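(* For positive integers $n,d$ and a positive real number $r$, let \[ S_{n,d}(r) = \left\{ \sum_{j=1}^n f_j : f_j = \sum_{k=0}^d a_{jk} x_j^k \in \mathbb{R}[x_j]_{\le d},\ |a_{jk}| \le r,\ 1 \le j \le n,\ 0 \le k \le d\right\}\simeq [-r,r]^{dn}\times[-nr,nr], \] let $S_{n,d}(\infty)=\bigcup_{r>0}S_{n,d}(r)$, and let $A_{n,d}$ be the set of $f\in\mathbb{R}[x_1,\dots,x_n]_{\le d}$ that are g-convex with respect to some connection on $\mathbb{R}^n$. Then for any positive integers $n$ and $d$, $\dim (S_{n,d}(\infty) \cap A_{n,d}) = nd+1$. Moreover, for each $r > 0$, if $S_{n,d}(r)$ is equipped with the uniform probability distribution, then the probability that $f \in S_{n,d}(r)$ is g-convex with respect to some connection is $O(1/\log d)$ (as $d\to\infty$).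
   Context: $\mathbb{R}[x_1,\dots,x_n]_{\le d}$ is the space of real polynomials of degree at most $d$; $\dim$ is topological dimension. The identification $S_{n,d}(r)\simeq[-r,r]^{dn}\times[-nr,nr]$ sends a polynomial to its coefficients, the last coordinate being the constant term. A connection means a smooth torsion-free affine connection $\nabla$ ($\nabla_XY-\nabla_YX=[X,Y]$). A smooth function $f$ on a manifold $\mathcal{M}$ is g-convex with respect to $\nabla$ if $f\circ\gamma:[0,1]\to\mathbb{R}$ is convex for every $\nabla$-geodesic $\gamma:[0,1]\to\mathcal{M}$; equivalently, $\mathrm{Hess}_\nabla f(X,Y)=X(Y(f))-(\nabla_XY)(f)$ is positive semidefinite at every point. *)

theory Defs
  imports "HOL-Analysis.Analysis" "HOL-Library.Poly_Mapping" "HOL-Library.Landau_Symbols"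
begin

section \<open>Real polynomials in finitely many variables\<close>

text \<open>A monomial is its finitely supported exponent vector, a polynomial its finitely supported
  family of coefficients; the variables are indexed by the finite type \<open>'n\<close>, so that
  \<open>n = CARD('n)\<close>.\<close>

type_synonym 'n rpoly = "('n \<Rightarrow>\<^sub>0 nat) \<Rightarrow>\<^sub>0 real"

definition eval_poly :: "'n::finite rpoly \<Rightarrow> real ^ 'n \<Rightarrow> real" where
  "eval_poly p x =
     (\<Sum>m\<in>Poly_Mapping.keys p. Poly_Mapping.lookup p m * (\<Prod>i\<in>UNIV. (x $ i) ^ Poly_Mapping.lookup m i))"

definition polys_le :: "nat \<Rightarrow> 'n::finite rpoly set" where
  "polys_le d = {p. \<forall>m\<in>Poly_Mapping.keys p. (\<Sum>i\<in>UNIV. Poly_Mapping.lookup m i) \<le> d}"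

text \<open>The topology of coefficientwise convergence. On every \<open>polys_le d\<close> it
  induces the usual topology of a finite-dimensional real vector space.\<close>

definition coeff_topology :: "'n::finite rpoly topology" where
  "coeff_topology = pullback_topology UNIV Poly_Mapping.lookup euclidean"

section \<open>Covering dimension\<close>

text \<open>\<open>covering_dim_le X k\<close>: every open cover has an open refinement in which no point lies
  in more than \<open>k + 1\<close> members. The range \<open>k \<ge> - 1\<close> gives the empty space dimension \<open>- 1\<close>;
  the dimension is \<open>\<infinity>\<close> if there is no bound.\<close>

definition covering_dim_le :: "'a topology \<Rightarrow> int \<Rightarrow> bool" where
  "covering_dim_le X k \<longleftrightarrow>
     (\<forall>\<C>. (\<forall>U\<in>\<C>. openin X U) \<and> \<Union>\<C> = topspace X \<longrightarrow>
       (\<exists>\<R>. (\<forall>V\<in>\<R>. openin X V \<and> (\<exists>U\<in>\<C>. V \<subseteq> U)) \<and> \<Union>\<R> = topspace X \<and>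
            (\<forall>x\<in>topspace X. finite {V\<in>\<R>. x \<in> V} \<and> int (card {V\<in>\<R>. x \<in> V}) \<le> k + 1)))"

definition covering_dim :: "'a topology \<Rightarrow> ereal" where
  "covering_dim X = Inf {ereal (of_int k) | k. k \<ge> - 1 \<and> covering_dim_le X k}"

section \<open>Connections and g-convexity\<close>

text \<open>\<open>k_times_cont_diff k f\<close> says that \<open>f\<close> is of class \<open>C\<^sup>k\<close> on the whole space, in terms of
  iterated directional derivatives.\<close>

fun k_times_cont_diff :: "nat \<Rightarrow> ('a::euclidean_space \<Rightarrow> 'b::real_normed_vector) \<Rightarrow> bool" where
  "k_times_cont_diff 0 f \<longleftrightarrow> continuous_on UNIV f"
| "k_times_cont_diff (Suc k) f \<longleftrightarrow>
     (\<forall>x. f differentiable (at x)) \<and>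
     (\<forall>v. k_times_cont_diff k (\<lambda>x. frechet_derivative f (at x) v))"

definition smooth :: "('a::euclidean_space \<Rightarrow> 'b::real_normed_vector) \<Rightarrow> bool" where
  "smooth f \<longleftrightarrow> (\<forall>k. k_times_cont_diff k f)"

type_synonym 'a vfield = "'a \<Rightarrow> 'a"

definition dir_deriv :: "'a::euclidean_space vfield \<Rightarrow> ('a \<Rightarrow> 'b::real_normed_vector) \<Rightarrow> 'a \<Rightarrow> 'b"
  where "dir_deriv X f = (\<lambda>p. frechet_derivative f (at p) (X p))"

definition lie_bracket :: "'a::euclidean_space vfield \<Rightarrow> 'a vfield \<Rightarrow> 'a vfield" where
  "lie_bracket X Y = (\<lambda>p. dir_deriv X Y p - dir_deriv Y X p)"

text \<open>Only the values of a connection on smooth vector fields matter. Homogeneity over the reals in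
  the second argument is the case of a constant \<open>f\<close> in the Leibniz rule.\<close>

definition connection :: "('a::euclidean_space vfield \<Rightarrow> 'a vfield \<Rightarrow> 'a vfield) \<Rightarrow> bool" where
  "connection D \<longleftrightarrow>
     (\<forall>X Y. smooth X \<and> smooth Y \<longrightarrow> smooth (D X Y)) \<and>
     (\<forall>X X' Y. smooth X \<and> smooth X' \<and> smooth Y \<longrightarrow>
        D (\<lambda>p. X p + X' p) Y = (\<lambda>p. D X Y p + D X' Y p)) \<and>
     (\<forall>f X Y. smooth (f :: 'a \<Rightarrow> real) \<and> smooth X \<and> smooth Y \<longrightarrow>
        D (\<lambda>p. f p *\<^sub>R X p) Y = (\<lambda>p. f p *\<^sub>R D X Y p)) \<and>
     (\<forall>X Y Y'. smooth X \<and> smooth Y \<and> smooth Y' \<longrightarrow>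
        D X (\<lambda>p. Y p + Y' p) = (\<lambda>p. D X Y p + D X Y' p)) \<and>
     (\<forall>f X Y. smooth (f :: 'a \<Rightarrow> real) \<and> smooth X \<and> smooth Y \<longrightarrow>
        D X (\<lambda>p. f p *\<^sub>R Y p) = (\<lambda>p. dir_deriv X f p *\<^sub>R Y p + f p *\<^sub>R D X Y p)) \<and>
     (\<forall>X Y. smooth X \<and> smooth Y \<longrightarrow>
        (\<lambda>p. D X Y p - D Y X p) = lie_bracket X Y)"

text \<open>The Christoffel symbols as a bilinear form: \<open>D\<close> applied to the constant vector
  fields \<open>u\<close>, \<open>v\<close>, evaluated at \<open>p\<close>.\<close>

definition christoffel ::
  "('a::euclidean_space vfield \<Rightarrow> 'a vfield \<Rightarrow> 'a vfield) \<Rightarrow> 'a \<Rightarrow> 'a \<Rightarrow> 'a \<Rightarrow> 'a" where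
  "christoffel D p u v = D (\<lambda>_. u) (\<lambda>_. v) p"

text \<open>The geodesic equation \<open>\<gamma>'' + \<Gamma>(\<gamma>', \<gamma>') = 0\<close> on \<open>[0,1]\<close>, with one-sided derivatives at the
  end points and \<open>v = \<gamma>'\<close>. Solutions are automatically smooth.\<close>

definition geodesic ::
  "('a::euclidean_space vfield \<Rightarrow> 'a vfield \<Rightarrow> 'a vfield) \<Rightarrow> (real \<Rightarrow> 'a) \<Rightarrow> bool" where
  "geodesic D \<gamma> \<longleftrightarrow>
     (\<exists>v. \<forall>t\<in>{0..1}.
        (\<gamma> has_vector_derivative v t) (at t within {0..1}) \<and>
        (v has_vector_derivative - christoffel D (\<gamma> t) (v t) (v t)) (at t within {0..1}))"

definition g_convex ::
  "('a::euclidean_space vfield \<Rightarrow> 'a vfield \<Rightarrow> 'a vfield) \<Rightarrow> ('a \<Rightarrow> real) \<Rightarrow> bool" where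
  "g_convex D f \<longleftrightarrow> smooth f \<and> (\<forall>\<gamma>. geodesic D \<gamma> \<longrightarrow> convex_on {0..1} (f \<circ> \<gamma>))"

definition g_convex_polys :: "nat \<Rightarrow> 'n::finite rpoly set" where
  "g_convex_polys d = {p \<in> polys_le d. \<exists>D. connection D \<and> g_convex D (eval_poly p)}"

section \<open>Separable polynomials and their uniform distribution\<close>

definition sep_polys :: "nat \<Rightarrow> real \<Rightarrow> 'n::finite rpoly set" where
  "sep_polys d r =
     {\<Sum>j\<in>UNIV. \<Sum>k\<le>d. Poly_Mapping.single (Poly_Mapping.single j k) (a j k) | a.
        \<forall>j. \<forall>k\<le>d. \<bar>a j k\<bar> \<le> r}"

definition sep_polys_inf :: "nat \<Rightarrow> 'n::finite rpoly set" where
  "sep_polys_inf d = (\<Union>r\<in>{0<..}. sep_polys d r)"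

text \<open>The exponent vectors of \<open>1\<close> and of \<open>x\<^sub>j ^ k\<close>, \<open>1 \<le> k \<le> d\<close>; there are \<open>n d + 1\<close> of them, as
  \<open>x\<^sub>j ^ 0\<close> is the same monomial for all \<open>j\<close>.\<close>

definition sep_monoms :: "nat \<Rightarrow> ('n::finite \<Rightarrow>\<^sub>0 nat) set" where
  "sep_monoms d = {Poly_Mapping.single j k | j k. k \<le> d}"

definition poly_of_coeffs :: "nat \<Rightarrow> (('n::finite \<Rightarrow>\<^sub>0 nat) \<Rightarrow> real) \<Rightarrow> 'n rpoly" where
  "poly_of_coeffs d c = (\<Sum>m\<in>sep_monoms d. Poly_Mapping.single m (c m))"

text \<open>Lebesgue (not just Borel) measure in the \<open>n d + 1\<close> coefficients, transported to
  polynomials.\<close>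

definition sep_lebesgue :: "nat \<Rightarrow> 'n::finite rpoly measure" where
  "sep_lebesgue d =
     embed_measure (completion (\<Pi>\<^sub>M m\<in>sep_monoms d. lborel)) (poly_of_coeffs d)"

definition sep_uniform :: "nat \<Rightarrow> real \<Rightarrow> 'n::finite rpoly measure" where
  "sep_uniform d r = uniform_measure (sep_lebesgue d) (sep_polys d r)"

text \<open>In these coordinates \<open>sep_polys d r\<close> is the box \<open>[-r,r]^(d n) \<times> [-n r, n r]\<close>.\<close>

lemma finite_sep_monoms: "finite (sep_monoms d :: ('n::finite \<Rightarrow>\<^sub>0 nat) set)"
proof -
  have "sep_monoms d = (\<lambda>(j::'n, k). Poly_Mapping.single j k) ` (UNIV \<times> {..d})"
    unfolding sep_monoms_def by auto
  then show ?thesis by simp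
qed

lemma lookup_poly_of_coeffs:
  "Poly_Mapping.lookup (poly_of_coeffs d c) m = (if m \<in> sep_monoms d then c m else 0)"
  by (auto simp: poly_of_coeffs_def lookup_sum lookup_single when_def finite_sep_monoms)

lemma inj_on_poly_of_coeffs:
  "inj_on (poly_of_coeffs d) (\<Pi>\<^sub>E m\<in>(sep_monoms d :: ('n::finite \<Rightarrow>\<^sub>0 nat) set). UNIV)"
proof (rule inj_onI)
  fix b c :: "('n \<Rightarrow>\<^sub>0 nat) \<Rightarrow> real"
  assume *: "b \<in> (\<Pi>\<^sub>E m\<in>sep_monoms d. UNIV)" "c \<in> (\<Pi>\<^sub>E m\<in>sep_monoms d. UNIV)"
    and eq: "poly_of_coeffs d b = poly_of_coeffs d c"
  show "b = c"
  proof (rule PiE_ext[OF *])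
    fix m :: "'n \<Rightarrow>\<^sub>0 nat" assume "m \<in> sep_monoms d"
    then show "b m = c m"
      using arg_cong[OF eq, of "\<lambda>p. Poly_Mapping.lookup p m"] by (simp add: lookup_poly_of_coeffs)
  qed
qed

lemma single_eq_0_iff: "Poly_Mapping.single j k = 0 \<longleftrightarrow> k = (0::nat)"
  by (metis lookup_single_eq lookup_zero single_zero)

lemma single_eq_iff:
  "k \<noteq> (0::nat) \<Longrightarrow> Poly_Mapping.single i l = Poly_Mapping.single j k \<longleftrightarrow> i = j \<and> l = k"
  by (metis lookup_single_eq lookup_single_not_eq)

lemma lookup_sep:
  fixes a :: "'n::finite \<Rightarrow> nat \<Rightarrow> real"
  shows "Poly_Mapping.lookup (\<Sum>j\<in>UNIV. \<Sum>k\<le>d. Poly_Mapping.single (Poly_Mapping.single j k) (a j k)) 0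
           = (\<Sum>j\<in>UNIV. a j 0)"
    and "k \<noteq> 0 \<Longrightarrow> k \<le> d \<Longrightarrow>
         Poly_Mapping.lookup (\<Sum>j\<in>UNIV. \<Sum>k\<le>d. Poly_Mapping.single (Poly_Mapping.single j k) (a j k))
           (Poly_Mapping.single i k) = a i k"
    and "m \<notin> sep_monoms d \<Longrightarrow>
         Poly_Mapping.lookup (\<Sum>j\<in>UNIV. \<Sum>k\<le>d. Poly_Mapping.single (Poly_Mapping.single j k) (a j k)) m = 0"
proof -
  show "Poly_Mapping.lookup (\<Sum>j\<in>UNIV. \<Sum>k\<le>d. Poly_Mapping.single (Poly_Mapping.single j k) (a j k)) 0
           = (\<Sum>j\<in>UNIV. a j 0)"
    by (simp add: lookup_sum lookup_single when_def single_eq_0_iff)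
next
  assume k: "k \<noteq> 0" "k \<le> d"
  have "(\<Sum>l\<le>d. a j l when Poly_Mapping.single j l = Poly_Mapping.single i k)
          = (if j = i then a i k else 0)" for j
  proof -
    have "(\<Sum>l\<le>d. a j l when Poly_Mapping.single j l = Poly_Mapping.single i k)
        = (\<Sum>l\<le>d. if l = k then (if j = i then a i k else 0) else 0)"
      by (rule sum.cong) (auto simp: when_def single_eq_iff[OF k(1)])
    then show ?thesis using k by simp
  qed
  then show "Poly_Mapping.lookup (\<Sum>j\<in>UNIV. \<Sum>k\<le>d. Poly_Mapping.single (Poly_Mapping.single j k) (a j k))
           (Poly_Mapping.single i k) = a i k"
    by (simp add: lookup_sum lookup_single)
next
  assume "m \<notin> sep_monoms d"
  then have "Poly_Mapping.single j l \<noteq> m" if "l \<le> d" for j l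
    using that by (auto simp: sep_monoms_def)
  then show "Poly_Mapping.lookup (\<Sum>j\<in>UNIV. \<Sum>k\<le>d. Poly_Mapping.single (Poly_Mapping.single j k) (a j k)) m = 0"
    by (auto simp: lookup_sum lookup_single when_def intro!: sum.neutral)
qed

lemma sep_polys_eq_box:
  "(sep_polys d r :: 'n::finite rpoly set) =
     poly_of_coeffs d ` (\<Pi>\<^sub>E m\<in>sep_monoms d. if m = 0 then {- (real CARD('n) * r)..real CARD('n) * r}
                                                else {- r..r})"
    (is "_ = _ ` ?B")
proof (intro equalityI subsetI)
  fix p :: "'n rpoly" assume "p \<in> sep_polys d r"
  then obtain a :: "'n \<Rightarrow> nat \<Rightarrow> real" where
    p: "p = (\<Sum>j\<in>UNIV. \<Sum>k\<le>d. Poly_Mapping.single (Poly_Mapping.single j k) (a j k))"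
    and a: "\<And>j k. k \<le> d \<Longrightarrow> \<bar>a j k\<bar> \<le> r"
    unfolding sep_polys_def by blast
  define c where "c = restrict (Poly_Mapping.lookup p) (sep_monoms d)"
  have "p = poly_of_coeffs d c"
    by (rule poly_mapping_eqI) (auto simp: lookup_poly_of_coeffs c_def p lookup_sep(3))
  moreover have "c \<in> ?B"
  proof (rule PiE_I)
    fix m :: "'n \<Rightarrow>\<^sub>0 nat" assume m: "m \<in> sep_monoms d"
    have "\<bar>\<Sum>j\<in>UNIV. a j 0\<bar> \<le> (\<Sum>j\<in>(UNIV::'n set). r)"
      by (rule order_trans[OF sum_abs sum_mono]) (simp add: a)
    then have 0: "\<bar>Poly_Mapping.lookup p 0\<bar> \<le> real CARD('n) * r"
      by (simp add: p lookup_sep(1))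
    obtain j k where jk: "m = Poly_Mapping.single j k" "k \<le> d"
      using m by (auto simp: sep_monoms_def)
    have "\<bar>Poly_Mapping.lookup p m\<bar> \<le> r" if "m \<noteq> 0"
      using that a jk by (simp add: p lookup_sep(2) single_eq_0_iff)
    with 0 m show "c m \<in> (if m = 0 then {- (real CARD('n) * r)..real CARD('n) * r} else {- r..r})"
      by (auto simp: c_def abs_le_iff minus_le_iff)
  qed (simp add: c_def)
  ultimately show "p \<in> poly_of_coeffs d ` ?B" by blast
next
  fix p :: "'n rpoly" assume "p \<in> poly_of_coeffs d ` ?B"
  then obtain c where p: "p = poly_of_coeffs d c" and c: "c \<in> ?B" by blast
  define a where "a j k = (if k = 0 then c 0 / real CARD('n) else c (Poly_Mapping.single j k))"
    for j :: 'n and k :: nat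
  have "\<bar>a j k\<bar> \<le> r" if "k \<le> d" for j k
  proof -
    have "Poly_Mapping.single j k \<in> sep_monoms d" using that by (auto simp: sep_monoms_def)
    from PiE_mem[OF c this] show ?thesis
      by (auto simp: a_def single_eq_0_iff field_simps abs_le_iff split: if_splits)
  qed
  moreover have "p = (\<Sum>j\<in>UNIV. \<Sum>k\<le>d. Poly_Mapping.single (Poly_Mapping.single j k) (a j k))"
  proof (rule poly_mapping_eqI)
    fix m
    show "Poly_Mapping.lookup p m = Poly_Mapping.lookup (\<Sum>j\<in>UNIV. \<Sum>k\<le>d. Poly_Mapping.single (Poly_Mapping.single j k) (a j k)) m"
    proof (cases "m \<in> sep_monoms d")
      case True
      then obtain j k where jk: "m = Poly_Mapping.single j k" "k \<le> d"
        by (auto simp: sep_monoms_def)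
      show ?thesis
      proof (cases "k = 0")
        case True
        then have "m = 0" using jk by simp
        then show ?thesis using \<open>m \<in> sep_monoms d\<close>
          by (simp add: p lookup_poly_of_coeffs lookup_sep(1) a_def)
      next
        case False
        then show ?thesis using jk True
          by (simp add: p lookup_poly_of_coeffs lookup_sep(2) a_def)
      qed
    qed (simp add: p lookup_poly_of_coeffs lookup_sep(3))
  qed
  ultimately show "p \<in> sep_polys d r" unfolding sep_polys_def by blast
qed

end

theory Submission
  imports Defs "HOL-Probability.Probability" "HOL-Real_Asymp.Real_Asymp"
    "HOL-Computational_Algebra.Fundamental_Theorem_Algebra"
begin

text \<open>
A function is g-convex for some connection as soon as it can be made to have positive semidefinite
Hessian by subtracting \<open>df \<circ> \<Gamma>\<close>, and conversely its ordinary Hessian is positive semidefinite at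
every critical point, because geodesics start there in all directions. For a separable
\<open>f = \<Sum>f\<^sub>j(x\<^sub>j)\<close> whose \<open>f\<^sub>j\<close> have only nondegenerate critical points this leaves two cases: some
\<open>f\<^sub>j'\<close> has no zero, or every \<open>f\<^sub>j''\<close> is positive at all zeros of \<open>f\<^sub>j'\<close>; in both
\<open>\<Gamma>(u,v) = - (\<Sum>K (1 + x\<^sub>i\<^sup>2)\<^sup>d u\<^sub>i v\<^sub>i) \<nabla>f\<close> works for large \<open>K\<close>. Degenerate polynomials form a null set,
so the g-convex ones are Lebesgue measurable. They contain a cube of full dimension \<open>n d + 1\<close>, and the
dimension follows from Lebesgue's covering theorem.

In either case some \<open>f\<^sub>j'\<close> never changes its sign from plus to minus. With \<open>a\<^sub>k\<close> uniform,
\<open>\<Sum>k a\<^sub>k x\<^sup>k\<^sup>-\<^sup>1\<close> at points \<open>x\<close> approaching \<open>1\<close> very rapidly is dominated by disjoint blocks of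
coefficients, so flipping the signs of the blocks makes the signs at \<open>m\<close> such points independent and
fair, and the probability is about \<open>(m + 1) / 2 ^ m\<close>.
\<close>

section \<open>Covering dimension\<close>

text \<open>A connection acts on the Hessian only through \<open>df\<close>, and \<open>df\<close>
  vanishes only where every \<open>f_j'\<close> does; hence a single \<open>f_j\<close> without
  critical points settles g-convexity, whatever the other summands do. The weight
  \<open>(1 + x_i^2)^d\<close> is there because \<open>f_i''\<close> may grow at infinity while the
  gradient is merely bounded below.

  At degenerate polynomials g-convexity stays undecided, so the shape of the set is unknown there.
  The upper bound on the dimension is therefore proved for arbitrary subspaces of N-space, and the
  cube inside the set is exploited through a retraction of all coefficient vectors onto it.

  The rate \<open>1 / ln d\<close> comes from counting scales. Domination by one block forces
  \<open>ln N_i\<close> to grow geometrically, so the number \<open>m\<close> of sample points is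
  only about the logarithm of \<open>ln d / ln (ln d)\<close> to the base 7/4. A base below 2 lets
  \<open>2 ^ m\<close> outgrow \<open>ln d\<close> by a power, which pays for \<open>m + 1\<close>;
  a base above 3/2 is forced by the size \<open>b powr (3/2)\<close> of the lower blocks.\<close>

text \<open>\<open>V m\<close> collects the points with some ball that meets \<open>C m\<close> and
  at most \<open>k\<close> members in all. Balls around one point are nested, so finitely many
  indices at a point all occur in the ball of largest radius; this bounds the order at every point
  of the space, not only on \<open>Q\<close>.\<close>

lemma fatten_closed_family:
  fixes C :: "nat \<Rightarrow> 'a::metric_space set"
  assumes loc: "\<And>x. x \<in> Q \<Longrightarrow> \<exists>s>0. finite {m. C m \<inter> ball x s \<noteq> {}} \<and> card {m. C m \<inter> ball x s \<noteq> {}} \<le> k"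
  obtains V where "\<And>m. open (V m)" "\<And>m. C m \<inter> Q \<subseteq> V m"
    "\<And>x. finite {m. x \<in> V m} \<and> card {m. x \<in> V m} \<le> k"
proof -
  define A where "A x s = {m. C m \<inter> ball x s \<noteq> {}}" for x s
  define P where "P x s \<longleftrightarrow> finite (A x s) \<and> card (A x s) \<le> k" for x s
  define V where "V m = {x. \<exists>s. P x s \<and> m \<in> A x s}" for m
  have A_mono: "A y s \<subseteq> A x t" if "ball y s \<subseteq> ball x t" for x y s t
    using that unfolding A_def by blast
  have P_mono: "P y s" if "ball y s \<subseteq> ball x t" "P x t" for x y s t
    using A_mono[OF that(1)] that(2) unfolding P_def
    by (meson card_mono finite_subset order_trans)
  show thesis
  proof
    show "open (V m)" for m
      unfolding open_contains_ball
    proof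
      fix x assume "x \<in> V m"
      then obtain s y where s: "P x s" "y \<in> C m" "dist x y < s"
        unfolding V_def A_def by auto
      \<comment> \<open>Half the slack: for \<open>dist x z < e\<close> the ball of radius
        \<open>s - e\<close> around \<open>z\<close> stays inside \<open>ball x s\<close> and still
        contains the witness \<open>y\<close>.\<close>
      define e where "e = (s - dist x y) / 2"
      have e: "e > 0" "dist x y + 2 * e = s" using s(3) by (auto simp: e_def field_simps)
      have "z \<in> V m" if "dist x z < e" for z
      proof -
        have "ball z (s - e) \<subseteq> ball x s"
        proof
          fix w assume "w \<in> ball z (s - e)"
          then show "w \<in> ball x s" using dist_triangle[of x w z] that by simp
        qed
        then have "P z (s - e)" using s(1) P_mono by blast
        moreover have "y \<in> ball z (s - e)"
          using dist_triangle[of z y x] that e by (simp add: dist_commute)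
        ultimately show ?thesis using s(2) unfolding V_def A_def by blast
      qed
      then show "\<exists>e>0. ball x e \<subseteq> V m" using e(1) by (auto simp: subset_eq)
    qed
    show "C m \<inter> Q \<subseteq> V m" for m
    proof
      fix x assume x: "x \<in> C m \<inter> Q"
      then obtain s where "s > 0" "P x s" using loc[of x] unfolding P_def A_def by auto
      moreover have "x \<in> C m \<inter> ball x s" using x \<open>s > 0\<close> by simp
      ultimately show "x \<in> V m" unfolding V_def A_def by blast
    qed
    show "finite {m. x \<in> V m} \<and> card {m. x \<in> V m} \<le> k" for x
    proof (rule finite_if_finite_subsets_card_bdd)
      fix G assume G: "G \<subseteq> {m. x \<in> V m}" "finite G"
      then have "\<forall>m\<in>G. \<exists>s. P x s \<and> m \<in> A x s" by (auto simp: V_def)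
      then obtain s where s: "\<And>m. m \<in> G \<Longrightarrow> P x (s m) \<and> m \<in> A x (s m)" by metis
      show "card G \<le> k"
      proof (cases "G = {}")
        case False
        have "Max (s ` G) \<in> s ` G" using False G(2) by (intro Max_in) auto
        then obtain n where n: "n \<in> G" "Max (s ` G) = s n" by auto
        have "G \<subseteq> A x (s n)"
        proof
          fix m assume m: "m \<in> G"
          have "s m \<le> s n" using m G(2) n(2) by (metis Max_ge finite_imageI imageI)
          then show "m \<in> A x (s n)" using s[OF m] A_mono[of x "s m" x "s n"] by (auto simp: subset_ball)
        qed
        then show ?thesis using s[OF n(1)] card_mono unfolding P_def by (metis order_trans)
      qed simp
    qed
  qed
qed

text \<open>The family \<open>C\<close> is locally finite on the union of the \<open>B l\<close> without further assumptions, since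
  \<open>B l\<close> meets \<open>C m\<close> only for \<open>m \<le> l\<close>.\<close>

lemma open_cover_shrink_order:
  fixes B C :: "nat \<Rightarrow> 'a::metric_space set"
  assumes "\<And>m. open (B m)" "\<And>m. closed (D m)" "\<And>m. B m \<subseteq> D m"
    and C: "\<And>m. C m = D m - (\<Union>l<m. B l)"
    and ord: "\<And>x. finite {m. x \<in> C m} \<and> card {m. x \<in> C m} \<le> k"
  obtains V where "\<And>m. open (V m)" "(\<Union>m. B m) \<subseteq> (\<Union>m. V m \<inter> D m)"
    "\<And>x. finite {m. x \<in> V m} \<and> card {m. x \<in> V m} \<le> k"
proof -
  let ?Q = "\<Union>m. B m"
  have loc: "\<exists>s>0. finite {m. C m \<inter> ball x s \<noteq> {}} \<and> card {m. C m \<inter> ball x s \<noteq> {}} \<le> k" if x: "x \<in> ?Q" for x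
  proof -
    obtain l where l: "x \<in> B l" using x by blast
    let ?F = "{m\<in>{..l}. x \<notin> C m}"
    have clC: "closed (C m)" for m unfolding C using assms by (intro closed_Diff open_UN) auto
    \<comment> \<open>Inside \<open>B l\<close> only \<open>C 0\<close>, ..., \<open>C l\<close>
      occur; deleting the finitely many closed ones that miss \<open>x\<close> leaves a
      neighbourhood meeting only members that contain \<open>x\<close>.\<close>
    have "open (B l - (\<Union>m\<in>?F. C m))"
      using clC assms by (intro open_Diff closed_UN) auto
    then obtain s where s: "s > 0" "ball x s \<subseteq> B l - (\<Union>m\<in>?F. C m)"
      using l open_contains_ball[of "B l - (\<Union>m\<in>?F. C m)"] by blast
    have "{m. C m \<inter> ball x s \<noteq> {}} \<subseteq> {m. x \<in> C m}"
    proof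
      fix m assume "m \<in> {m. C m \<inter> ball x s \<noteq> {}}"
      then obtain y where y: "y \<in> C m" "y \<in> ball x s" by blast
      then have "y \<in> B l" "y \<notin> (\<Union>m\<in>?F. C m)" using s by auto
      then have "m \<le> l" using y C[of m] by (metis DiffD2 UN_I lessThan_iff not_less)
      then show "m \<in> {m. x \<in> C m}" using \<open>y \<notin> _\<close> y by auto
    qed
    then show ?thesis using s(1) ord[of x] by (meson card_mono finite_subset order_trans)
  qed
  obtain V where V: "\<And>m. open (V m)" "\<And>m. C m \<inter> ?Q \<subseteq> V m"
    "\<And>x. finite {m. x \<in> V m} \<and> card {m. x \<in> V m} \<le> k"
    using fatten_closed_family[of ?Q C k] loc by blast
  have "?Q \<subseteq> (\<Union>m. V m \<inter> D m)"
  proof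
    fix x assume x: "x \<in> ?Q"
    define m where "m = (LEAST m. x \<in> B m)"
    have "x \<in> B m" using x unfolding m_def by (metis LeastI UN_iff)
    moreover have "x \<notin> B l" if "l < m" for l using that not_less_Least unfolding m_def by blast
    ultimately have "x \<in> C m" "x \<in> D m" using C assms(3) by blast+
    then show "x \<in> (\<Union>m. V m \<inter> D m)" using V(2)[of m] x by blast
  qed
  with V show thesis using that by blast
qed

text \<open>The dimension \<open>N\<close> is a term, so a point of N-space is a function on
  \<open>nat\<close>, and a box is a cylinder that restricts only the first \<open>N\<close>
  coordinates.\<close>

definition obox :: "nat \<Rightarrow> (nat \<Rightarrow> real) \<Rightarrow> real \<Rightarrow> (nat \<Rightarrow> real) set" where
  "obox N q t = {x. \<forall>i<N. \<bar>x i - q i\<bar> < t}"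

definition closed_box :: "nat \<Rightarrow> (nat \<Rightarrow> real) \<Rightarrow> real \<Rightarrow> (nat \<Rightarrow> real) set" where
  "closed_box N q t = {x. \<forall>i<N. \<bar>x i - q i\<bar> \<le> t}"

lemma open_obox: "open (obox N q t)"
proof -
  have "obox N q t = (\<Inter>i\<in>{..<N}. {x. \<bar>x i - q i\<bar> < t})" by (auto simp: obox_def)
  moreover have "open {x::nat \<Rightarrow> real. \<bar>x i - q i\<bar> < t}" for i
    by (intro open_Collect_less continuous_intros) simp
  ultimately show ?thesis by auto
qed

lemma closed_closed_box: "closed (closed_box N q t)"
proof -
  have "closed_box N q t = (\<Inter>i\<in>{..<N}. {x. \<bar>x i - q i\<bar> \<le> t})" by (auto simp: closed_box_def)
  moreover have "closed {x::nat \<Rightarrow> real. \<bar>x i - q i\<bar> \<le> t}" for i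
    by (intro closed_Collect_le continuous_intros) simp
  ultimately show ?thesis by auto
qed

text \<open>A point on the boundaries of several boxes uses a different coordinate for each of them.\<close>

lemma generic_boxes_order:
  fixes q :: "nat \<Rightarrow> nat \<Rightarrow> real" and t :: "nat \<Rightarrow> real"
  assumes q: "\<And>m i. q m i \<in> \<rat>"
    and gen: "\<And>l m. l < m \<Longrightarrow> t m - t l \<notin> \<rat> \<and> t m + t l \<notin> \<rat>"
    and C: "\<And>m. C m \<subseteq> closed_box N (q m) (t m) - (\<Union>l\<in>{l. l < m \<and> J l}. obox N (q l) (t l))"
    and J: "\<And>m. C m \<noteq> {} \<Longrightarrow> J m"
  shows "finite {m. x \<in> C m} \<and> card {m. x \<in> C m} \<le> Suc N"
proof (rule finite_if_finite_subsets_card_bdd)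
  fix G assume G: "G \<subseteq> {m. x \<in> C m}" "finite G"
  show "card G \<le> Suc N"
  proof (cases "G = {}")
    case False
    define G' where "G' = G - {Max G}"
    have MG: "Max G \<in> G" using False G(2) by simp
    \<comment> \<open>Membership in \<open>C (Max G)\<close> keeps \<open>x\<close> out of all
      earlier open boxes, so every member of \<open>G\<close> but the last has \<open>x\<close> on
      its boundary. The last one accounts for the 1 in \<open>Suc N\<close>.\<close>
    have "\<exists>i<N. \<bar>x i - q m i\<bar> = t m" if "m \<in> G'" for m
    proof -
      have m: "m \<in> G" "m < Max G" using that G(2) unfolding G'_def
        by (auto simp: order.not_eq_order_implies_strict)
      have "J m" using G(1) m J by blast
      then have "x \<in> closed_box N (q m) (t m)" "x \<notin> obox N (q m) (t m)"
        using C[of m] C[of "Max G"] G(1) m MG by blast+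
      then show ?thesis by (auto simp: obox_def closed_box_def not_less intro: antisym)
    qed
    then obtain f where f: "\<And>m. m \<in> G' \<Longrightarrow> f m < N \<and> \<bar>x (f m) - q m (f m)\<bar> = t m" by metis
    \<comment> \<open>As the centres are rational, two boundary equations in the same coordinate
      would make the sum or the difference of the widths rational.\<close>
    have neq: "\<not> (\<bar>x i - q m i\<bar> = t m \<and> \<bar>x i - q l i\<bar> = t l)" if "l < m" for l m i
    proof
      assume "\<bar>x i - q m i\<bar> = t m \<and> \<bar>x i - q l i\<bar> = t l"
      then consider "t m - t l = q l i - q m i" | "t m - t l = q m i - q l i"
        | "t m + t l = q m i - q l i" | "t m + t l = q l i - q m i" by (auto simp: abs_if split: if_splits)
      then show False using gen[OF that] q by cases (metis Rats_diff)+
    qed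
    have "inj_on f G'"
    proof (rule inj_onI)
      fix l m assume "l \<in> G'" "m \<in> G'" "f l = f m"
      then show "l = m" using f neq[of l m "f l"] neq[of m l "f l"] by (metis nat_neq_iff)
    qed
    then have "card G' \<le> card {..<N}" using f by (intro card_inj_on_le) auto
    then show ?thesis using G(2) MG unfolding G'_def by simp
  qed simp
qed

text \<open>The widths are chosen recursively: each predecessor excludes only countably many values
  from an open interval.\<close>

lemma generic_widths:
  fixes \<rho> :: "nat \<Rightarrow> real"
  shows "\<exists>t. \<forall>m. (\<rho> m > 0 \<longrightarrow> \<rho> m < t m \<and> t m < 2 * \<rho> m) \<and>
           (\<forall>l<m. t m - t l \<notin> \<rat> \<and> t m + t l \<notin> \<rat>)"
proof -
  define P where "P f m y \<longleftrightarrow> (\<rho> m > 0 \<longrightarrow> \<rho> m < y \<and> y < 2 * \<rho> m) \<and>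
           (\<forall>l<m. y - f l \<notin> \<rat> \<and> y + f l \<notin> \<rat>)" for f :: "nat \<Rightarrow> real" and m y
  have "\<exists>f. \<forall>m. P f m (f m)"
  proof (rule dependent_wf_choice[of less_than])
    show "wf less_than" by simp
    show "P f m y = P g m y" if "\<And>z. (z, m) \<in> less_than \<Longrightarrow> f z = g z" for f g m y
    proof -
      have "f l = g l" if "l < m" for l using that \<open>\<And>z. (z, m) \<in> less_than \<Longrightarrow> f z = g z\<close> by simp
      then show ?thesis unfolding P_def by (simp cong: all_cong)
    qed
    fix m and f :: "nat \<Rightarrow> real"
    \<comment> \<open>If \<open>\<rho> m\<close> is not positive, the width is unconstrained and the
      unit interval is a default.\<close>
    define a b where "a = (if \<rho> m > 0 then \<rho> m else 0)" and "b = (if \<rho> m > 0 then 2 * \<rho> m else 1)"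
    have ab: "a < b" by (auto simp: a_def b_def)
    let ?S = "(\<Union>l<m. (\<lambda>z. f l + z) ` \<rat> \<union> (\<lambda>z. z - f l) ` \<rat>)"
    have S: "countable ?S"
      by (intro countable_Un countable_UN countable_image countable_rat) auto
    obtain y where y: "y \<in> {a<..<b}" "y \<notin> ?S"
      using real_interval_avoid_countable_set[OF ab S] by (elim bexE)
    have "y - f l \<notin> \<rat> \<and> y + f l \<notin> \<rat>" if "l < m" for l
    proof -
      have "y \<notin> (\<lambda>z. f l + z) ` \<rat>" "y \<notin> (\<lambda>z. z - f l) ` \<rat>" using y(2) that by blast+
      moreover have "y = f l + (y - f l)" "y = (y + f l) - f l" by simp_all
      ultimately show ?thesis by (metis imageI)
    qed
    moreover have "a < y" "y < b" using y(1) by simp_all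
    ultimately have "P f m y" unfolding P_def a_def b_def by (simp split: if_splits)
    then show "\<exists>y. P f m y" by blast
  qed
  then show ?thesis unfolding P_def by blast
qed


text \<open>The closed box has twice the radius because the generic width that later replaces
  \<open>\<rho>\<close> is only known to lie below \<open>2 * \<rho>\<close>. The codes of type
  \<open>rat list\<close> and \<open>rat\<close> keep the family of boxes countable.\<close>

lemma rational_box_in_cylinder:
  fixes H :: "(nat \<Rightarrow> real) set"
  assumes "open H" "x \<in> H" and cyl: "\<And>y z. (\<And>i. i < N \<Longrightarrow> y i = z i) \<Longrightarrow> y \<in> H \<Longrightarrow> z \<in> H"
  obtains xs :: "rat list" and \<rho> :: rat where "\<rho> > 0"
    "closed_box N (\<lambda>i. if i < length xs then real_of_rat (xs ! i) else 0) (2 * real_of_rat \<rho>) \<subseteq> H"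
    "x \<in> obox N (\<lambda>i. if i < length xs then real_of_rat (xs ! i) else 0) (real_of_rat \<rho>)"
proof -
  have "openin (product_topology (\<lambda>i. euclidean) UNIV) H"
    using assms(1) by (simp add: euclidean_product_topology)
  from product_topology_open_contains_basis[OF this assms(2)]
  obtain V where V: "x \<in> Pi\<^sub>E UNIV V" "\<And>i. open (V i)" "Pi\<^sub>E UNIV V \<subseteq> H" by auto
  have "\<exists>e>0. ball (x i) e \<subseteq> V i" for i using V(1,2) open_contains_ball by blast
  then obtain e where e: "\<And>i. e i > 0" "\<And>i. ball (x i) (e i) \<subseteq> V i" by metis
  define m where "m = Min (insert 1 (e ` {..<N}))"
  have m: "m > 0" "\<And>i. i < N \<Longrightarrow> m \<le> e i" using e(1) by (auto simp: m_def)
  \<comment> \<open>A third suffices: \<open>x\<close> is within \<open>\<rho>\<close> of the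
    centre, so the box of radius \<open>2 * \<rho>\<close> stays within
    \<open>3 * \<rho> < m\<close> of \<open>x\<close> in the first \<open>N\<close>
    coordinates.\<close>
  obtain \<rho> where \<rho>: "0 < real_of_rat \<rho>" "real_of_rat \<rho> < m / 3"
    using of_rat_dense[of 0 "m / 3"] m(1) by auto
  have "\<exists>y. x i - real_of_rat \<rho> < real_of_rat y \<and> real_of_rat y < x i + real_of_rat \<rho>" for i
    using of_rat_dense[of "x i - real_of_rat \<rho>" "x i + real_of_rat \<rho>"] \<rho>(1) by auto
  then obtain y where y: "\<And>i. x i - real_of_rat \<rho> < real_of_rat (y i) \<and> real_of_rat (y i) < x i + real_of_rat \<rho>"
    by metis
  define xs where "xs = map y [0..<N]"
  define q where "q i = (if i < length xs then real_of_rat (xs ! i) else 0)" for i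
  have q: "q i = real_of_rat (y i)" if "i < N" for i using that by (simp add: q_def xs_def)
  have xq: "\<bar>x i - q i\<bar> < real_of_rat \<rho>" if "i < N" for i
    using y[of i] q[OF that] by (simp add: abs_less_iff algebra_simps)
  have "closed_box N q (2 * real_of_rat \<rho>) \<subseteq> H"
  proof
    fix z assume z: "z \<in> closed_box N q (2 * real_of_rat \<rho>)"
    define z' where "z' i = (if i < N then z i else x i)" for i
    have "z' i \<in> V i" for i
    proof (cases "i < N")
      case True
      have "\<bar>z i - q i\<bar> \<le> 2 * real_of_rat \<rho>" using z True by (simp add: closed_box_def)
      then have "\<bar>x i - z i\<bar> < e i" using xq[OF True] \<rho>(2) m(2)[OF True] by linarith
      then show ?thesis using e(2)[of i] True by (auto simp: z'_def dist_real_def subset_eq)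
    next
      case False
      then show ?thesis using V(1) by (auto simp: z'_def PiE_def Pi_def)
    qed
    then have "z' \<in> H" using V(3) by (auto simp: PiE_def Pi_def)
    then show "z \<in> H" by (rule cyl[rotated]) (simp add: z'_def)
  qed
  moreover have "x \<in> obox N q (real_of_rat \<rho>)" using xq by (simp add: obox_def)
  ultimately show thesis using that[of \<rho> xs] \<rho>(1) unfolding q_def by simp
qed

text \<open>The rational boxes fitting into a member of the cover, taken with generic widths, are
  turned into an open family of order \<open>N + 1\<close>. That bound holds at every point of
  N-space and so passes to any subspace.\<close>

lemma covering_dim_le_embedding:
  fixes X :: "'a topology" and \<phi> :: "'a \<Rightarrow> nat \<Rightarrow> real"
  assumes emb: "\<And>U. openin X U \<Longrightarrow> \<exists>G. open G \<and> U = {p \<in> topspace X. \<phi> p \<in> G}"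
    and cont: "\<And>G. open G \<Longrightarrow> openin X {p \<in> topspace X. \<phi> p \<in> G}"
    and supp: "\<And>p i. p \<in> topspace X \<Longrightarrow> N \<le> i \<Longrightarrow> \<phi> p i = 0"
  shows "covering_dim_le X (int N)"
  unfolding covering_dim_le_def
proof (intro allI impI)
  fix \<C> assume \<C>: "(\<forall>U\<in>\<C>. openin X U) \<and> \<Union>\<C> = topspace X"
  have "\<forall>U\<in>\<C>. \<exists>G. open G \<and> U = {p \<in> topspace X. \<phi> p \<in> G}" using \<C> emb by blast
  then obtain G where G: "\<And>U. U \<in> \<C> \<Longrightarrow> open (G U)" "\<And>U. U \<in> \<C> \<Longrightarrow> U = {p \<in> topspace X. \<phi> p \<in> G U}"
    by metis
  \<comment> \<open>Truncation turns each \<open>G U\<close> into a cylinder over the first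
    \<open>N\<close> coordinates, so that boxes can fit inside; on the image of
    \<open>\<phi>\<close> it is the identity.\<close>
  define \<pi> where "\<pi> x = (\<lambda>i. if i < N then x i else 0)" for x :: "nat \<Rightarrow> real"
  have cont_\<pi>: "continuous_on UNIV \<pi>"
    unfolding \<pi>_def
  proof (rule continuous_on_coordinatewise_then_product)
    show "continuous_on UNIV (\<lambda>x. if i < N then x i else (0::real))" for i
      by (cases "i < N") simp_all
  qed
  define H where "H U = \<pi> -` G U" for U
  have H_open: "open (H U)" if "U \<in> \<C>" for U
    unfolding H_def using cont_\<pi> G(1)[OF that] by (simp add: continuous_on_open_vimage)
  have \<pi>\<phi>: "\<pi> (\<phi> p) = \<phi> p" if "p \<in> topspace X" for p using supp[OF that] by (auto simp: \<pi>_def)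
  have U_eq: "U = {p \<in> topspace X. \<phi> p \<in> H U}" if "U \<in> \<C>" for U
  proof -
    have "{p \<in> topspace X. \<phi> p \<in> H U} = {p \<in> topspace X. \<phi> p \<in> G U}" by (auto simp: H_def \<pi>\<phi>)
    then show ?thesis using G(2)[OF that] by blast
  qed
  define e where "e = (from_nat :: nat \<Rightarrow> rat list \<times> rat)"
  define q where "q m = (\<lambda>i. if i < length (fst (e m)) then real_of_rat (fst (e m) ! i) else 0)" for m
  define \<rho> where "\<rho> m = real_of_rat (snd (e m))" for m
  obtain t where t: "\<And>m. \<rho> m > 0 \<Longrightarrow> \<rho> m < t m \<and> t m < 2 * \<rho> m"
      "\<And>l m. l < m \<Longrightarrow> t m - t l \<notin> \<rat> \<and> t m + t l \<notin> \<rat>" using generic_widths[of \<rho>] by metis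
  define J where "J m \<longleftrightarrow> \<rho> m > 0 \<and> (\<exists>U\<in>\<C>. closed_box N (q m) (2 * \<rho> m) \<subseteq> H U)" for m
  then obtain U where U: "\<And>m. J m \<Longrightarrow> U m \<in> \<C> \<and> closed_box N (q m) (2 * \<rho> m) \<subseteq> H (U m)" by metis
  define B where "B m = (if J m then obox N (q m) (t m) else {})" for m
  define D where "D m = (if J m then closed_box N (q m) (t m) else {})" for m
  define C where "C m = D m - (\<Union>l<m. B l)" for m
  have ord: "finite {m. x \<in> C m} \<and> card {m. x \<in> C m} \<le> Suc N" for x
  proof (rule generic_boxes_order)
    show "q m i \<in> \<rat>" for m i by (simp add: q_def)
    show "C m \<subseteq> closed_box N (q m) (t m) - (\<Union>l\<in>{l. l < m \<and> J l}. obox N (q l) (t l))" for m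
      unfolding C_def B_def D_def by auto
    show "J m" if "C m \<noteq> {}" for m using that unfolding C_def D_def by (auto split: if_splits)
  qed (use t in auto)
  obtain V where V: "\<And>m. open (V m)" "(\<Union>m. B m) \<subseteq> (\<Union>m. V m \<inter> D m)"
    "\<And>x. finite {m. x \<in> V m} \<and> card {m. x \<in> V m} \<le> Suc N"
  proof (rule open_cover_shrink_order[of B D C "Suc N"])
    show "open (B m)" "closed (D m)" for m
      by (simp_all add: B_def D_def open_obox closed_closed_box)
    show "B m \<subseteq> D m" for m
      by (auto simp: B_def D_def obox_def closed_box_def less_imp_le)
  qed (use ord in \<open>auto simp: C_def\<close>)
  \<comment> \<open>\<open>V m\<close> may reach beyond its box; cutting with \<open>H (U m)\<close>
    makes it subordinate to the cover again. Points of \<open>D m\<close> survive, as that closed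
    box lies in \<open>H (U m)\<close>.\<close>
  define V' where "V' m = {p \<in> topspace X. \<phi> p \<in> V m \<inter> H (U m)}" for m
  have V'_sub: "V' m \<subseteq> U m" "openin X (V' m)" if "J m" for m
  proof -
    have "U m \<in> \<C>" using U[OF that] by blast
    then show "V' m \<subseteq> U m" unfolding V'_def using U_eq[of "U m"] by blast
    show "openin X (V' m)" unfolding V'_def using V(1) H_open[OF \<open>U m \<in> \<C>\<close>]
      by (intro cont open_Int)
  qed
  show "\<exists>\<R>. (\<forall>V\<in>\<R>. openin X V \<and> (\<exists>U\<in>\<C>. V \<subseteq> U)) \<and> \<Union>\<R> = topspace X \<and>
            (\<forall>x\<in>topspace X. finite {V\<in>\<R>. x \<in> V} \<and> int (card {V\<in>\<R>. x \<in> V}) \<le> int N + 1)"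
  proof (intro exI[of _ "V' ` {m. J m}"] conjI ballI)
    fix W assume "W \<in> V' ` {m. J m}"
    then show "openin X W" "\<exists>U\<in>\<C>. W \<subseteq> U" using V'_sub U by blast+
  next
    show "\<Union> (V' ` {m. J m}) = topspace X"
    proof
      show "\<Union> (V' ` {m. J m}) \<subseteq> topspace X" by (auto simp: V'_def)
      show "topspace X \<subseteq> \<Union> (V' ` {m. J m})"
      proof
        fix p assume p: "p \<in> topspace X"
        then obtain S where S: "S \<in> \<C>" "p \<in> S" using \<C> by blast
        have pH: "\<phi> p \<in> H S" using S U_eq by blast
        have cyl: "z \<in> H S" if "\<And>i. i < N \<Longrightarrow> y i = z i" "y \<in> H S" for y z
        proof -
          have "\<pi> y = \<pi> z" using that(1) by (auto simp: \<pi>_def)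
          then show ?thesis using that(2) by (simp add: H_def)
        qed
        obtain xs r where r: "r > 0"
          "closed_box N (\<lambda>i. if i < length xs then real_of_rat (xs ! i) else 0) (2 * real_of_rat r) \<subseteq> H S"
          "\<phi> p \<in> obox N (\<lambda>i. if i < length xs then real_of_rat (xs ! i) else 0) (real_of_rat r)"
          by (rule rational_box_in_cylinder[OF H_open[OF S(1)] pH cyl]) simp_all
        define m where "m = to_nat (xs, r)"
        have em: "e m = (xs, r)" by (simp add: e_def m_def)
        have qm: "q m = (\<lambda>i. if i < length xs then real_of_rat (xs ! i) else 0)" "\<rho> m = real_of_rat r"
          unfolding q_def \<rho>_def em fst_conv snd_conv by simp_all
        have Jm: "J m" unfolding J_def qm using r(1,2) S(1) by auto
        have "\<phi> p \<in> obox N (q m) (\<rho> m)" using r(3) unfolding qm .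
        then have "\<phi> p \<in> B m" using Jm t(1)[of m] by (auto simp: B_def J_def obox_def intro: less_trans)
        then obtain n where n: "\<phi> p \<in> V n" "\<phi> p \<in> D n" using V(2) by blast
        then have Jn: "J n" by (auto simp: D_def split: if_splits)
        have "closed_box N (q n) (t n) \<subseteq> closed_box N (q n) (2 * \<rho> n)"
          using t(1)[of n] Jn by (force simp: closed_box_def J_def)
        then have "\<phi> p \<in> H (U n)" using n(2) U[OF Jn] Jn by (auto simp: D_def)
        then show "p \<in> \<Union> (V' ` {m. J m})" using n(1) Jn p by (auto simp: V'_def)
      qed
    qed
  next
    fix p assume "p \<in> topspace X"
    have sub: "{W \<in> V' ` {m. J m}. p \<in> W} \<subseteq> V' ` {m. \<phi> p \<in> V m}" by (auto simp: V'_def)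
    have "finite (V' ` {m. \<phi> p \<in> V m})" "card (V' ` {m. \<phi> p \<in> V m}) \<le> Suc N"
      using V(3)[of "\<phi> p"] card_image_le[of "{m. \<phi> p \<in> V m}" V'] by (auto intro: order_trans)
    with sub show "finite {W \<in> V' ` {m. J m}. p \<in> W}"
      "int (card {W \<in> V' ` {m. J m}. p \<in> W}) \<le> int N + 1"
      using card_mono[OF _ sub] by (auto intro: finite_subset)
  qed
qed

section \<open>Lower bound: covers of the unit cube\<close>

definition unit_cube :: "nat \<Rightarrow> (nat \<Rightarrow> real) set" where
  "unit_cube N = {x. (\<forall>i<N. 0 \<le> x i \<and> x i \<le> 1) \<and> (\<forall>i\<ge>N. x i = 0)}"

lemma compact_unit_cube: "compact (unit_cube N)"
proof -
  have "unit_cube N = Pi\<^sub>E UNIV (\<lambda>i. if i < N then {0..1} else {0})"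
    by (force simp: unit_cube_def PiE_def Pi_def extensional_def split: if_splits)
  moreover have "compactin (product_topology (\<lambda>_. euclideanreal) UNIV)
      (Pi\<^sub>E UNIV (\<lambda>i::nat. if i < N then {0..1} else {0}))"
    by (simp add: compactin_PiE)
  ultimately show ?thesis
    by (metis compactin_euclidean_iff euclidean_product_topology)
qed

lemma tendsto_fun_iff:
  fixes f :: "'a \<Rightarrow> 'b \<Rightarrow> 'c::topological_space"
  shows "(f \<longlongrightarrow> l) F \<longleftrightarrow> (\<forall>i. ((\<lambda>x. f x i) \<longlongrightarrow> l i) F)"
  using limitin_componentwise[of "\<lambda>_. euclidean" UNIV f l F]
  by (simp add: euclidean_product_topology limitin_canonical_iff)

text \<open>Kuhn's labelling lemma on grids of mesh \<open>1 / (p + 1)\<close> yields cells with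
  corners where \<open>F i\<close> is nonpositive and corners where it is nonnegative, for all
  \<open>i\<close> at once; a limit point of these cells is a common zero.\<close>

lemma poincare_miranda:
  fixes F :: "nat \<Rightarrow> (nat \<Rightarrow> real) \<Rightarrow> real"
  assumes cont: "\<And>i. i < N \<Longrightarrow> continuous_on (unit_cube N) (F i)"
    and F0: "\<And>i x. i < N \<Longrightarrow> x \<in> unit_cube N \<Longrightarrow> x i = 0 \<Longrightarrow> F i x \<le> 0"
    and F1: "\<And>i x. i < N \<Longrightarrow> x \<in> unit_cube N \<Longrightarrow> x i = 1 \<Longrightarrow> F i x \<ge> 0"
  obtains x where "x \<in> unit_cube N" "\<And>i. i < N \<Longrightarrow> F i x = 0"
proof -
  define g where "g p y = (\<lambda>i. if i < N then real (y i) / real (Suc p) else 0)" for p :: nat and y :: "nat \<Rightarrow> nat"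
  have g_cube: "g p y \<in> unit_cube N" if "\<And>i. i < N \<Longrightarrow> y i \<le> Suc p" for p y
    using that by (fastforce simp: g_def unit_cube_def divide_le_eq_1 simp flip: of_nat_Suc)
  \<comment> \<open>On the two faces the label is fixed as Kuhn's lemma demands; \<open>F0\<close>
    and \<open>F1\<close> ensure that it still agrees with the sign of \<open>F i\<close>
    there.\<close>
  define lab where "lab p y i = (if y i = 0 then 0 else if y i = Suc p then 1 else if F i (g p y) \<le> 0 then 0 else (1::nat))"
    for p y i
  have lab0: "F i (g p y) \<le> 0" if "lab p y i = 0" "i < N" "\<And>i. i < N \<Longrightarrow> y i \<le> Suc p" for p y i
    using that F0[OF that(2) g_cube[of y p]] by (auto simp: lab_def g_def split: if_splits)
  have lab1: "F i (g p y) \<ge> 0" if "lab p y i = 1" "i < N" "\<And>i. i < N \<Longrightarrow> y i \<le> Suc p" for p y i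
    using that F1[OF that(2) g_cube[of y p]] by (auto simp: lab_def g_def split: if_splits)
  define near where "near q y \<longleftrightarrow> (\<forall>j<N. q j \<le> y j \<and> y j \<le> q j + 1)" for q y :: "nat \<Rightarrow> nat"
  have "\<exists>q. (\<forall>i<N. q i < Suc p) \<and> (\<forall>i<N. \<exists>r s. near q r \<and> near q s \<and> F i (g p r) \<le> 0 \<and> F i (g p s) \<ge> 0)" for p
  proof -
    have k1: "\<forall>x. (\<forall>i<N. x i \<le> Suc p) \<longrightarrow> (\<forall>i<N. lab p x i = 0 \<or> lab p x i = 1)"
      and k2: "\<forall>x. (\<forall>i<N. x i \<le> Suc p) \<longrightarrow> (\<forall>i<N. x i = 0 \<longrightarrow> lab p x i = 0)"
      and k3: "\<forall>x. (\<forall>i<N. x i \<le> Suc p) \<longrightarrow> (\<forall>i<N. x i = Suc p \<longrightarrow> lab p x i = 1)"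
      by (simp_all add: lab_def)
    obtain q where q: "\<forall>i<N. q i < Suc p" "\<forall>i<N. \<exists>r s. near q r \<and> near q s \<and> lab p r i \<noteq> lab p s i"
      unfolding near_def by (rule kuhn_lemma[OF zero_less_Suc k1 k2 k3])
    have "\<exists>r s. near q r \<and> near q s \<and> F i (g p r) \<le> 0 \<and> F i (g p s) \<ge> 0" if i: "i < N" for i
    proof -
      obtain r s where rs: "near q r" "near q s" "lab p r i \<noteq> lab p s i" using q(2) i by blast
      have le: "r j \<le> Suc p" "s j \<le> Suc p" if "j < N" for j
      proof -
        have "r j \<le> q j + 1" "s j \<le> q j + 1" "q j < Suc p" using rs(1,2) q(1) that by (simp_all add: near_def)
        then show "r j \<le> Suc p" "s j \<le> Suc p" by linarith+
      qed
      have "lab p r i = 0 \<and> lab p s i = 1 \<or> lab p r i = 1 \<and> lab p s i = 0"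
        using rs(3) by (auto simp: lab_def split: if_splits)
      then show ?thesis using lab0 lab1 le rs(1,2) i by meson
    qed
    then show ?thesis using q(1) by blast
  qed
  then obtain q where q: "\<And>p i. i < N \<Longrightarrow> q p i < Suc p"
      "\<And>p i. i < N \<Longrightarrow> \<exists>r s. near (q p) r \<and> near (q p) s \<and> F i (g p r) \<le> 0 \<and> F i (g p s) \<ge> 0"
    by metis
  have "g p (q p) \<in> unit_cube N" for p using q(1) by (intro g_cube) (simp add: less_imp_le)
  then obtain x h where x: "x \<in> unit_cube N" "strict_mono h" "((\<lambda>p. g p (q p)) \<circ> h) \<longlonglongrightarrow> x"
    using compact_unit_cube[of N] unfolding compact_eq_seq_compact_metric seq_compact_def by metis
  \<comment> \<open>The corners of a cell differ by at most one mesh width in each coordinate, so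
    every choice of corners has the same limit.\<close>
  have near_lim: "(\<lambda>p. g (h p) (y p)) \<longlonglongrightarrow> x" "\<And>p. g (h p) (y p) \<in> unit_cube N"
    if y: "\<And>p. near (q (h p)) (y p)" for y
  proof -
    have "(\<lambda>p. g (h p) (y p) j) \<longlonglongrightarrow> x j" for j
    proof (cases "j < N")
      case True
      have "(\<lambda>p. g (h p) (q (h p)) j) \<longlonglongrightarrow> x j"
        using x(3) by (simp add: tendsto_fun_iff o_def)
      moreover have "(\<lambda>p. g (h p) (y p) j - g (h p) (q (h p)) j) \<longlonglongrightarrow> 0"
      proof (rule Lim_null_comparison)
        have "norm (g (h p) (y p) j - g (h p) (q (h p)) j) \<le> 1 / real (Suc p)" for p
        proof -
          have "q (h p) j \<le> y p j" "y p j \<le> q (h p) j + 1" using y True by (auto simp: near_def)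
          then have "\<bar>real (y p j) - real (q (h p) j)\<bar> \<le> 1" by linarith
          then have "norm (g (h p) (y p) j - g (h p) (q (h p)) j) \<le> 1 / real (Suc (h p))"
            using True by (simp add: g_def diff_divide_distrib[symmetric] divide_right_mono)
          also have "\<dots> \<le> 1 / real (Suc p)"
            using seq_suble[OF x(2), of p] by (intro divide_left_mono) auto
          finally show ?thesis .
        qed
        then show "\<forall>\<^sub>F p in sequentially. norm (g (h p) (y p) j - g (h p) (q (h p)) j) \<le> 1 / real (Suc p)" by simp
        show "(\<lambda>p. 1 / real (Suc p)) \<longlonglongrightarrow> 0" by (rule LIMSEQ_Suc[OF lim_1_over_n])
      qed
      ultimately have "(\<lambda>p. g (h p) (q (h p)) j + (g (h p) (y p) j - g (h p) (q (h p)) j)) \<longlonglongrightarrow> x j + 0"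
        by (rule tendsto_add)
      then show ?thesis by simp
    next
      case False
      then show ?thesis using x(1) by (simp add: g_def unit_cube_def)
    qed
    then show "(\<lambda>p. g (h p) (y p)) \<longlonglongrightarrow> x" by (simp add: tendsto_fun_iff)
    show "g (h p) (y p) \<in> unit_cube N" for p
    proof (rule g_cube)
      show "y p i \<le> Suc (h p)" if "i < N" for i
        using y[of p] q(1)[OF that, of "h p"] that unfolding near_def by fastforce
    qed
  qed
  have "F i x = 0" if i: "i < N" for i
  proof -
    have "\<forall>p. \<exists>r s. near (q (h p)) r \<and> near (q (h p)) s \<and> F i (g (h p) r) \<le> 0 \<and> F i (g (h p) s) \<ge> 0"
      using q(2)[OF i] by blast
    then obtain r s where rs: "\<And>p. near (q (h p)) (r p)" "\<And>p. near (q (h p)) (s p)"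
      "\<And>p. F i (g (h p) (r p)) \<le> 0" "\<And>p. F i (g (h p) (s p)) \<ge> 0" by metis
    have lim: "(\<lambda>p. F i (g (h p) (y p))) \<longlonglongrightarrow> F i x" if "\<And>p. near (q (h p)) (y p)" for y
      by (rule continuous_on_tendsto_compose[OF cont[OF i] near_lim(1)[OF that] x(1)])
        (use near_lim(2)[OF that] in simp)
    have "F i x \<le> 0" using LIMSEQ_le_const2[OF lim[OF rs(1)]] rs(3) by blast
    moreover have "F i x \<ge> 0" using LIMSEQ_le_const[OF lim[OF rs(2)]] rs(4) by blast
    ultimately show ?thesis by simp
  qed
  with x(1) show thesis using that by blast
qed

text \<open>A cubical form of the Knaster--Kuratowski--Mazurkiewicz lemma. With \<open>f i\<close> the distance to the
  complement of \<open>W i\<close>, the Poincare--Miranda theorem provides a common zero of the functions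
  \<open>(\<Sum>j\<in>{i<..N}. f j) - f i\<close>; there all \<open>f i\<close> are positive, or all of them vanish.\<close>

lemma cube_cover_common_point:
  assumes W: "\<And>i. i \<le> N \<Longrightarrow> openin (top_of_set (unit_cube N)) (W i)"
    and W1: "\<And>i x. i < N \<Longrightarrow> x \<in> W i \<Longrightarrow> x i < 1"
    and W0: "\<And>i j x. i \<le> N \<Longrightarrow> j < i \<Longrightarrow> x \<in> W i \<Longrightarrow> x j > 0"
    and cover: "unit_cube N \<subseteq> (\<Union>i\<le>N. W i)"
  shows "\<exists>x\<in>unit_cube N. \<forall>i\<le>N. x \<in> W i"
proof -
  let ?K = "unit_cube N"
  \<comment> \<open>\<open>infdist\<close> to the empty set is 0, so the value 1 stands in when
    \<open>W i\<close> is the whole cube; on the cube \<open>f i\<close> is then positive exactly on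
    \<open>W i\<close>.\<close>
  define f where "f i x = (if ?K - W i = {} then 1 else infdist x (?K - W i))" for i x
  have f_nonneg: "f i x \<ge> 0" for i x by (simp add: f_def infdist_nonneg)
  have f_0_iff: "f i x = 0 \<longleftrightarrow> x \<notin> W i" if "i \<le> N" "x \<in> ?K" for i x
  proof (cases "?K - W i = {}")
    case True
    then show ?thesis using that by (auto simp: f_def)
  next
    case False
    have "closedin (top_of_set ?K) (?K - W i)"
      using W[OF that(1)] by (simp add: closedin_diff)
    then have "closed (?K - W i)"
      using compact_imp_closed[OF compact_unit_cube] closedin_closed_trans by blast
    then show ?thesis using False that in_closed_iff_infdist_zero[of "?K - W i" x] by (auto simp: f_def)
  qed
  have f_cont: "continuous_on ?K (f i)" for i
    unfolding f_def by (cases "?K - W i = {}") (auto intro!: continuous_intros)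
  obtain x where x: "x \<in> ?K" "\<And>i. i < N \<Longrightarrow> (\<Sum>j\<in>{i<..N}. f j x) - f i x = 0"
  proof (rule poincare_miranda[of N "\<lambda>i x. (\<Sum>j\<in>{i<..N}. f j x) - f i x"])
    show "continuous_on ?K (\<lambda>x. (\<Sum>j\<in>{i<..N}. f j x) - f i x)" for i
      by (intro continuous_intros f_cont)
    show "(\<Sum>j\<in>{i<..N}. f j x) - f i x \<le> 0" if "i < N" "x \<in> ?K" "x i = 0" for i x
    proof -
      have "f j x = 0" if "j \<in> {i<..N}" for j
        using W0[of j i x] that \<open>x i = 0\<close> \<open>x \<in> ?K\<close> by (auto simp: f_0_iff)
      then show ?thesis using f_nonneg by simp
    qed
    show "(\<Sum>j\<in>{i<..N}. f j x) - f i x \<ge> 0" if "i < N" "x \<in> ?K" "x i = 1" for i x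
    proof -
      have "f i x = 0" using W1[of i x] that by (auto simp: f_0_iff)
      then show ?thesis by (simp add: sum_nonneg f_nonneg)
    qed
  qed blast
  show ?thesis
  proof (cases "f N x = 0")
    case False
    \<comment> \<open>For \<open>i < N\<close> the equation makes \<open>f i x\<close> the sum of
      the later values, among them \<open>f N x\<close>. Read downwards from \<open>N\<close>, the
      same equations make all values vanish in the other case.\<close>
    have "f i x \<noteq> 0" if "i \<le> N" for i
    proof (cases "i = N")
      case ne: False
      then have "f N x \<le> (\<Sum>j\<in>{i<..N}. f j x)" using that by (intro member_le_sum) (auto simp: f_nonneg)
      then show ?thesis using x(2)[of i] False f_nonneg[of N x] that ne by simp
    qed (use False in simp)
    then show ?thesis using f_0_iff x(1) by blast
  next
    case True
    have "f (N - k) x = 0" for k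
    proof (induction k rule: less_induct)
      case (less k)
      show ?case
      proof (cases "N - k = N")
        case False
        have "f j x = 0" if "j \<in> {N - k<..N}" for j
          using less[of "N - j"] that by auto
        then show ?thesis using x(2)[of "N - k"] False by simp
      qed (use True in simp)
    qed
    then have "x \<notin> W i" if "i \<le> N" for i
      using f_0_iff[OF that x(1)] that by (metis diff_diff_cancel)
    then show ?thesis using cover x(1) by blast
  qed
qed

text \<open>The test cover is pulled back along \<open>r\<close>, refined in \<open>X\<close>, and
  the refinement is restricted along \<open>e\<close>; \<open>r (e x) = x\<close> keeps it
  subordinate. Members are grouped by a test set containing them, and a common point of the
  \<open>N + 1\<close> groups lies in \<open>N + 1\<close> distinct members.\<close>

lemma covering_dim_le_cube_retract:
  assumes r: "continuous_map X (top_of_set (unit_cube N)) r"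
    and e: "continuous_map (top_of_set (unit_cube N)) X e"
    and re: "\<And>x. x \<in> unit_cube N \<Longrightarrow> r (e x) = x"
    and dim: "covering_dim_le X k"
  shows "int N \<le> k"
proof (rule ccontr)
  assume "\<not> int N \<le> k"
  let ?K = "unit_cube N"
  \<comment> \<open>A point of the cube lies in \<open>U i\<close> for its first vanishing
    coordinate \<open>i\<close>, or in \<open>U N\<close> if there is none.\<close>
  define U where "U i = {x\<in>?K. (i < N \<longrightarrow> x i < 1) \<and> (\<forall>j<i. x j > 0)}" for i
  have U_open: "openin (top_of_set ?K) (U i)" for i
  proof -
    have "U i = ?K \<inter> ((if i < N then {x. x i < 1} else UNIV) \<inter> (\<Inter>j\<in>{..<i}. {x. 0 < x j}))"
      by (auto simp: U_def)
    moreover have "open ((if i < N then {x. x i < 1} else UNIV) \<inter> (\<Inter>j\<in>{..<i}. {x::nat \<Rightarrow> real. 0 < x j}))"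
      by (auto intro!: open_Int open_INT open_Collect_less continuous_intros)
    ultimately show ?thesis by (simp add: openin_open_Int)
  qed
  have U_cover: "\<exists>i\<le>N. x \<in> U i" if x: "x \<in> ?K" for x
  proof (cases "\<forall>j<N. x j > 0")
    case True
    then have "x \<in> U N" using x by (simp add: U_def)
    then show ?thesis by blast
  next
    case False
    define i where "i = (LEAST j. j < N \<and> \<not> x j > 0)"
    have i: "i < N" "\<not> x i > 0" using False LeastI_ex[of "\<lambda>j. j < N \<and> \<not> x j > 0"] by (auto simp: i_def)
    have "x j > 0" if "j < i" for j
      using not_less_Least[of j "\<lambda>j. j < N \<and> \<not> x j > 0"] that i(1) by (auto simp: i_def)
    then have "x \<in> U i" using i x by (simp add: U_def)
    then show ?thesis using i(1) by (meson less_imp_le)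
  qed
  define C where "C i = {p\<in>topspace X. r p \<in> U i}" for i
  have "openin X (C i)" for i
    unfolding C_def using r U_open by (rule openin_continuous_map_preimage)
  moreover have "\<Union> (C ` {..N}) = topspace X"
    using U_cover continuous_map_image_subset_topspace[OF r] by (force simp: C_def)
  ultimately have "(\<forall>U\<in>C ` {..N}. openin X U) \<and> \<Union> (C ` {..N}) = topspace X" by simp
  from dim[unfolded covering_dim_le_def, THEN spec, THEN mp, OF this]
  obtain \<R> where R: "\<forall>V\<in>\<R>. openin X V \<and> (\<exists>U\<in>C ` {..N}. V \<subseteq> U)" "\<Union>\<R> = topspace X"
      "\<forall>x\<in>topspace X. finite {V\<in>\<R>. x \<in> V} \<and> int (card {V\<in>\<R>. x \<in> V}) \<le> k + 1"
    by (elim exE conjE)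
  have "\<forall>V\<in>\<R>. \<exists>i\<le>N. V \<subseteq> C i" using R(1) by auto
  then obtain \<phi> where \<phi>: "\<And>V. V \<in> \<R> \<Longrightarrow> \<phi> V \<le> N \<and> V \<subseteq> C (\<phi> V)" by metis
  define W where "W i = {x\<in>?K. e x \<in> \<Union>{V\<in>\<R>. \<phi> V = i}}" for i
  have e_top: "e x \<in> topspace X" if "x \<in> ?K" for x
    using continuous_map_image_subset_topspace[OF e] that by auto
  have WU: "W i \<subseteq> U i" for i
    unfolding W_def C_def using \<phi> re by (fastforce simp: C_def)
  have "\<exists>x\<in>?K. \<forall>i\<le>N. x \<in> W i"
  proof (rule cube_cover_common_point)
    show "openin (top_of_set ?K) (W i)" for i
    proof -
      have "openin X (\<Union>{V\<in>\<R>. \<phi> V = i})" using R(1) by (intro openin_Union) auto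
      from openin_continuous_map_preimage[OF e this] show ?thesis by (simp add: W_def)
    qed
    show "x i < 1" if "i < N" "x \<in> W i" for i x using WU that by (auto simp: U_def)
    show "x j > 0" if "i \<le> N" "j < i" "x \<in> W i" for i j x using WU that by (auto simp: U_def)
    show "?K \<subseteq> (\<Union>i\<le>N. W i)"
    proof
      fix x assume x: "x \<in> ?K"
      then obtain V where "V \<in> \<R>" "e x \<in> V" using e_top R(2) by blast
      then show "x \<in> (\<Union>i\<le>N. W i)" using \<phi> x by (auto simp: W_def)
    qed
  qed
  then obtain x where x: "x \<in> ?K" "\<And>i. i \<le> N \<Longrightarrow> \<exists>V. V \<in> \<R> \<and> \<phi> V = i \<and> e x \<in> V"
    unfolding W_def by blast
  then obtain v where v: "\<And>i. i \<le> N \<Longrightarrow> v i \<in> \<R> \<and> \<phi> (v i) = i \<and> e x \<in> v i" by metis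
  have fin: "finite {V\<in>\<R>. e x \<in> V}" "int (card {V\<in>\<R>. e x \<in> V}) \<le> k + 1"
    using R(3) e_top[OF x(1)] by auto
  have "card {..N} \<le> card {V\<in>\<R>. e x \<in> V}"
    using v by (intro card_inj_on_le[of v] fin(1)) (auto intro!: inj_onI, metis)
  then show False using fin(2) \<open>\<not> int N \<le> k\<close> by simp
qed

lemma covering_dim_eqI:
  assumes "covering_dim_le X (int N)" "\<And>k. covering_dim_le X k \<Longrightarrow> int N \<le> k"
  shows "covering_dim X = ereal (real N)"
  unfolding covering_dim_def
proof (rule cInf_eq_minimum)
  show "ereal (real N) \<in> {ereal (real_of_int k) |k. - 1 \<le> k \<and> covering_dim_le X k}"
    using assms(1) by (intro CollectI exI[of _ "int N"]) auto
  fix y assume "y \<in> {ereal (real_of_int k) |k. - 1 \<le> k \<and> covering_dim_le X k}"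
  then obtain k where k: "y = ereal (real_of_int k)" "covering_dim_le X k" by blast
  have "real_of_int (int N) \<le> real_of_int k" using assms(2)[OF k(2)] by (simp only: of_int_le_iff)
  then show "ereal (real N) \<le> y" by (simp add: k(1))
qed

section \<open>Connections and g-convexity of separable functions\<close>

lemma k_times_cont_diff_Suc_imp: "k_times_cont_diff (Suc k) f \<Longrightarrow> k_times_cont_diff k f"
proof (induction k arbitrary: f)
  case 0
  then show ?case by (auto intro!: continuous_at_imp_continuous_on differentiable_imp_continuous_within)
next
  case (Suc k)
  then show ?case by (metis k_times_cont_diff.simps(2))
qed

lemma k_times_cont_diff_SucI:
  assumes "\<And>x. (f has_derivative f' x) (at x)" "\<And>v. k_times_cont_diff k (\<lambda>x. f' x v)"
  shows "k_times_cont_diff (Suc k) f"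
proof -
  have "frechet_derivative f (at x) = f' x" for x using frechet_derivative_at[OF assms(1)] by simp
  then show ?thesis using assms by (auto simp: differentiable_def)
qed

lemma k_times_cont_diff_SucD:
  assumes "k_times_cont_diff (Suc k) f"
  shows "(f has_derivative frechet_derivative f (at x)) (at x)"
    "k_times_cont_diff k (\<lambda>x. frechet_derivative f (at x) v)"
  using assms by (auto simp: frechet_derivative_works)

lemma k_times_cont_diff_const: "k_times_cont_diff k (\<lambda>_. c)"
proof (induction k arbitrary: c)
  case (Suc k)
  show ?case by (rule k_times_cont_diff_SucI[OF has_derivative_const]) (rule Suc)
qed simp

lemma k_times_cont_diff_add:
  "k_times_cont_diff k f \<Longrightarrow> k_times_cont_diff k g \<Longrightarrow> k_times_cont_diff k (\<lambda>x. f x + g x)"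
proof (induction k arbitrary: f g)
  case 0
  then show ?case by (auto intro: continuous_intros)
next
  case (Suc k)
  show ?case
    by (rule k_times_cont_diff_SucI[OF has_derivative_add])
      (use k_times_cont_diff_SucD[OF Suc.prems(1)] k_times_cont_diff_SucD[OF Suc.prems(2)] Suc.IH in auto)
qed

text \<open>One induction on the order serves multiplication, scaling and the inner product.\<close>

lemma k_times_cont_diff_bilinear:
  assumes "bounded_bilinear b"
  shows "k_times_cont_diff k f \<Longrightarrow> k_times_cont_diff k g \<Longrightarrow> k_times_cont_diff k (\<lambda>x. b (f x) (g x))"
proof (induction k arbitrary: f g)
  case 0
  then show ?case using bounded_bilinear.continuous_on[OF assms] by auto
next
  case (Suc k)
  note f = k_times_cont_diff_SucD[OF Suc.prems(1)] and g = k_times_cont_diff_SucD[OF Suc.prems(2)]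
  show ?case
  proof (rule k_times_cont_diff_SucI)
    show "((\<lambda>x. b (f x) (g x)) has_derivative
      (\<lambda>v. b (f x) (frechet_derivative g (at x) v) + b (frechet_derivative f (at x) v) (g x))) (at x)" for x
      by (rule bounded_bilinear.FDERIV[OF assms f(1) g(1)])
    show "k_times_cont_diff k (\<lambda>x. b (f x) (frechet_derivative g (at x) v) + b (frechet_derivative f (at x) v) (g x))" for v
      by (intro k_times_cont_diff_add Suc.IH f(2) g(2) k_times_cont_diff_Suc_imp[OF Suc.prems(1)]
          k_times_cont_diff_Suc_imp[OF Suc.prems(2)])
  qed
qed

lemma k_times_cont_diff_linear: "bounded_linear h \<Longrightarrow> k_times_cont_diff k h"
proof (cases k)
  case 0
  assume "bounded_linear h"
  then show ?thesis using 0 by (simp add: linear_continuous_on)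
next
  case (Suc l)
  assume "bounded_linear h"
  then show ?thesis unfolding Suc
    by (intro k_times_cont_diff_SucI[of h "\<lambda>_. h"] bounded_linear_imp_has_derivative k_times_cont_diff_const)
qed

lemma k_times_cont_diff_linear_compose:
  assumes "bounded_linear h"
  shows "k_times_cont_diff k f \<Longrightarrow> k_times_cont_diff k (\<lambda>x. f (h x))"
proof (induction k arbitrary: f)
  case 0
  then show ?case using linear_continuous_on[OF assms, of UNIV]
    by (auto intro: continuous_on_compose2[where t=UNIV])
next
  case (Suc k)
  note f = k_times_cont_diff_SucD[OF Suc.prems]
  show ?case
  proof (rule k_times_cont_diff_SucI)
    show "((\<lambda>x. f (h x)) has_derivative (\<lambda>v. frechet_derivative f (at (h x)) (h v))) (at x)" for x
      by (rule has_derivative_compose[OF bounded_linear_imp_has_derivative[OF assms] f(1)])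
    show "k_times_cont_diff k (\<lambda>x. frechet_derivative f (at (h x)) (h v))" for v
      by (rule Suc.IH[OF f(2)])
  qed
qed

lemma k_times_cont_diff_linear_image:
  assumes "bounded_linear h"
  shows "k_times_cont_diff k f \<Longrightarrow> k_times_cont_diff k (\<lambda>x. h (f x))"
proof (induction k arbitrary: f)
  case 0
  then show ?case using bounded_linear.continuous_on[OF assms] by auto
next
  case (Suc k)
  note f = k_times_cont_diff_SucD[OF Suc.prems]
  show ?case
    by (rule k_times_cont_diff_SucI[OF bounded_linear.has_derivative[OF assms f(1)]]) (rule Suc.IH[OF f(2)])
qed

lemma smooth_has_derivative: "smooth f \<Longrightarrow> (f has_derivative frechet_derivative f (at x)) (at x)"
  unfolding smooth_def by (rule k_times_cont_diff_SucD(1)) blast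

lemma smooth_frechet_derivative: "smooth f \<Longrightarrow> smooth (\<lambda>x. frechet_derivative f (at x) v)"
  unfolding smooth_def by (blast intro: k_times_cont_diff_SucD(2))

lemma smooth_imp_continuous_on: "smooth f \<Longrightarrow> continuous_on S f"
  unfolding smooth_def by (metis continuous_on_subset k_times_cont_diff.simps(1) subset_UNIV)

lemma smooth_const: "smooth (\<lambda>_. c)"
  by (simp add: smooth_def k_times_cont_diff_const)

lemma smooth_add: "smooth f \<Longrightarrow> smooth g \<Longrightarrow> smooth (\<lambda>x. f x + g x)"
  by (simp add: smooth_def k_times_cont_diff_add)

lemma smooth_bilinear: "bounded_bilinear b \<Longrightarrow> smooth f \<Longrightarrow> smooth g \<Longrightarrow> smooth (\<lambda>x. b (f x) (g x))"
  by (simp add: smooth_def k_times_cont_diff_bilinear)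

lemma smooth_linear: "bounded_linear h \<Longrightarrow> smooth h"
  by (simp add: smooth_def k_times_cont_diff_linear)

lemma smooth_linear_compose: "bounded_linear h \<Longrightarrow> smooth f \<Longrightarrow> smooth (\<lambda>x. f (h x))"
  by (simp add: smooth_def k_times_cont_diff_linear_compose)

lemma smooth_linear_image: "bounded_linear h \<Longrightarrow> smooth f \<Longrightarrow> smooth (\<lambda>x. h (f x))"
  by (simp add: smooth_def k_times_cont_diff_linear_image)

lemmas smooth_scaleR = smooth_bilinear[OF bounded_bilinear_scaleR]
lemmas smooth_mult = smooth_bilinear[OF bounded_bilinear_mult]
lemmas smooth_inner = smooth_bilinear[OF bounded_bilinear_inner]

lemma smooth_uminus:
  assumes "smooth f"
  shows "smooth (\<lambda>x. - f x)"
  using smooth_scaleR[OF smooth_const[of "-1"] assms] by simp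

lemma smooth_sum: "finite I \<Longrightarrow> (\<And>i. i \<in> I \<Longrightarrow> smooth (f i)) \<Longrightarrow> smooth (\<lambda>x. \<Sum>i\<in>I. f i x)"
  by (induction I rule: finite_induct) (auto intro: smooth_const smooth_add)

lemma smooth_power:
  fixes f :: "'a::euclidean_space \<Rightarrow> real"
  shows "smooth f \<Longrightarrow> smooth (\<lambda>x. f x ^ n)"
  by (induction n) (auto intro: smooth_const smooth_mult)

lemma smooth_vec_nth:
  fixes f :: "'a::euclidean_space \<Rightarrow> real ^ 'n::finite"
  assumes "smooth f"
  shows "smooth (\<lambda>x. f x $ i)"
  using smooth_inner[OF assms smooth_const[of "axis i (1::real)"]] by (simp add: inner_axis)

lemma smooth_vec_lambda:
  fixes f :: "'n::finite \<Rightarrow> 'a::euclidean_space \<Rightarrow> real"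
  assumes "\<And>i. smooth (f i)"
  shows "smooth (\<lambda>x. \<chi> i. f i x)"
proof -
  have "(\<lambda>x. \<chi> i. f i x) = (\<lambda>x. \<Sum>i\<in>UNIV. f i x *\<^sub>R axis i (1::real))"
    by (auto simp: vec_eq_iff axis_def if_distrib cong: if_cong)
  then show ?thesis using assms by (auto intro!: smooth_sum smooth_scaleR smooth_const)
qed

text \<open>Smoothness speaks only of derivatives in fixed directions; expanding \<open>X p\<close>
  in the basis reduces the varying direction to these.\<close>

lemma smooth_dir_deriv:
  assumes f: "smooth f" and X: "smooth X"
  shows "smooth (\<lambda>p. frechet_derivative f (at p) (X p))"
proof -
  have "frechet_derivative f (at p) (X p) = (\<Sum>b\<in>Basis. (X p \<bullet> b) *\<^sub>R frechet_derivative f (at p) b)" for p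
  proof -
    have lin: "linear (frechet_derivative f (at p))"
      using smooth_has_derivative[OF f] has_derivative_linear by blast
    have "frechet_derivative f (at p) (X p) = frechet_derivative f (at p) (\<Sum>b\<in>Basis. (X p \<bullet> b) *\<^sub>R b)"
      by (simp add: euclidean_representation)
    then show ?thesis by (simp add: linear_sum[OF lin] linear_scale[OF lin])
  qed
  then show ?thesis
    by (simp, intro smooth_sum smooth_scaleR smooth_inner X smooth_const smooth_frechet_derivative f) auto
qed

lemma smooth_poly:
  fixes f :: "'a::euclidean_space \<Rightarrow> real"
  shows "smooth f \<Longrightarrow> smooth (\<lambda>x. poly p (f x))"
  by (induction p) (auto intro!: smooth_const smooth_add smooth_mult)

section \<open>Connections with given Christoffel symbols\<close>

text \<open>The flat derivative is a connection; adding a tensor \<open>\<Gamma>\<close> leaves the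
  Leibniz rule intact, and its symmetry leaves the torsion zero. On constant fields the flat part
  vanishes.\<close>

lemma connection_flat_plus:
  fixes \<Gamma> :: "'a::euclidean_space \<Rightarrow> 'a \<Rightarrow> 'a \<Rightarrow> 'a"
  assumes bil: "\<And>p. bilinear (\<Gamma> p)" and symm: "\<And>p u v. \<Gamma> p u v = \<Gamma> p v u"
    and smth: "\<And>X Y. smooth X \<Longrightarrow> smooth Y \<Longrightarrow> smooth (\<lambda>p. \<Gamma> p (X p) (Y p))"
  shows "connection (\<lambda>X Y p. dir_deriv X Y p + \<Gamma> p (X p) (Y p))"
    and "christoffel (\<lambda>X Y p. dir_deriv X Y p + \<Gamma> p (X p) (Y p)) p u v = \<Gamma> p u v"
proof -
  have lin: "linear (frechet_derivative f (at p))" if "smooth f" for f :: "'a \<Rightarrow> 'b::real_normed_vector" and p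
    using smooth_has_derivative[OF that] has_derivative_linear by blast
  have add: "frechet_derivative (\<lambda>p. f p + g p) (at p) = (\<lambda>v. frechet_derivative f (at p) v + frechet_derivative g (at p) v)"
    if "smooth f" "smooth g" for f g :: "'a \<Rightarrow> 'a" and p
    using frechet_derivative_at[OF has_derivative_add[OF smooth_has_derivative[OF that(1)] smooth_has_derivative[OF that(2)]]]
    by (rule sym)
  have prod: "frechet_derivative (\<lambda>p. f p *\<^sub>R g p) (at p) =
      (\<lambda>v. f p *\<^sub>R frechet_derivative g (at p) v + frechet_derivative f (at p) v *\<^sub>R g p)"
    if "smooth f" "smooth g" for f :: "'a \<Rightarrow> real" and g :: "'a \<Rightarrow> 'a" and p
    using frechet_derivative_at[OF has_derivative_scaleR[OF smooth_has_derivative[OF that(1)] smooth_has_derivative[OF that(2)]]]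
    by (rule sym)
  show "connection (\<lambda>X Y p. dir_deriv X Y p + \<Gamma> p (X p) (Y p))"
    unfolding connection_def
  proof (intro conjI allI impI; (elim conjE)?)
    fix X Y :: "'a \<Rightarrow> 'a" assume XY: "smooth X" "smooth Y"
    show "smooth (\<lambda>p. dir_deriv X Y p + \<Gamma> p (X p) (Y p))"
      unfolding dir_deriv_def by (intro smooth_add smooth_dir_deriv smth XY)
  next
    fix X X' Y :: "'a \<Rightarrow> 'a" assume "smooth X" "smooth X'" "smooth Y"
    then show "(\<lambda>p. dir_deriv (\<lambda>p. X p + X' p) Y p + \<Gamma> p (X p + X' p) (Y p)) =
       (\<lambda>p. dir_deriv X Y p + \<Gamma> p (X p) (Y p) + (dir_deriv X' Y p + \<Gamma> p (X' p) (Y p)))"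
      by (auto simp: dir_deriv_def linear_add[OF lin] bilinear_ladd[OF bil])
  next
    fix f :: "'a \<Rightarrow> real" and X Y :: "'a \<Rightarrow> 'a" assume "smooth f" "smooth X" "smooth Y"
    then show "(\<lambda>p. dir_deriv (\<lambda>p. f p *\<^sub>R X p) Y p + \<Gamma> p (f p *\<^sub>R X p) (Y p)) =
       (\<lambda>p. f p *\<^sub>R (dir_deriv X Y p + \<Gamma> p (X p) (Y p)))"
      by (auto simp: dir_deriv_def linear_scale[OF lin] bilinear_lmul[OF bil] scaleR_add_right)
  next
    fix X Y Y' :: "'a \<Rightarrow> 'a" assume "smooth X" "smooth Y" "smooth Y'"
    then show "(\<lambda>p. dir_deriv X (\<lambda>p. Y p + Y' p) p + \<Gamma> p (X p) (Y p + Y' p)) =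
       (\<lambda>p. dir_deriv X Y p + \<Gamma> p (X p) (Y p) + (dir_deriv X Y' p + \<Gamma> p (X p) (Y' p)))"
      by (auto simp: dir_deriv_def add bilinear_radd[OF bil])
  next
    fix f :: "'a \<Rightarrow> real" and X Y :: "'a \<Rightarrow> 'a" assume "smooth f" "smooth X" "smooth Y"
    then show "(\<lambda>p. dir_deriv X (\<lambda>p. f p *\<^sub>R Y p) p + \<Gamma> p (X p) (f p *\<^sub>R Y p)) =
       (\<lambda>p. dir_deriv X f p *\<^sub>R Y p + f p *\<^sub>R (dir_deriv X Y p + \<Gamma> p (X p) (Y p)))"
      by (auto simp: dir_deriv_def prod bilinear_rmul[OF bil] scaleR_add_right)
  next
    fix X Y :: "'a \<Rightarrow> 'a" assume "smooth X" "smooth Y"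
    show "(\<lambda>p. dir_deriv X Y p + \<Gamma> p (X p) (Y p) - (dir_deriv Y X p + \<Gamma> p (Y p) (X p))) = lie_bracket X Y"
      unfolding lie_bracket_def by (rule ext) (subst symm, simp)
  qed
  show "christoffel (\<lambda>X Y p. dir_deriv X Y p + \<Gamma> p (X p) (Y p)) p u v = \<Gamma> p u v"
    by (simp add: christoffel_def dir_deriv_def frechet_derivative_const)
qed

definition separable :: "real \<Rightarrow> ('n \<Rightarrow> real poly) \<Rightarrow> real ^ 'n::finite \<Rightarrow> real" where
  "separable c F x = c + (\<Sum>j\<in>UNIV. poly (F j) (x $ j))"

lemma smooth_separable: "smooth (separable c (F :: 'n::finite \<Rightarrow> real poly))"
proof -
  have "smooth (\<lambda>x::real^'n. x $ j)" for j
    by (intro smooth_vec_nth smooth_linear bounded_linear_ident)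
  then show ?thesis unfolding separable_def by (intro smooth_add smooth_const smooth_sum smooth_poly) auto
qed

text \<open>For a geodesic, \<open>w = - \<Gamma>(v, v)\<close> and the second derivative is
  \<open>Hess f (v, v) - df(\<Gamma>(v, v))\<close>. A general \<open>w\<close> serves both the
  constructed connection and an unknown one.\<close>

lemma separable_along_geodesic:
  fixes F :: "'n::finite \<Rightarrow> real poly"
  assumes "\<And>t. t \<in> {0..1} \<Longrightarrow> (\<gamma> has_vector_derivative v t) (at t within {0..1})"
    and "\<And>t. t \<in> {0..1} \<Longrightarrow> (v has_vector_derivative w t) (at t within {0..1})"
    and t: "t \<in> {0..1}"
  shows "((\<lambda>t. separable c F (\<gamma> t)) has_real_derivative
            (\<Sum>j\<in>UNIV. poly (pderiv (F j)) (\<gamma> t $ j) * v t $ j)) (at t within {0..1})"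
    and "((\<lambda>t. \<Sum>j\<in>UNIV. poly (pderiv (F j)) (\<gamma> t $ j) * v t $ j) has_real_derivative
            (\<Sum>j\<in>UNIV. poly (pderiv (pderiv (F j))) (\<gamma> t $ j) * (v t $ j)\<^sup>2 +
                       poly (pderiv (F j)) (\<gamma> t $ j) * w t $ j)) (at t within {0..1})"
proof -
  have \<gamma>: "((\<lambda>t. \<gamma> t $ j) has_real_derivative v t $ j) (at t within {0..1})" for j
    using bounded_linear.has_vector_derivative[OF bounded_linear_vec_nth assms(1)[OF t]]
    by (simp add: has_real_derivative_iff_has_vector_derivative)
  have v: "((\<lambda>t. v t $ j) has_real_derivative w t $ j) (at t within {0..1})" for j
    using bounded_linear.has_vector_derivative[OF bounded_linear_vec_nth assms(2)[OF t]]
    by (simp add: has_real_derivative_iff_has_vector_derivative)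
  have p: "((\<lambda>t. poly p (\<gamma> t $ j)) has_real_derivative poly (pderiv p) (\<gamma> t $ j) * v t $ j) (at t within {0..1})" for p j
    by (rule DERIV_chain2[OF poly_DERIV \<gamma>])
  have "((\<lambda>t. c + (\<Sum>j\<in>UNIV. poly (F j) (\<gamma> t $ j))) has_real_derivative
      0 + (\<Sum>j\<in>UNIV. poly (pderiv (F j)) (\<gamma> t $ j) * v t $ j)) (at t within {0..1})"
    by (intro DERIV_add DERIV_const DERIV_sum p)
  then show "((\<lambda>t. separable c F (\<gamma> t)) has_real_derivative
            (\<Sum>j\<in>UNIV. poly (pderiv (F j)) (\<gamma> t $ j) * v t $ j)) (at t within {0..1})"
    by (simp add: separable_def)
  have "((\<lambda>t. \<Sum>j\<in>UNIV. poly (pderiv (F j)) (\<gamma> t $ j) * v t $ j) has_real_derivative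
            (\<Sum>j\<in>UNIV. poly (pderiv (pderiv (F j))) (\<gamma> t $ j) * v t $ j * v t $ j +
                       w t $ j * poly (pderiv (F j)) (\<gamma> t $ j))) (at t within {0..1})"
    by (intro DERIV_sum DERIV_mult p v)
  then show "((\<lambda>t. \<Sum>j\<in>UNIV. poly (pderiv (F j)) (\<gamma> t $ j) * v t $ j) has_real_derivative
            (\<Sum>j\<in>UNIV. poly (pderiv (pderiv (F j))) (\<gamma> t $ j) * (v t $ j)\<^sup>2 +
                       poly (pderiv (F j)) (\<gamma> t $ j) * w t $ j)) (at t within {0..1})"
    by (simp add: power2_eq_square mult.assoc mult.commute[of "w t $ _"])
qed

text \<open>Geodesics have only one-sided derivatives at 0 and 1, hence derivatives within the
  closed interval. Monotonicity of \<open>f'\<close> compares the mean slopes on the two sides of an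
  intermediate point.\<close>

lemma convex_on_second_derivative_within:
  fixes f :: "real \<Rightarrow> real"
  assumes f: "\<And>t. t \<in> {a..b} \<Longrightarrow> (f has_real_derivative f' t) (at t within {a..b})"
    and f': "\<And>t. t \<in> {a..b} \<Longrightarrow> (f' has_real_derivative f'' t) (at t within {a..b})"
    and pos: "\<And>t. t \<in> {a..b} \<Longrightarrow> f'' t \<ge> 0"
  shows "convex_on {a..b} f"
proof -
  have mvt: "\<exists>z. x < z \<and> z < y \<and> g y - g x = (y - x) * g' z"
    if g: "\<And>t. t \<in> {a..b} \<Longrightarrow> (g has_real_derivative g' t) (at t within {a..b})"
      and xy: "a \<le> x" "x < y" "y \<le> b" for g g' :: "real \<Rightarrow> real" and x y
  proof -
    have "\<exists>z\<in>{x<..<y}. g y - g x = g' z * (y - x)"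
    proof (rule mvt_simple[OF xy(2)])
      show "(g has_derivative (*) (g' t)) (at t within {x..y})" if "x \<le> t" "t \<le> y" for t
        using has_field_derivative_subset[OF g[of t], of "{x..y}"] xy that by (simp add: has_field_derivative_def)
    qed
    then show ?thesis by (auto simp: mult.commute)
  qed
  have mono: "f' x \<le> f' y" if xy: "a \<le> x" "x < y" "y \<le> b" for x y
  proof -
    obtain z where "x < z" "z < y" "f' y - f' x = (y - x) * f'' z" using mvt[OF f' xy] by blast
    then show ?thesis using pos[of z] xy by (smt (verit) atLeastAtMost_iff mult_nonneg_nonneg)
  qed
  show ?thesis
  proof (rule convex_on_linorderI)
    fix t x y :: real assume t: "t > 0" "t < 1" and xy: "x \<in> {a..b}" "y \<in> {a..b}" "x < y"
    define z where "z = (1 - t) * x + t * y"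
    have zx: "z - x = t * (y - x)" unfolding z_def by (simp add: algebra_simps)
    have yz: "y - z = (1 - t) * (y - x)" unfolding z_def by (simp add: algebra_simps)
    have "0 < z - x" unfolding zx using t xy by simp
    moreover have "0 < y - z" unfolding yz using t xy by simp
    ultimately have z: "x < z" "z < y" by simp_all
    obtain p where p: "x < p" "p < z" "f z - f x = (z - x) * f' p" using mvt[OF f, of x z] z xy by auto
    obtain q where q: "z < q" "q < y" "f y - f z = (y - z) * f' q" using mvt[OF f, of z y] z xy by auto
    have "f' p \<le> f' q" using mono[of p q] p q xy by simp
    moreover have "(1 - t) * f x + t * f y - f z = t * (f y - f z) - (1 - t) * (f z - f x)"
      by (simp add: algebra_simps)
    moreover have "\<dots> = t * (1 - t) * (y - x) * (f' q - f' p)"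
      unfolding p(3) q(3) zx yz by (simp add: algebra_simps)
    moreover have "t * (1 - t) * (y - x) * (f' q - f' p) \<ge> 0"
      using t xy \<open>f' p \<le> f' q\<close> by (intro mult_nonneg_nonneg) auto
    ultimately have "f z \<le> (1 - t) * f x + t * f y" by linarith
    then show "f ((1 - t) *\<^sub>R x + t *\<^sub>R y) \<le> (1 - t) * f x + t * f y" by (simp add: z_def)
  qed simp
qed

text \<open>The connection has Christoffel symbols \<open>\<Gamma>(u,v) = - (\<Sum>i. K (1 + x\<^sub>i\<^sup>2)\<^sup>m u\<^sub>i v\<^sub>i) \<nabla>f\<close>, so that
  \<open>Hess f - df \<circ> \<Gamma>\<close> is the diagonal form with the entries assumed nonnegative.\<close>

lemma separable_g_convexI:
  fixes F :: "'n::finite \<Rightarrow> real poly"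
  assumes pos: "\<And>x i. poly (pderiv (pderiv (F i))) (x $ i) +
       K * (1 + (x $ i)\<^sup>2) ^ m * (\<Sum>j\<in>UNIV. (poly (pderiv (F j)) (x $ j))\<^sup>2) \<ge> 0"
  shows "\<exists>D. connection D \<and> g_convex D (separable c F)"
proof -
  define S where "S x u v = (\<Sum>i\<in>UNIV. K * (1 + (x $ i)\<^sup>2) ^ m * (u $ i) * (v $ i))" for x u v :: "real ^ 'n"
  define G where "G x = (\<chi> j. poly (pderiv (F j)) (x $ j))" for x :: "real ^ 'n"
  define \<Gamma> where "\<Gamma> x u v = - (S x u v *\<^sub>R G x)" for x u v
  have bil: "bilinear (\<Gamma> x)" for x
    unfolding bilinear_def
    by (intro conjI allI linearI)
      (simp_all add: \<Gamma>_def S_def algebra_simps sum.distrib sum_distrib_left scaleR_left_distrib)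
  have nth: "smooth (\<lambda>x::real^'n. x $ j)" for j
    by (intro smooth_vec_nth smooth_linear bounded_linear_ident)
  have smth: "smooth (\<lambda>p. \<Gamma> p (X p) (Y p))" if "smooth X" "smooth Y" for X Y
    unfolding \<Gamma>_def S_def G_def
    by (intro smooth_uminus smooth_scaleR smooth_sum smooth_mult smooth_const smooth_power smooth_add
        smooth_vec_lambda smooth_poly nth smooth_vec_nth that) auto
  have symm: "\<Gamma> p u v = \<Gamma> p v u" for p u v
  proof -
    have "S p u v = S p v u" unfolding S_def by (rule sum.cong) (simp_all add: mult_ac)
    then show ?thesis by (simp add: \<Gamma>_def)
  qed
  define D where "D = (\<lambda>X Y p. dir_deriv X Y p + \<Gamma> p (X p) (Y p))"
  have D: "connection D" "christoffel D p u v = \<Gamma> p u v" for p u v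
    unfolding D_def by (rule connection_flat_plus[OF bil symm smth]; assumption)+
  have "g_convex D (separable c F)"
    unfolding g_convex_def
  proof (intro conjI allI impI smooth_separable)
    fix \<gamma> assume "geodesic D \<gamma>"
    then obtain v where v: "\<And>t. t \<in> {0..1} \<Longrightarrow> (\<gamma> has_vector_derivative v t) (at t within {0..1})"
        "\<And>t. t \<in> {0..1} \<Longrightarrow> (v has_vector_derivative - \<Gamma> (\<gamma> t) (v t) (v t)) (at t within {0..1})"
      unfolding geodesic_def D(2) by blast
    note der = separable_along_geodesic(1)[OF v, where c = c and F = F] separable_along_geodesic(2)[OF v, where F = F]
    have "convex_on {0..1} (\<lambda>t. separable c F (\<gamma> t))"
    proof (rule convex_on_second_derivative_within[OF der])
      fix t :: real
      define n where "n = (\<Sum>j\<in>UNIV. (poly (pderiv (F j)) (\<gamma> t $ j))\<^sup>2)"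
      \<comment> \<open>As \<open>- \<Gamma>\<close> is \<open>S\<close> times the gradient
        \<open>G\<close>, the first-order term pairs \<open>G\<close> with itself and yields
        \<open>S\<close> times the squared norm \<open>n\<close>.\<close>
      have "(\<Sum>j\<in>UNIV. poly (pderiv (pderiv (F j))) (\<gamma> t $ j) * (v t $ j)\<^sup>2 +
                       poly (pderiv (F j)) (\<gamma> t $ j) * (- \<Gamma> (\<gamma> t) (v t) (v t)) $ j)
          = (\<Sum>j\<in>UNIV. poly (pderiv (pderiv (F j))) (\<gamma> t $ j) * (v t $ j)\<^sup>2) + S (\<gamma> t) (v t) (v t) * n"
        by (simp add: \<Gamma>_def G_def n_def sum.distrib sum_distrib_left power2_eq_square mult_ac)
      also have "\<dots> = (\<Sum>j\<in>UNIV. (poly (pderiv (pderiv (F j))) (\<gamma> t $ j) + K * (1 + (\<gamma> t $ j)\<^sup>2) ^ m * n) * (v t $ j)\<^sup>2)"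
        unfolding S_def sum_distrib_right sum.distrib[symmetric]
        by (rule sum.cong) (simp_all add: algebra_simps power2_eq_square)
      also have "\<dots> \<ge> 0" using pos unfolding n_def by (intro sum_nonneg mult_nonneg_nonneg) auto
      finally show "0 \<le> (\<Sum>j\<in>UNIV. poly (pderiv (pderiv (F j))) (\<gamma> t $ j) * (v t $ j)\<^sup>2 +
                       poly (pderiv (F j)) (\<gamma> t $ j) * (- \<Gamma> (\<gamma> t) (v t) (v t)) $ j)" .
    qed
    then show "convex_on {0..1} (separable c F \<circ> \<gamma>)" by (simp add: o_def)
  qed
  then show ?thesis using D(1) by blast
qed

section \<open>Local existence of geodesics\<close>

lemma smooth_lipschitz_on_cbox:
  fixes F :: "'a::euclidean_space \<Rightarrow> 'b::real_normed_vector"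
  assumes F: "smooth F"
  obtains L where "L \<ge> 0" "\<And>x y. x \<in> cbox a b \<Longrightarrow> y \<in> cbox a b \<Longrightarrow> norm (F x - F y) \<le> L * norm (x - y)"
proof -
  have "\<exists>B. \<forall>x\<in>cbox a b. norm (frechet_derivative F (at x) e) \<le> B" for e
  proof -
    have "compact ((\<lambda>x. frechet_derivative F (at x) e) ` cbox a b)"
      by (intro compact_continuous_image smooth_imp_continuous_on smooth_frechet_derivative F compact_cbox)
    then have "bounded ((\<lambda>x. frechet_derivative F (at x) e) ` cbox a b)" by (rule compact_imp_bounded)
    then show ?thesis unfolding bounded_iff by auto
  qed
  then obtain B where B: "\<And>x e. x \<in> cbox a b \<Longrightarrow> norm (frechet_derivative F (at x) e) \<le> B e" by metis
  define L where "L = (\<Sum>e\<in>Basis. \<bar>B e\<bar>)"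
  have on: "onorm (frechet_derivative F (at x)) \<le> L" if x: "x \<in> cbox a b" for x
  proof (rule onorm_bound)
    show "0 \<le> L" by (simp add: L_def sum_nonneg)
    fix h :: 'a
    have lin: "linear (frechet_derivative F (at x))"
      using smooth_has_derivative[OF F] has_derivative_linear by blast
    have "frechet_derivative F (at x) h = frechet_derivative F (at x) (\<Sum>e\<in>Basis. (h \<bullet> e) *\<^sub>R e)"
      by (simp add: euclidean_representation)
    also have "\<dots> = (\<Sum>e\<in>Basis. (h \<bullet> e) *\<^sub>R frechet_derivative F (at x) e)"
      by (simp add: linear_sum[OF lin] linear_scale[OF lin])
    finally have "norm (frechet_derivative F (at x) h) \<le> (\<Sum>e\<in>Basis. norm ((h \<bullet> e) *\<^sub>R frechet_derivative F (at x) e))"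
      by (simp only: norm_sum)
    also have "\<dots> \<le> (\<Sum>e\<in>Basis. norm h * \<bar>B e\<bar>)"
    proof (rule sum_mono)
      fix e :: 'a assume "e \<in> Basis"
      then show "norm ((h \<bullet> e) *\<^sub>R frechet_derivative F (at x) e) \<le> norm h * \<bar>B e\<bar>"
        using B[OF x, of e] Basis_le_norm[of e h] by (simp, intro mult_mono) auto
    qed
    finally show "norm (frechet_derivative F (at x) h) \<le> L * norm h"
      by (simp add: L_def sum_distrib_left mult.commute)
  qed
  have "norm (F x - F y) \<le> L * norm (x - y)" if "x \<in> cbox a b" "y \<in> cbox a b" for x y
    by (rule differentiable_bound[OF convex_box(1) _ on that])
      (rule has_derivative_at_withinI[OF smooth_has_derivative[OF F]])
  moreover have "L \<ge> 0" by (simp add: L_def sum_nonneg)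
  ultimately show thesis using that by blast
qed

text \<open>For \<open>h * L < 1\<close> the integral operator is a contraction. The bound on the
  distance from \<open>y0\<close> is recorded because it will keep solutions of a truncated field in
  the region where the truncation is invisible.\<close>

lemma picard_lipschitz:
  fixes F :: "'a::euclidean_space \<Rightarrow> 'a"
  assumes L: "\<And>x y. norm (F x - F y) \<le> L * norm (x - y)" and B: "\<And>x. norm (F x) \<le> B"
    and h: "h > 0" "h * L < 1"
  obtains y where "y 0 = y0" "\<And>t. t \<in> {0..h} \<Longrightarrow> (y has_vector_derivative F (y t)) (at t within {0..h})"
    "\<And>t. t \<in> {0..h} \<Longrightarrow> norm (y t - y0) \<le> h * B"
proof -
  have L0: "L \<ge> 0"
  proof -
    obtain e :: 'a where "norm e = 1" using vector_choose_size[of 1] by auto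
    then show ?thesis using L[of e 0] order_trans[OF norm_ge_zero[of "F e - F 0"]] by simp
  qed
  have F_cont: "continuous_on S F" for S
  proof -
    have "L-lipschitz_on S F" using L L0 by (intro lipschitz_onI) (auto simp: dist_norm)
    then show ?thesis by (rule lipschitz_on_continuous_on)
  qed
  \<comment> \<open>Clamping the time extends functions on \<open>{0..h}\<close> by constants to the
    whole line, where the complete space of bounded continuous functions is at hand.\<close>
  define c where "c t = max 0 (min h t)" for t :: real
  have c: "c t \<in> {0..h}" "t \<in> {0..h} \<Longrightarrow> c t = t" for t using h by (auto simp: c_def)
  define T where "T y t = y0 + integral {0..c t} (\<lambda>s. F (apply_bcontfun y s))" for y t
  have Fy_cont: "continuous_on S (\<lambda>s. F (apply_bcontfun y s))" for S y
    by (intro continuous_on_compose2[OF F_cont[of UNIV]] continuous_intros) auto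
  have Fy_int: "(\<lambda>s. F (apply_bcontfun y s)) integrable_on {0..t}" for y and t :: real
    by (rule integrable_continuous_real[OF Fy_cont])
  have T_bound: "norm (T y t - y0) \<le> h * B" for y t
  proof -
    have "norm (integral {0..c t} (\<lambda>s. F (apply_bcontfun y s))) \<le> B * (c t - 0)"
      using c[of t] B by (intro integral_bound Fy_cont) auto
    also have "B * (c t - 0) \<le> B * h" using c(1)[of t] order_trans[OF norm_ge_zero B[of 0]]
      by (intro mult_left_mono) auto
    finally show ?thesis by (simp add: T_def mult.commute)
  qed
  have T_bcont: "T y \<in> bcontfun" for y
  proof (rule bcontfun_normI)
    have "continuous_on {0..h} (\<lambda>t. integral {0..t} (\<lambda>s. F (apply_bcontfun y s)))"
      by (rule indefinite_integral_continuous_1[OF Fy_int])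
    then have "continuous_on UNIV (\<lambda>t. integral {0..c t} (\<lambda>s. F (apply_bcontfun y s)))"
      by (rule continuous_on_compose2[where t="{0..h}"]) (use c in \<open>auto simp: c_def[abs_def] intro!: continuous_intros\<close>)
    then show "continuous_on UNIV (T y)" unfolding T_def[abs_def] by (intro continuous_intros)
    show "norm (T y t) \<le> norm y0 + h * B" for t
      using T_bound[of y t] norm_triangle_sub[of "T y t" y0] by linarith
  qed
  have T_app: "apply_bcontfun (Bcontfun (T y)) = T y" for y by (rule Bcontfun_inverse[OF T_bcont])
  have contr: "dist (Bcontfun (T y)) (Bcontfun (T z)) \<le> h * L * dist y z" for y z
  proof (rule dist_bound)
    fix t
    have "T y t - T z t = integral {0..c t} (\<lambda>s. F (apply_bcontfun y s) - F (apply_bcontfun z s))"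
      by (simp add: T_def integral_diff[OF Fy_int Fy_int])
    also have "norm \<dots> \<le> (L * dist y z) * (c t - 0)"
    proof (rule integral_bound)
      show "continuous_on {0..c t} (\<lambda>s. F (apply_bcontfun y s) - F (apply_bcontfun z s))"
        by (intro continuous_intros Fy_cont)
      fix s
      have "norm (F (apply_bcontfun y s) - F (apply_bcontfun z s)) \<le> L * dist (apply_bcontfun y s) (apply_bcontfun z s)"
        using L by (simp add: dist_norm)
      also have "\<dots> \<le> L * dist y z" using L0 dist_bounded by (intro mult_left_mono) auto
      finally show "norm (F (apply_bcontfun y s) - F (apply_bcontfun z s)) \<le> L * dist y z" .
    qed (use c in auto)
    also have "\<dots> \<le> (L * dist y z) * h" using c(1)[of t] L0 by (intro mult_left_mono) auto
    finally show "dist (apply_bcontfun (Bcontfun (T y)) t) (apply_bcontfun (Bcontfun (T z)) t) \<le> h * L * dist y z"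
      unfolding T_app by (simp add: dist_norm mult_ac)
  qed
  have "\<exists>!y. Bcontfun (T y) = y"
    by (rule banach_fix_type[of "h * L"]) (use h L0 contr in auto)
  then obtain y where y: "Bcontfun (T y) = y" by blast
  then have y_T: "apply_bcontfun y t = T y t" for t using T_app[of y] by simp
  show thesis
  proof (rule that[of "apply_bcontfun y"])
    show "apply_bcontfun y 0 = y0" unfolding y_T by (simp add: T_def c_def)
    show "norm (apply_bcontfun y t - y0) \<le> h * B" for t unfolding y_T by (rule T_bound)
    fix t assume t: "t \<in> {0..h}"
    have d: "((\<lambda>u. y0 + integral {0..u} (\<lambda>s. F (apply_bcontfun y s))) has_vector_derivative F (apply_bcontfun y t)) (at t within {0..h})"
      using has_vector_derivative_add[OF has_vector_derivative_const integral_has_vector_derivative[OF Fy_cont t]] by simp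
    show "(apply_bcontfun y has_vector_derivative F (apply_bcontfun y t)) (at t within {0..h})"
    proof (rule has_vector_derivative_transform[OF t _ d])
      show "apply_bcontfun y u = y0 + integral {0..u} (\<lambda>s. F (apply_bcontfun y s))" if "u \<in> {0..h}" for u
        using y_T[of u] unfolding T_def c(2)[OF that] .
    qed
  qed
qed

text \<open>Composing \<open>F\<close> with the projection onto a box makes it globally bounded and
  Lipschitz; up to time \<open>h\<close> the solution stays in the box, where the two fields
  agree.\<close>

lemma smooth_ode_local_solution:
  fixes F :: "'a::euclidean_space \<Rightarrow> 'a"
  assumes F: "smooth F"
  obtains h y where "h > 0" "y 0 = y0"
    "\<And>t. t \<in> {0..h} \<Longrightarrow> (y has_vector_derivative F (y t)) (at t within {0..h})"
proof -
  define a b where "a = y0 - One" and "b = y0 + One"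
  have ab: "a \<bullet> i \<le> b \<bullet> i" if "i \<in> Basis" for i using that by (simp add: a_def b_def inner_simps)
  obtain L where L: "L \<ge> 0" "\<And>x y. x \<in> cbox a b \<Longrightarrow> y \<in> cbox a b \<Longrightarrow> norm (F x - F y) \<le> L * norm (x - y)"
    using smooth_lipschitz_on_cbox[OF F] by metis
  have "compact (F ` cbox a b)"
    by (intro compact_continuous_image smooth_imp_continuous_on F compact_cbox)
  then have "bounded (F ` cbox a b)" by (rule compact_imp_bounded)
  then obtain B where B: "\<And>x. x \<in> cbox a b \<Longrightarrow> norm (F x) \<le> B" unfolding bounded_iff by auto
  define G where "G x = F (clamp a b x)" for x
  have B0: "B \<ge> 0" using B[OF clamp_in_interval[OF ab]] norm_ge_zero order_trans by blast
  have GL: "norm (G x - G y) \<le> L * norm (x - y)" for x y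
  proof -
    have "norm (G x - G y) \<le> L * norm (clamp a b x - clamp a b y)"
      unfolding G_def by (intro L(2) clamp_in_interval ab)
    also have "\<dots> \<le> L * norm (x - y)" using L(1) dist_clamps_le_dist_args[of a b x y]
      by (intro mult_left_mono) (auto simp: dist_norm)
    finally show ?thesis .
  qed
  have GB: "norm (G x) \<le> B" for x unfolding G_def by (intro B clamp_in_interval ab)
  \<comment> \<open>A single choice gives \<open>h * L < 1\<close> for the contraction and
    \<open>h * B \<le> 1\<close> for staying in the box, whose half-width is 1.\<close>
  define h where "h = 1 / (L + B + 1)"
  have h: "h > 0" "h * L < 1" "h * B \<le> 1" using L(1) B0 by (auto simp: h_def divide_simps)
  obtain y where y: "y 0 = y0" "\<And>t. t \<in> {0..h} \<Longrightarrow> (y has_vector_derivative G (y t)) (at t within {0..h})"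
    "\<And>t. t \<in> {0..h} \<Longrightarrow> norm (y t - y0) \<le> h * B"
    using picard_lipschitz[OF GL GB h(1,2), of y0] by blast
  have "G (y t) = F (y t)" if t: "t \<in> {0..h}" for t
  proof -
    have "y t \<in> cbox a b" unfolding mem_box
    proof
      fix i :: 'a assume i: "i \<in> Basis"
      have "\<bar>(y t - y0) \<bullet> i\<bar> \<le> 1" using Basis_le_norm[OF i, of "y t - y0"] y(3)[OF t] h(3) by linarith
      then show "a \<bullet> i \<le> y t \<bullet> i \<and> y t \<bullet> i \<le> b \<bullet> i" using i by (auto simp: a_def b_def inner_simps abs_le_iff)
    qed
    then show ?thesis by (simp add: G_def)
  qed
  then show thesis using y(2) by (intro that[where h = h and y = y] h(1) y(1)) simp
qed

lemma connection_christoffel_bilinear: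
  assumes D: "connection D"
  shows "bilinear (christoffel D p)"
proof -
  note D' = D[unfolded connection_def]
  have add1: "D (\<lambda>_. u + u') (\<lambda>_. v) p = D (\<lambda>_. u) (\<lambda>_. v) p + D (\<lambda>_. u') (\<lambda>_. v) p" for u u' v
    using D'[THEN conjunct2, THEN conjunct1, rule_format, of "\<lambda>_. u" "\<lambda>_. u'" "\<lambda>_. v"] smooth_const by metis
  have scale1: "D (\<lambda>_. c *\<^sub>R u) (\<lambda>_. v) p = c *\<^sub>R D (\<lambda>_. u) (\<lambda>_. v) p" for c u v
    using D'[THEN conjunct2, THEN conjunct2, THEN conjunct1, rule_format, of "\<lambda>_. c" "\<lambda>_. u" "\<lambda>_. v"] smooth_const by metis
  have add2: "D (\<lambda>_. u) (\<lambda>_. v + v') p = D (\<lambda>_. u) (\<lambda>_. v) p + D (\<lambda>_. u) (\<lambda>_. v') p" for u v v'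
    using D'[THEN conjunct2, THEN conjunct2, THEN conjunct2, THEN conjunct1, rule_format, of "\<lambda>_. u" "\<lambda>_. v" "\<lambda>_. v'"] smooth_const by metis
  have scale2: "D (\<lambda>_. u) (\<lambda>_. c *\<^sub>R v) p = c *\<^sub>R D (\<lambda>_. u) (\<lambda>_. v) p" for c u v
  proof -
    have "D (\<lambda>_. u) (\<lambda>_. c *\<^sub>R v) = (\<lambda>p. dir_deriv (\<lambda>_. u) (\<lambda>_. c) p *\<^sub>R v + c *\<^sub>R D (\<lambda>_. u) (\<lambda>_. v) p)"
      using D'[THEN conjunct2, THEN conjunct2, THEN conjunct2, THEN conjunct2, THEN conjunct1, rule_format, of "\<lambda>_. c" "\<lambda>_. u" "\<lambda>_. v"] by (simp add: smooth_const)
    then show ?thesis by (simp add: dir_deriv_def frechet_derivative_const)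
  qed
  show ?thesis unfolding bilinear_def christoffel_def
    by (intro conjI allI linearI add1 add2 scale1 scale2)
qed

text \<open>A solution on a short interval \<open>{0..h}\<close> is reparametrised to
  \<open>{0..1}\<close>. As the equation is quadratic in the velocity, this only scales the initial
  velocity, whence the factor \<open>s\<close>.\<close>

lemma geodesic_exists:
  fixes D :: "'a::euclidean_space vfield \<Rightarrow> 'a vfield \<Rightarrow> 'a vfield"
  assumes D: "connection D"
  obtains \<gamma> v s where "s > 0" "\<gamma> 0 = p" "v 0 = s *\<^sub>R u"
    "\<And>t. t \<in> {0..1} \<Longrightarrow> (\<gamma> has_vector_derivative v t) (at t within {0..1})"
    "\<And>t. t \<in> {0..1} \<Longrightarrow> (v has_vector_derivative - christoffel D (\<gamma> t) (v t) (v t)) (at t within {0..1})"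
proof -
  have bil: "bilinear (christoffel D q)" for q by (rule connection_christoffel_bilinear[OF D])
  \<comment> \<open>The axioms give smooth Christoffel symbols only for fixed vectors; the expansion
    in the basis makes them jointly smooth in position and velocity.\<close>
  have expand: "christoffel D q w w = (\<Sum>i\<in>Basis. \<Sum>j\<in>Basis. ((w \<bullet> i) * (w \<bullet> j)) *\<^sub>R christoffel D q i j)" for q w
  proof -
    have "christoffel D q w w = christoffel D q (\<Sum>i\<in>Basis. (w \<bullet> i) *\<^sub>R i) (\<Sum>j\<in>Basis. (w \<bullet> j) *\<^sub>R j)"
      by (simp add: euclidean_representation)
    also have "\<dots> = (\<Sum>(i, j)\<in>Basis \<times> Basis. christoffel D q ((w \<bullet> i) *\<^sub>R i) ((w \<bullet> j) *\<^sub>R j))"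
      by (rule bilinear_sum[OF bil])
    finally show ?thesis
      by (simp add: sum.cartesian_product bilinear_lmul[OF bil] bilinear_rmul[OF bil] mult.commute)
  qed
  have sm: "smooth (\<lambda>q. christoffel D q i j)" for i j
    using D smooth_const unfolding connection_def christoffel_def by blast
  define F where "F z = (snd z, - christoffel D (fst z) (snd z) (snd z))" for z
  have smooth_snd: "smooth (\<lambda>z::'a \<times> 'a. snd z)" by (intro smooth_linear bounded_linear_snd)
  have smooth_F: "smooth F"
  proof -
    have 1: "smooth (\<lambda>z::'a \<times> 'a. - christoffel D (fst z) (snd z) (snd z))"
      unfolding expand
      by (intro smooth_uminus smooth_sum smooth_scaleR smooth_mult smooth_inner smooth_snd smooth_const
          smooth_linear_compose[OF bounded_linear_fst] sm) auto
    have l1: "bounded_linear (\<lambda>z::'a \<times> 'a. (snd z, 0::'a))"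
      by (intro bounded_linear_Pair bounded_linear_snd bounded_linear_zero)
    have l2: "bounded_linear (\<lambda>v::'a. (0::'a, v))"
      by (intro bounded_linear_Pair bounded_linear_ident bounded_linear_zero)
    have "smooth (\<lambda>z. (snd z, 0::'a) + (0, - christoffel D (fst z) (snd z) (snd z)))"
      by (rule smooth_add[OF smooth_linear[OF l1] smooth_linear_image[OF l2 1]])
    then show ?thesis unfolding F_def[abs_def] by simp
  qed
  obtain h y where h: "h > 0" and y: "y 0 = (p, u)"
    "\<And>t. t \<in> {0..h} \<Longrightarrow> (y has_vector_derivative F (y t)) (at t within {0..h})"
    using smooth_ode_local_solution[OF smooth_F] by blast
  define \<gamma> where "\<gamma> t = fst (y (h * t))" for t
  define v where "v t = h *\<^sub>R snd (y (h * t))" for t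
  have yh: "((\<lambda>t. y (h * t)) has_vector_derivative h *\<^sub>R F (y (h * t))) (at t within {0..1})" if "t \<in> {0..1}" for t
  proof -
    have im: "(\<lambda>t. h * t) ` {0..1} \<subseteq> {0..h}" using h by (auto simp: mult_left_le)
    have "((\<lambda>t. h * t) has_vector_derivative h) (at t within {0..1})"
      by (auto intro!: derivative_eq_intros simp flip: has_real_derivative_iff_has_vector_derivative)
    moreover have "(y has_vector_derivative F (y (h * t))) (at (h * t) within (\<lambda>t. h * t) ` {0..1})"
      using has_vector_derivative_within_subset[OF y(2) im] that im by blast
    ultimately show ?thesis
      using vector_diff_chain_within[of "\<lambda>t. h * t" h t "{0..1}" y] by (simp add: o_def)
  qed
  show thesis
  proof (rule that[OF h])
    show "\<gamma> 0 = p" "v 0 = h *\<^sub>R u" by (simp_all add: \<gamma>_def v_def y(1))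
    fix t :: real assume t: "t \<in> {0..1}"
    show "(\<gamma> has_vector_derivative v t) (at t within {0..1})"
      using bounded_linear.has_vector_derivative[OF bounded_linear_fst yh[OF t]]
      by (simp add: \<gamma>_def[abs_def] v_def F_def)
    have "((\<lambda>t. h *\<^sub>R snd (y (h * t))) has_vector_derivative h *\<^sub>R snd (h *\<^sub>R F (y (h * t)))) (at t within {0..1})"
      by (intro bounded_linear.has_vector_derivative[OF bounded_linear_scaleR_right]
          bounded_linear.has_vector_derivative[OF bounded_linear_snd yh[OF t]])
    then show "(v has_vector_derivative - christoffel D (\<gamma> t) (v t) (v t)) (at t within {0..1})"
      by (simp add: \<gamma>_def v_def[abs_def] F_def bilinear_lmul[OF bil] bilinear_rmul[OF bil])
  qed
qed

section \<open>The Hessian at critical points\<close>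

text \<open>Difference quotients at 0 lie below the slope of the chord to \<open>t\<close>, so that
  slope is at least the derivative 0.\<close>

lemma convex_on_minimum_left_endpoint:
  fixes f :: "real \<Rightarrow> real"
  assumes conv: "convex_on {0..1} f" and der: "(f has_real_derivative 0) (at 0 within {0..1})"
    and t: "t \<in> {0..1}"
  shows "f 0 \<le> f t"
proof (cases "t = 0")
  case False
  then have t0: "t > 0" using t by simp
  have lim: "((\<lambda>s. (f s - f 0) / (s - 0)) \<longlongrightarrow> 0) (at 0 within {0..1})"
    using der by (simp add: has_field_derivative_iff)
  have nb: "at (0::real) within {0..1} \<noteq> bot" by (simp add: trivial_limit_within islimpt_Icc)
  have ev: "\<forall>\<^sub>F s in at 0 within {0..1}. (f s - f 0) / (s - 0) \<le> (f t - f 0) / t"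
    unfolding eventually_at
  proof (intro exI[of _ t] conjI ballI impI t0)
    fix s :: real assume s: "s \<in> {0..1}" "s \<noteq> 0 \<and> dist s 0 < t"
    then have s': "0 < s" "s < t" by auto
    have "f ((1 - s / t) *\<^sub>R 0 + (s / t) *\<^sub>R t) \<le> (1 - s / t) * f 0 + (s / t) * f t"
      using s' t by (intro convex_onD[OF conv]) auto
    then show "(f s - f 0) / (s - 0) \<le> (f t - f 0) / t" using s' by (simp add: field_simps)
  qed
  have "0 \<le> (f t - f 0) / t" by (rule tendsto_upperbound[OF lim ev nb])
  then show ?thesis using t0 by (simp add: field_simps)
qed simp

text \<open>At a critical point the contribution of any connection vanishes. Along a geodesic
  starting in direction \<open>i\<close>, a negative \<open>f_i''\<close> would make
  \<open>f\<close> drop right after 0, although convexity and the zero derivative force a minimum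
  there.\<close>

lemma g_convex_separable_critical:
  fixes F :: "'n::finite \<Rightarrow> real poly"
  assumes D: "connection D" and conv: "g_convex D (separable c F)"
    and crit: "\<And>j. poly (pderiv (F j)) (p $ j) = 0"
  shows "poly (pderiv (pderiv (F i))) (p $ i) \<ge> 0"
proof (rule ccontr)
  assume neg: "\<not> ?thesis"
  obtain \<gamma> v s where s: "s > 0" and \<gamma>: "\<gamma> 0 = p" "v 0 = s *\<^sub>R axis i (1::real)"
    "\<And>t. t \<in> {0..1} \<Longrightarrow> (\<gamma> has_vector_derivative v t) (at t within {0..1})"
    "\<And>t. t \<in> {0..1} \<Longrightarrow> (v has_vector_derivative - christoffel D (\<gamma> t) (v t) (v t)) (at t within {0..1})"
    using geodesic_exists[OF D] by metis
  define \<phi> where "\<phi> t = separable c F (\<gamma> t)" for t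
  define \<phi>' where "\<phi>' t = (\<Sum>j\<in>UNIV. poly (pderiv (F j)) (\<gamma> t $ j) * v t $ j)" for t
  note der = separable_along_geodesic(1)[OF \<gamma>(3,4), where c = c and F = F, folded \<phi>_def \<phi>'_def]
    separable_along_geodesic(2)[OF \<gamma>(3,4), where F = F, folded \<phi>'_def]
  have "geodesic D \<gamma>" unfolding geodesic_def using \<gamma>(3,4) by blast
  then have cv: "convex_on {0..1} \<phi>" using conv by (simp add: g_convex_def o_def \<phi>_def[abs_def])
  have \<phi>'0: "\<phi>' 0 = 0" by (simp add: \<phi>'_def \<gamma>(1) crit)
  let ?q = "\<Sum>j\<in>UNIV. poly (pderiv (pderiv (F j))) (\<gamma> 0 $ j) * (v 0 $ j)\<^sup>2 +
       poly (pderiv (F j)) (\<gamma> 0 $ j) * (- christoffel D (\<gamma> 0) (v 0) (v 0)) $ j"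
  have "?q = (\<Sum>j\<in>UNIV. if j = i then poly (pderiv (pderiv (F i))) (p $ i) * s\<^sup>2 else 0)"
    by (rule sum.cong) (auto simp: \<gamma>(1,2) crit axis_def)
  then have "?q < 0" using neg s by (simp add: mult_neg_pos)
  moreover have "(\<phi>' has_real_derivative ?q) (at 0 within {0..1})" using der(2)[of 0] by simp
  ultimately obtain d where d: "d > 0" "\<And>t. t > 0 \<Longrightarrow> 0 + t \<in> {0..1} \<Longrightarrow> t < d \<Longrightarrow> \<phi>' (0 + t) < \<phi>' 0"
    using has_real_derivative_neg_dec_right[of \<phi>' ?q 0 "{0..1}"] by blast
  define e where "e = min (d / 2) 1"
  have e: "0 < e" "e \<le> 1" "e < d" using d(1) by (auto simp: e_def)
  have "\<exists>z\<in>{0<..<e}. \<phi> e - \<phi> 0 = \<phi>' z * (e - 0)"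
  proof (rule mvt_simple[OF e(1)])
    show "(\<phi> has_derivative (*) (\<phi>' t)) (at t within {0..e})" if "0 \<le> t" "t \<le> e" for t
      using has_field_derivative_subset[OF der(1)[of t], of "{0..e}"] e that by (simp add: has_field_derivative_def)
  qed
  then obtain z where z: "0 < z" "z < e" "\<phi> e - \<phi> 0 = \<phi>' z * e" by auto
  have "\<phi>' z < 0" using d(2)[of z] z e \<phi>'0 by simp
  then have "\<phi> e < \<phi> 0" using z(3) e(1) mult_neg_pos[of "\<phi>' z" e] by linarith
  moreover have "\<phi> 0 \<le> \<phi> e" using e der(1)[of 0] \<phi>'0 by (intro convex_on_minimum_left_endpoint[OF cv]) auto
  ultimately show False by simp
qed

section \<open>Sign changes of random polynomials\<close>

definition unif :: "real \<Rightarrow> real measure" where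
  "unif r = uniform_measure lborel {-r..r}"

lemma sets_unif [simp, measurable_cong]: "sets (unif r) = sets borel"
  by (simp add: unif_def)

lemma space_unif [simp]: "space (unif r) = UNIV"
  by (simp add: unif_def)

lemma emeasure_unif:
  assumes "A \<in> sets borel" "r > 0"
  shows "emeasure (unif r) A = emeasure lborel ({-r..r} \<inter> A) / ennreal (2 * r)"
  using assms by (simp add: unif_def)

lemma prob_space_unif: "r > 0 \<Longrightarrow> prob_space (unif r)"
  unfolding unif_def by (rule prob_space_uniform_measure) auto

lemma emeasure_unif_uminus:
  assumes A: "A \<in> sets borel" and r: "r > 0"
  shows "emeasure (unif r) (uminus -` A) = emeasure (unif r) A"
proof -
  have [measurable]: "uminus -` A \<in> sets borel"
    using measurable_sets[of uminus borel borel A] A by simp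
  have "emeasure lborel ({-r..r} \<inter> A) = emeasure (distr lborel borel uminus) ({-r..r} \<inter> A)"
    by (simp add: lborel_distr_uminus)
  also have "\<dots> = emeasure lborel (uminus -` ({-r..r} \<inter> A))"
    using A by (subst emeasure_distr) auto
  also have "uminus -` ({-r..r} \<inter> A) = {-r..r} \<inter> uminus -` A" by auto
  finally show ?thesis using A r by (simp add: emeasure_unif)
qed

lemma emeasure_unif_small_ball:
  assumes r: "r > 0" and w: "w > 0" and z: "z \<ge> 0"
  shows "emeasure (unif r) {y. \<bar>w * y + s\<bar> \<le> z} \<le> ennreal (z / (w * r))"
proof -
  have eq: "{y. \<bar>w * y + s\<bar> \<le> z} = {(- z - s) / w..(z - s) / w}"
    using w by (auto simp: abs_le_iff field_simps)
  have "emeasure (unif r) {y. \<bar>w * y + s\<bar> \<le> z} \<le> emeasure lborel {(- z - s) / w..(z - s) / w} / ennreal (2 * r)"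
    unfolding eq using r by (subst emeasure_unif) (auto intro!: divide_right_mono_ennreal emeasure_mono)
  also have "\<dots> = ennreal (2 * z / w) / ennreal (2 * r)"
    using w z by (simp add: divide_right_mono diff_divide_distrib[symmetric])
  also have "\<dots> = ennreal (z / (w * r))"
    using w z r by (simp add: divide_ennreal)
  finally show ?thesis .
qed

lemma measurable_component_unif:
  assumes "i \<in> I"
  shows "(\<lambda>a. a i) \<in> borel_measurable (Pi\<^sub>M I (\<lambda>_. unif r))"
proof -
  have "measurable (Pi\<^sub>M I (\<lambda>_. unif r)) (unif r) = borel_measurable (Pi\<^sub>M I (\<lambda>_. unif r))"
    by (rule measurable_cong_sets) simp_all
  then show ?thesis using measurable_component_singleton[OF assms, of "\<lambda>_. unif r"] by simp
qed

lemma distr_PiM_unif_flip: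
  assumes I: "finite I" and r: "r > 0" and s: "\<And>i. i \<in> I \<Longrightarrow> s i = 1 \<or> s i = -1"
  shows "distr (Pi\<^sub>M I (\<lambda>_. unif r)) (Pi\<^sub>M I (\<lambda>_. unif r)) (\<lambda>a. \<lambda>i\<in>I. s i * a i) = Pi\<^sub>M I (\<lambda>_. unif r)"
proof -
  interpret prob_space "unif r" by (rule prob_space_unif[OF r])
  interpret product_sigma_finite "\<lambda>_. unif r" ..
  let ?M = "Pi\<^sub>M I (\<lambda>_. unif r)" and ?f = "\<lambda>a. \<lambda>i\<in>I. s i * a i"
  have f: "?f \<in> measurable ?M ?M" by measurable
  show ?thesis
  proof (rule PiM_eqI[OF I])
    fix A assume A: "\<And>i. i \<in> I \<Longrightarrow> A i \<in> sets (unif r)"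
    have A': "(\<lambda>y. s i * y) -` A i \<in> sets (unif r)" if "i \<in> I" for i
      using measurable_sets[of "\<lambda>y. s i * y" borel borel "A i"] A[OF that] by simp
    have "emeasure (distr ?M ?M ?f) (Pi\<^sub>E I A) = emeasure ?M (?f -` Pi\<^sub>E I A \<inter> space ?M)"
      using A I by (intro emeasure_distr f sets_PiM_I_finite) auto
    also have "?f -` Pi\<^sub>E I A \<inter> space ?M = Pi\<^sub>E I (\<lambda>i. (\<lambda>y. s i * y) -` A i)"
      by (auto simp: space_PiM PiE_iff)
    also have "emeasure ?M \<dots> = (\<Prod>i\<in>I. emeasure (unif r) ((\<lambda>y. s i * y) -` A i))"
      using A' by (intro emeasure_PiM I) auto
    also have "\<dots> = (\<Prod>i\<in>I. emeasure (unif r) (A i))"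
    proof (rule prod.cong[OF refl])
      fix i assume i: "i \<in> I"
      show "emeasure (unif r) ((\<lambda>y. s i * y) -` A i) = emeasure (unif r) (A i)"
        using s[OF i] A[OF i] emeasure_unif_uminus[of "A i" r] r by auto
    qed
    finally show "emeasure (distr ?M ?M ?f) (Pi\<^sub>E I A) = (\<Prod>i\<in>I. emeasure (unif r) (A i))" .
  qed simp
qed

lemma AE_PiM_unif_bounded:
  assumes I: "finite I" and r: "r > 0" and k: "k \<in> I"
  shows "AE a in Pi\<^sub>M I (\<lambda>_. unif r). \<bar>a k\<bar> \<le> r"
proof (rule AE_PiM_component[OF prob_space_unif[OF r] k])
  show "AE y in unif r. \<bar>y\<bar> \<le> r"
    unfolding unif_def by (rule AE_uniform_measureI) (auto simp: abs_le_iff)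
qed

text \<open>Flipping the sign of one coefficient removes the mixed terms.\<close>

lemma nn_integral_linear_form_square:
  assumes I: "finite I" and r: "r > 0" and B: "B \<subseteq> I"
  shows "(\<integral>\<^sup>+a. ennreal ((\<Sum>k\<in>B. w k * a k)\<^sup>2) \<partial>Pi\<^sub>M I (\<lambda>_. unif r)) \<le> ennreal (r\<^sup>2 * (\<Sum>k\<in>B. (w k)\<^sup>2))"
  using finite_subset[OF B I] B
proof (induction B rule: finite_induct)
  case (insert k B)
  let ?M = "Pi\<^sub>M I (\<lambda>_. unif r)"
  interpret prob_space ?M by (intro prob_space_PiM prob_space_unif r)
  define X where "X a = (\<Sum>k\<in>B. w k * a k)" for a
  have k: "k \<in> I" and BI: "B \<subseteq> I" using insert.prems by auto
  have X_meas [measurable]: "X \<in> borel_measurable ?M"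
    unfolding X_def[abs_def] using BI 
    by (intro borel_measurable_sum borel_measurable_times borel_measurable_const measurable_component_unif) auto
  have k_meas [measurable]: "(\<lambda>a. a k) \<in> borel_measurable ?M"
    by (rule measurable_component_unif[OF k])
  define s where "s i = (if i = k then -1 else 1::real)" for i
  let ?f = "\<lambda>a. \<lambda>i\<in>I. s i * a i"
  have f: "?f \<in> measurable ?M ?M" by measurable
  have "(\<integral>\<^sup>+a. ennreal ((w k * a k + X a)\<^sup>2) \<partial>?M) = (\<integral>\<^sup>+a. ennreal ((w k * a k + X a)\<^sup>2) \<partial>distr ?M ?M ?f)"
    by (subst distr_PiM_unif_flip[OF I r]) (auto simp: s_def)
  also have "\<dots> = (\<integral>\<^sup>+a. ennreal ((w k * ?f a k + X (?f a))\<^sup>2) \<partial>?M)"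
    by (rule nn_integral_distr[OF f]) measurable
  also have "\<dots> = (\<integral>\<^sup>+a. ennreal ((X a - w k * a k)\<^sup>2) \<partial>?M)"
  proof (rule nn_integral_cong)
    fix a
    have "X (?f a) = X a" unfolding X_def using insert.hyps BI by (intro sum.cong) (auto simp: s_def)
    then show "ennreal ((w k * ?f a k + X (?f a))\<^sup>2) = ennreal ((X a - w k * a k)\<^sup>2)"
      using k by (simp add: s_def)
  qed
  finally have eq: "(\<integral>\<^sup>+a. ennreal ((w k * a k + X a)\<^sup>2) \<partial>?M) = (\<integral>\<^sup>+a. ennreal ((X a - w k * a k)\<^sup>2) \<partial>?M)" .
  \<comment> \<open>The integral plus its flipped copy is the parallelogram identity: the mixed term
    in \<open>X a\<close> and \<open>w k * a k\<close> cancels pointwise.\<close>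
  have "2 * (\<integral>\<^sup>+a. ennreal ((w k * a k + X a)\<^sup>2) \<partial>?M) =
      (\<integral>\<^sup>+a. ennreal ((w k * a k + X a)\<^sup>2) \<partial>?M) + (\<integral>\<^sup>+a. ennreal ((X a - w k * a k)\<^sup>2) \<partial>?M)"
    unfolding eq[symmetric] by (simp add: mult_2)
  also have "\<dots> = (\<integral>\<^sup>+a. ennreal ((w k * a k + X a)\<^sup>2) + ennreal ((X a - w k * a k)\<^sup>2) \<partial>?M)"
    by (rule nn_integral_add[symmetric]) measurable
  also have "\<dots> = (\<integral>\<^sup>+a. 2 * (ennreal ((X a)\<^sup>2) + ennreal ((w k * a k)\<^sup>2)) \<partial>?M)"
  proof (rule nn_integral_cong)
    fix a
    have sq: "(w k * a k + X a)\<^sup>2 + (X a - w k * a k)\<^sup>2 = 2 * ((X a)\<^sup>2 + (w k * a k)\<^sup>2)"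
      by (simp add: power2_eq_square algebra_simps)
    have "ennreal ((w k * a k + X a)\<^sup>2) + ennreal ((X a - w k * a k)\<^sup>2) = ennreal (2 * ((X a)\<^sup>2 + (w k * a k)\<^sup>2))"
      unfolding sq[symmetric] by (rule ennreal_plus[symmetric]) simp_all
    also have "\<dots> = 2 * (ennreal ((X a)\<^sup>2) + ennreal ((w k * a k)\<^sup>2))"
      by (simp add: ennreal_mult ennreal_plus)
    finally show "ennreal ((w k * a k + X a)\<^sup>2) + ennreal ((X a - w k * a k)\<^sup>2) = 2 * (ennreal ((X a)\<^sup>2) + ennreal ((w k * a k)\<^sup>2))" .
  qed
  also have "\<dots> = 2 * (\<integral>\<^sup>+a. ennreal ((X a)\<^sup>2) + ennreal ((w k * a k)\<^sup>2) \<partial>?M)"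
    by (rule nn_integral_cmult) measurable
  finally have "(\<integral>\<^sup>+a. ennreal ((w k * a k + X a)\<^sup>2) \<partial>?M) = (\<integral>\<^sup>+a. ennreal ((X a)\<^sup>2) + ennreal ((w k * a k)\<^sup>2) \<partial>?M)"
    by (subst (asm) ennreal_mult_cancel_left) auto
  also have "\<dots> = (\<integral>\<^sup>+a. ennreal ((X a)\<^sup>2) \<partial>?M) + (\<integral>\<^sup>+a. ennreal ((w k * a k)\<^sup>2) \<partial>?M)"
    by (rule nn_integral_add) measurable
  also have "\<dots> \<le> ennreal (r\<^sup>2 * (\<Sum>k\<in>B. (w k)\<^sup>2)) + ennreal (r\<^sup>2 * (w k)\<^sup>2)"
  proof (rule add_mono)
    show "(\<integral>\<^sup>+a. ennreal ((X a)\<^sup>2) \<partial>?M) \<le> ennreal (r\<^sup>2 * (\<Sum>k\<in>B. (w k)\<^sup>2))"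
      using insert.IH BI by (simp add: X_def)
    have "(\<integral>\<^sup>+a. ennreal ((w k * a k)\<^sup>2) \<partial>?M) \<le> (\<integral>\<^sup>+a. ennreal (r\<^sup>2 * (w k)\<^sup>2) \<partial>?M)"
    proof (rule nn_integral_mono_AE)
      show "AE a in ?M. ennreal ((w k * a k)\<^sup>2) \<le> ennreal (r\<^sup>2 * (w k)\<^sup>2)"
        using AE_PiM_unif_bounded[OF I r k]
      proof eventually_elim
        case (elim a)
        then have "(a k)\<^sup>2 \<le> r\<^sup>2" using r by (simp add: power2_le_iff_abs_le)
        then show ?case by (intro ennreal_leI) (simp add: power_mult_distrib mult.commute[of "r\<^sup>2"] mult_left_mono)
      qed
    qed
    then show "(\<integral>\<^sup>+a. ennreal ((w k * a k)\<^sup>2) \<partial>?M) \<le> ennreal (r\<^sup>2 * (w k)\<^sup>2)"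
      by (simp add: emeasure_space_1)
  qed
  also have "\<dots> = ennreal (r\<^sup>2 * (\<Sum>k\<in>insert k B. (w k)\<^sup>2))"
    using insert.hyps by (subst ennreal_plus[symmetric]) (auto simp: sum_nonneg algebra_simps)
  finally show ?case using insert.hyps by (simp add: X_def)
qed simp

text \<open>Integration of \<open>\<bar>X\<bar> \<le> X^2 / (2 * t) + t / 2\<close> reduces this to
  the second moment; \<open>t = r * \<sigma>\<close> bounds both summands by
  \<open>t / 2\<close>.\<close>

lemma nn_integral_linear_form_abs:
  assumes I: "finite I" and r: "r > 0" and B: "B \<subseteq> I" and \<sigma>: "\<sigma> > 0" "(\<Sum>k\<in>B. (w k)\<^sup>2) \<le> \<sigma>\<^sup>2"
  shows "(\<integral>\<^sup>+a. ennreal \<bar>\<Sum>k\<in>B. w k * a k\<bar> \<partial>Pi\<^sub>M I (\<lambda>_. unif r)) \<le> ennreal (r * \<sigma>)"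
proof -
  let ?M = "Pi\<^sub>M I (\<lambda>_. unif r)"
  interpret prob_space ?M by (intro prob_space_PiM prob_space_unif r)
  define X where "X a = (\<Sum>k\<in>B. w k * a k)" for a
  define t where "t = r * \<sigma>"
  have t: "t > 0" using r \<sigma> by (simp add: t_def)
  have [measurable]: "X \<in> borel_measurable ?M"
    unfolding X_def[abs_def] using B 
    by (intro borel_measurable_sum borel_measurable_times borel_measurable_const measurable_component_unif) auto
  have "(\<integral>\<^sup>+a. ennreal \<bar>X a\<bar> \<partial>?M) \<le> (\<integral>\<^sup>+a. ennreal (1 / (2 * t)) * ennreal ((X a)\<^sup>2) + ennreal (t / 2) \<partial>?M)"
  proof (rule nn_integral_mono)
    fix a
    have "0 \<le> (\<bar>X a\<bar> - t)\<^sup>2" by simp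
    then have "2 * t * \<bar>X a\<bar> \<le> (X a)\<^sup>2 + t\<^sup>2" by (simp add: power2_diff mult_ac)
    then have "\<bar>X a\<bar> \<le> 1 / (2 * t) * (X a)\<^sup>2 + t / 2" using t by (simp add: field_simps power2_eq_square)
    then show "ennreal \<bar>X a\<bar> \<le> ennreal (1 / (2 * t)) * ennreal ((X a)\<^sup>2) + ennreal (t / 2)"
      using t by (simp add: ennreal_mult'[symmetric] ennreal_plus[symmetric] ennreal_leI del: ennreal_plus)
  qed
  also have "\<dots> = ennreal (1 / (2 * t)) * (\<integral>\<^sup>+a. ennreal ((X a)\<^sup>2) \<partial>?M) + ennreal (t / 2)"
    by (subst nn_integral_add) (auto simp: nn_integral_cmult emeasure_space_1)
  also have "\<dots> \<le> ennreal (1 / (2 * t)) * ennreal (t\<^sup>2) + ennreal (t / 2)"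
  proof (intro add_right_mono mult_left_mono)
    have "r\<^sup>2 * (\<Sum>k\<in>B. (w k)\<^sup>2) \<le> t\<^sup>2" unfolding t_def power_mult_distrib using \<sigma>(2) by (simp add: mult_left_mono)
    then show "(\<integral>\<^sup>+a. ennreal ((X a)\<^sup>2) \<partial>?M) \<le> ennreal (t\<^sup>2)"
      using nn_integral_linear_form_square[OF I r B, of w] unfolding X_def by (meson ennreal_leI order_trans)
  qed simp
  also have "\<dots> = ennreal t"
    using t by (simp add: ennreal_mult'[symmetric] ennreal_plus[symmetric] power2_eq_square del: ennreal_plus)
  finally show ?thesis by (simp add: X_def t_def)
qed

text \<open>With all coefficients but \<open>a k\<close> frozen, \<open>w * a k + g a\<close> is
  uniform on an interval of length \<open>2 * w * r\<close>, so it falls into a window of half-width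
  \<open>Z a\<close> with probability at most \<open>Z a / (w * r)\<close>. Fubini integrates this
  bound.\<close>

lemma PiM_unif_small_ball:
  assumes I: "finite I" and r: "r > 0" and k: "k \<in> I" and w: "w > 0"
    and g [measurable]: "g \<in> borel_measurable (Pi\<^sub>M I (\<lambda>_. unif r))"
    and Z [measurable]: "Z \<in> borel_measurable (Pi\<^sub>M I (\<lambda>_. unif r))"
    and Z0: "\<And>a. Z a \<ge> 0"
    and indep: "\<And>a y. g (a(k := y)) = g a" "\<And>a y. Z (a(k := y)) = Z a"
  shows "emeasure (Pi\<^sub>M I (\<lambda>_. unif r)) {a \<in> space (Pi\<^sub>M I (\<lambda>_. unif r)). \<bar>w * a k + g a\<bar> \<le> Z a}
     \<le> (\<integral>\<^sup>+a. ennreal (Z a) \<partial>Pi\<^sub>M I (\<lambda>_. unif r)) * ennreal (1 / (w * r))"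
proof -
  let ?M = "Pi\<^sub>M I (\<lambda>_. unif r)"
  interpret U: prob_space "unif r" by (rule prob_space_unif[OF r])
  interpret product_sigma_finite "\<lambda>_. unif r" ..
  define J where "J = I - {k}"
  have IJ: "I = insert k J" "finite J" "k \<notin> J" using I k by (auto simp: J_def)
  have [measurable]: "(\<lambda>a. a k) \<in> borel_measurable ?M"
    by (rule measurable_component_unif[OF k])
  let ?E = "{a \<in> space ?M. \<bar>w * a k + g a\<bar> \<le> Z a}"
  have E: "?E \<in> sets ?M" by measurable
  have split: "(\<integral>\<^sup>+a. f a \<partial>?M) = (\<integral>\<^sup>+x. (\<integral>\<^sup>+y. f (x(k := y)) \<partial>unif r) \<partial>Pi\<^sub>M J (\<lambda>_. unif r))"
    if "f \<in> borel_measurable ?M" for f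
    unfolding IJ(1) by (rule product_nn_integral_insert[OF IJ(2,3)]) (use that IJ(1) in simp)
  have "emeasure ?M ?E = (\<integral>\<^sup>+a. indicator ?E a \<partial>?M)" using E by simp
  also have "\<dots> = (\<integral>\<^sup>+x. (\<integral>\<^sup>+y. indicator ?E (x(k := y)) \<partial>unif r) \<partial>Pi\<^sub>M J (\<lambda>_. unif r))"
    by (rule split) (use E in measurable)
  also have "\<dots> \<le> (\<integral>\<^sup>+x. (\<integral>\<^sup>+y. ennreal (Z (x(k := y))) * ennreal (1 / (w * r)) \<partial>unif r) \<partial>Pi\<^sub>M J (\<lambda>_. unif r))"
  proof (rule nn_integral_mono)
    fix x
    have "(\<integral>\<^sup>+y. indicator ?E (x(k := y)) \<partial>unif r) \<le> (\<integral>\<^sup>+y. indicator {y. \<bar>w * y + g x\<bar> \<le> Z x} y \<partial>unif r)"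
      by (rule nn_integral_mono) (auto simp: indep split: split_indicator)
    also have "\<dots> = emeasure (unif r) {y. \<bar>w * y + g x\<bar> \<le> Z x}"
      by (rule nn_integral_indicator) measurable
    also have "\<dots> \<le> ennreal (Z x / (w * r))" by (rule emeasure_unif_small_ball[OF r w Z0])
    also have "\<dots> = ennreal (Z x) * ennreal (1 / (w * r))"
      using Z0[of x] w r by (simp add: ennreal_mult'[symmetric])
    also have "\<dots> = (\<integral>\<^sup>+y. ennreal (Z (x(k := y))) * ennreal (1 / (w * r)) \<partial>unif r)"
      by (simp add: indep U.emeasure_space_1[simplified])
    finally show "(\<integral>\<^sup>+y. indicator ?E (x(k := y)) \<partial>unif r) \<le> (\<integral>\<^sup>+y. ennreal (Z (x(k := y))) * ennreal (1 / (w * r)) \<partial>unif r)" .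
  qed
  also have "\<dots> = (\<integral>\<^sup>+a. ennreal (Z a) * ennreal (1 / (w * r)) \<partial>?M)"
    by (rule split[symmetric]) measurable
  also have "\<dots> = (\<integral>\<^sup>+a. ennreal (Z a) \<partial>?M) * ennreal (1 / (w * r))"
    by (rule nn_integral_multc) measurable
  finally show ?thesis .
qed

text \<open>Averaging over the \<open>2 ^ m\<close> sign changes \<open>T S\<close>: for a fixed good point exactly \<open>m + 1\<close> of the
  resulting sign vectors consist of negative entries followed by positive ones.\<close>

lemma no_sign_change_prob:
  fixes Y :: "nat \<Rightarrow> 'a \<Rightarrow> real"
  assumes M: "prob_space M" and Y [measurable]: "\<And>i. i \<in> {1..m} \<Longrightarrow> Y i \<in> borel_measurable M"
    and T: "\<And>S. S \<subseteq> {1..m} \<Longrightarrow> T S \<in> measurable M M" "\<And>S. S \<subseteq> {1..m} \<Longrightarrow> distr M M (T S) = M"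
    and G: "G \<in> sets M"
    and pos: "\<And>a S i. a \<in> G \<Longrightarrow> S \<subseteq> {1..m} \<Longrightarrow> i \<in> {1..m} \<Longrightarrow> Y i (T S a) > 0 \<longleftrightarrow> (i \<in> S \<longleftrightarrow> Q i a)"
    and neg: "\<And>a S i. a \<in> G \<Longrightarrow> S \<subseteq> {1..m} \<Longrightarrow> i \<in> {1..m} \<Longrightarrow> Y i (T S a) < 0 \<longleftrightarrow> \<not> (i \<in> S \<longleftrightarrow> Q i a)"
  shows "emeasure M {a \<in> space M. \<forall>i\<in>{1..m}. \<forall>l\<in>{1..m}. i < l \<longrightarrow> \<not> (Y i a > 0 \<and> Y l a < 0)}
     \<le> ennreal ((real m + 1) / 2 ^ m) + emeasure M (space M - G)"
proof -
  interpret prob_space M by (rule M)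
  define E where "E = {a \<in> space M. \<forall>i\<in>{1..m}. \<forall>l\<in>{1..m}. i < l \<longrightarrow> \<not> (Y i a > 0 \<and> Y l a < 0)}"
  have E: "E \<in> sets M" unfolding E_def by measurable
  let ?P = "Pow {1..m}"
  \<comment> \<open>By invariance the probability of \<open>E\<close> is the average over
    \<open>S\<close> of the probability that \<open>T S a\<close> lies in \<open>E\<close>; the sum
    over \<open>S\<close> can then be estimated for each fixed \<open>a\<close>.\<close>
  have "(\<Sum>S\<in>?P. emeasure M E) = (\<Sum>S\<in>?P. (\<integral>\<^sup>+a. indicator E (T S a) \<partial>M))"
  proof (rule sum.cong[OF refl])
    fix S assume "S \<in> ?P"
    then have S: "S \<subseteq> {1..m}" by simp
    have "emeasure M E = emeasure (distr M M (T S)) E" by (simp add: T(2)[OF S])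
    also have "\<dots> = (\<integral>\<^sup>+a. indicator E a \<partial>distr M M (T S))" using E by simp
    also have "\<dots> = (\<integral>\<^sup>+a. indicator E (T S a) \<partial>M)" 
      by (rule nn_integral_distr[OF T(1)[OF S]]) (use E in simp)
    finally show "emeasure M E = (\<integral>\<^sup>+a. indicator E (T S a) \<partial>M)" .
  qed
  also have "\<dots> = (\<integral>\<^sup>+a. (\<Sum>S\<in>?P. indicator E (T S a)) \<partial>M)"
  proof (rule nn_integral_sum[symmetric])
    fix S assume "S \<in> ?P"
    then show "(\<lambda>a. indicator E (T S a)) \<in> borel_measurable M"
      using measurable_compose[OF T(1) borel_measurable_indicator[OF E]] by simp
  qed
  also have "\<dots> \<le> (\<integral>\<^sup>+a. ennreal (real m + 1) + ennreal (2 ^ m) * indicator (space M - G) a \<partial>M)"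
  proof (rule nn_integral_mono)
    fix a assume a: "a \<in> space M"
    have eq: "(\<Sum>S\<in>?P. indicator E (T S a)) = ennreal (real (card {S\<in>?P. T S a \<in> E}))"
    proof -
      have "(\<Sum>S\<in>?P. indicator E (T S a) :: ennreal) = (\<Sum>S\<in>?P. if T S a \<in> E then 1 else 0)"
        by (intro sum.cong) (auto simp: indicator_def)
      then show ?thesis by (simp add: sum.If_cases Int_def ennreal_of_nat_eq_real_of_nat)
    qed
    show "(\<Sum>S\<in>?P. indicator E (T S a)) \<le> ennreal (real m + 1) + ennreal (2 ^ m) * indicator (space M - G) a"
    proof (cases "a \<in> G")
      case True
      have "{S\<in>?P. T S a \<in> E} \<subseteq> (\<lambda>c. {i\<in>{1..m}. c < i \<longleftrightarrow> Q i a}) ` {0..m}"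
      proof
        fix S assume "S \<in> {S\<in>?P. T S a \<in> E}"
        then have S: "S \<subseteq> {1..m}" "T S a \<in> E" by auto
        note pos' = pos[OF True S(1)] and neg' = neg[OF True S(1)]
        \<comment> \<open>The last negative position; the inserted 0 covers the patterns without
          negative entries.\<close>
        define c where "c = Max (insert 0 {i\<in>{1..m}. Y i (T S a) < 0})"
        have c: "c \<in> insert 0 {i\<in>{1..m}. Y i (T S a) < 0}" unfolding c_def by (rule Max_in) auto
        have "c < i \<longleftrightarrow> Y i (T S a) > 0" if i: "i \<in> {1..m}" for i
        proof
          assume "c < i"
          have "\<not> Y i (T S a) < 0"
          proof
            assume "Y i (T S a) < 0"
            then have "i \<le> c" unfolding c_def using i by (intro Max_ge) auto
            then show False using \<open>c < i\<close> by simp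
          qed
          then show "Y i (T S a) > 0" using pos'[OF i] neg'[OF i] by blast
        next
          assume Yi: "Y i (T S a) > 0"
          show "c < i"
          proof (rule ccontr)
            assume "\<not> c < i"
            then have "c \<noteq> 0" using i by auto
            then have c': "c \<in> {1..m}" "Y c (T S a) < 0" using c by auto
            then have "i < c" using Yi \<open>\<not> c < i\<close> by (cases "i = c") auto
            then show False using S(2) i c' Yi unfolding E_def by blast
          qed
        qed
        then have ci: "c < i \<longleftrightarrow> (i \<in> S \<longleftrightarrow> Q i a)" if "i \<in> {1..m}" for i using that pos'[OF that] by blast
        have "S = {i\<in>{1..m}. c < i \<longleftrightarrow> Q i a}"
        proof (rule set_eqI)
          fix i
          show "i \<in> S \<longleftrightarrow> i \<in> {i\<in>{1..m}. c < i \<longleftrightarrow> Q i a}"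
            using S(1) ci[of i] by (cases "i \<in> {1..m}"; cases "Q i a"; cases "i \<in> S") auto
        qed
        moreover have "c \<in> {0..m}" using c by auto
        ultimately show "S \<in> (\<lambda>c. {i\<in>{1..m}. c < i \<longleftrightarrow> Q i a}) ` {0..m}" by blast
      qed
      then have "card {S\<in>?P. T S a \<in> E} \<le> card {0..m}"
        by (meson card_image_le card_mono finite_atLeastAtMost finite_imageI order_trans)
      then have "real (card {S\<in>?P. T S a \<in> E}) \<le> real m + 1" by simp
      then have "ennreal (real (card {S\<in>?P. T S a \<in> E})) \<le> ennreal (real m + 1)" by (rule ennreal_leI)
      then show ?thesis unfolding eq by (rule order_trans) simp
    next
      case False
      have "card {S\<in>?P. T S a \<in> E} \<le> card ?P" by (rule card_mono) auto
      then have "real (card {S\<in>?P. T S a \<in> E}) \<le> 2 ^ m" by (simp add: card_Pow)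
      then have "ennreal (real (card {S\<in>?P. T S a \<in> E})) \<le> ennreal (2 ^ m)" by (rule ennreal_leI)
      then show ?thesis unfolding eq using False a by (simp add: add_increasing)
    qed
  qed
  also have "\<dots> = ennreal (real m + 1) + ennreal (2 ^ m) * emeasure M (space M - G)"
    using G by (subst nn_integral_add) (auto simp: nn_integral_cmult emeasure_space_1)
  finally have le: "ennreal (2 ^ m) * emeasure M E \<le> ennreal (real m + 1) + ennreal (2 ^ m) * emeasure M (space M - G)"
    by (simp add: card_Pow ennreal_of_nat_eq_real_of_nat ennreal_power[symmetric])
  have inv: "ennreal (1 / 2 ^ m) * (ennreal (2 ^ m) * x) = x" for x
    by (simp add: mult.assoc[symmetric] ennreal_mult'[symmetric])
  have "emeasure M E = ennreal (1 / 2 ^ m) * (ennreal (2 ^ m) * emeasure M E)" by (simp add: inv)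
  also have "\<dots> \<le> ennreal (1 / 2 ^ m) * (ennreal (real m + 1) + ennreal (2 ^ m) * emeasure M (space M - G))"
    by (rule mult_left_mono[OF le]) simp
  also have "\<dots> = ennreal ((real m + 1) / 2 ^ m) + emeasure M (space M - G)"
    unfolding distrib_left inv by (simp add: ennreal_mult'[symmetric] del: ennreal_plus)
  finally show ?thesis unfolding E_def .
qed

text \<open>\<open>\<beta>\<close> groups the coefficients into classes, and \<open>T S\<close>
  flips whole classes. Where class \<open>i\<close> outweighs all others in the form
  \<open>W i\<close>, it decides the sign. The exceptional set is a union over \<open>i\<close> of
  small-ball events for the key coefficient \<open>\<kappa> i\<close>, with the other classes as
  window.\<close>

lemma linear_forms_no_sign_change_prob:
  fixes W :: "nat \<Rightarrow> 'i \<Rightarrow> real" and \<beta> :: "'i \<Rightarrow> nat"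
  assumes I: "finite I" and r: "r > 0" and L: "finite L" "{1..m} \<subseteq> L" "\<And>k. k \<in> I \<Longrightarrow> \<beta> k \<in> L"
    and key: "\<And>i. i \<in> {1..m} \<Longrightarrow> \<kappa> i \<in> I" "\<And>i. i \<in> {1..m} \<Longrightarrow> \<beta> (\<kappa> i) = i"
      "\<And>i. i \<in> {1..m} \<Longrightarrow> W i (\<kappa> i) > 0"
    and \<sigma>: "\<And>i l. i \<in> {1..m} \<Longrightarrow> l \<in> L - {i} \<Longrightarrow> \<sigma> i l > 0"
      "\<And>i l. i \<in> {1..m} \<Longrightarrow> l \<in> L - {i} \<Longrightarrow> (\<Sum>k\<in>{k\<in>I. \<beta> k = l}. (W i k)\<^sup>2) \<le> (\<sigma> i l)\<^sup>2"
  shows "emeasure (Pi\<^sub>M I (\<lambda>_. unif r)) {a \<in> space (Pi\<^sub>M I (\<lambda>_. unif r)).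
      \<forall>i\<in>{1..m}. \<forall>l\<in>{1..m}. i < l \<longrightarrow> \<not> ((\<Sum>k\<in>I. W i k * a k) > 0 \<and> (\<Sum>k\<in>I. W l k * a k) < 0)}
     \<le> ennreal ((real m + 1) / 2 ^ m + (\<Sum>i\<in>{1..m}. (\<Sum>l\<in>L - {i}. \<sigma> i l) / W i (\<kappa> i)))"
proof -
  let ?M = "Pi\<^sub>M I (\<lambda>_. unif r)"
  define part where "part i l a = (\<Sum>k\<in>{k\<in>I. \<beta> k = l}. W i k * a k)" for i l a
  define Y where "Y i a = (\<Sum>k\<in>I. W i k * a k)" for i a
  define R where "R i a = (\<Sum>l\<in>L - {i}. \<bar>part i l a\<bar>)" for i a
  define \<epsilon> where "\<epsilon> S l = (if l \<in> S then 1 else - 1 :: real)" for S and l :: nat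
  define T where "T S = (\<lambda>a. \<lambda>k\<in>I. \<epsilon> S (\<beta> k) * a k)" for S
  define G where "G = {a \<in> space ?M. \<forall>i\<in>{1..m}. R i a < \<bar>part i i a\<bar>}"
  have part_meas [measurable]: "part i l \<in> borel_measurable ?M" for i l
    unfolding part_def[abs_def] 
    by (intro borel_measurable_sum borel_measurable_times borel_measurable_const measurable_component_unif) auto
  have Y_meas [measurable]: "Y i \<in> borel_measurable ?M" for i
    unfolding Y_def[abs_def] 
    by (intro borel_measurable_sum borel_measurable_times borel_measurable_const measurable_component_unif) auto
  have R_meas [measurable]: "R i \<in> borel_measurable ?M" for i
    unfolding R_def[abs_def] by measurable
  have G: "G \<in> sets ?M" unfolding G_def by measurable
  have Y_part: "Y i a = (\<Sum>l\<in>L. part i l a)" for i a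
    unfolding Y_def part_def by (rule sum.group[symmetric]) (use I L in auto)
  have part_T: "part i l (T S a) = \<epsilon> S l * part i l a" for i l S a
    unfolding part_def T_def sum_distrib_left by (rule sum.cong) auto
  have Y_T: "\<bar>Y i (T S a) - \<epsilon> S i * part i i a\<bar> \<le> R i a" if i: "i \<in> {1..m}" for i S a
  proof -
    have "Y i (T S a) = part i i (T S a) + (\<Sum>l\<in>L - {i}. part i l (T S a))"
      unfolding Y_part using i L by (intro sum.remove) auto
    then have "\<bar>Y i (T S a) - \<epsilon> S i * part i i a\<bar> = \<bar>\<Sum>l\<in>L - {i}. \<epsilon> S l * part i l a\<bar>"
      by (simp add: part_T)
    also have "\<dots> \<le> (\<Sum>l\<in>L - {i}. \<bar>\<epsilon> S l * part i l a\<bar>)" by (rule sum_abs)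
    also have "\<dots> = R i a" unfolding R_def by (rule sum.cong) (auto simp: \<epsilon>_def)
    finally show ?thesis .
  qed
  have main: "emeasure ?M {a \<in> space ?M. \<forall>i\<in>{1..m}. \<forall>l\<in>{1..m}. i < l \<longrightarrow> \<not> (Y i a > 0 \<and> Y l a < 0)}
      \<le> ennreal ((real m + 1) / 2 ^ m) + emeasure ?M (space ?M - G)"
  proof (rule no_sign_change_prob[where T = T and Q = "\<lambda>i a. part i i a > 0"])
    show "prob_space ?M" by (intro prob_space_PiM prob_space_unif r)
    show "T S \<in> measurable ?M ?M" for S unfolding T_def by measurable
    show "distr ?M ?M (T S) = ?M" for S
      unfolding T_def by (rule distr_PiM_unif_flip[OF I r]) (auto simp: \<epsilon>_def)
    fix a S i assume "a \<in> G" and i: "i \<in> {1..m}"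
    then have "R i a < \<bar>part i i a\<bar>" by (auto simp: G_def)
    with Y_T[OF i, of S a] show "Y i (T S a) > 0 \<longleftrightarrow> (i \<in> S \<longleftrightarrow> part i i a > 0)"
      "Y i (T S a) < 0 \<longleftrightarrow> \<not> (i \<in> S \<longleftrightarrow> part i i a > 0)"
      by (auto simp: \<epsilon>_def abs_if split: if_splits)
  qed (use G in auto)
  have bad: "emeasure ?M {a \<in> space ?M. \<bar>part i i a\<bar> \<le> R i a} \<le> ennreal ((\<Sum>l\<in>L - {i}. \<sigma> i l) / W i (\<kappa> i))"
    if i: "i \<in> {1..m}" for i
  proof -
    define g where "g a = (\<Sum>k\<in>{k\<in>I. \<beta> k = i} - {\<kappa> i}. W i k * a k)" for a
    have part_g: "part i i a = W i (\<kappa> i) * a (\<kappa> i) + g a" for a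
      unfolding part_def g_def using key(1,2)[OF i] I by (intro sum.remove) auto
    have "emeasure ?M {a \<in> space ?M. \<bar>W i (\<kappa> i) * a (\<kappa> i) + g a\<bar> \<le> R i a}
        \<le> (\<integral>\<^sup>+a. ennreal (R i a) \<partial>?M) * ennreal (1 / (W i (\<kappa> i) * r))"
    proof (rule PiM_unif_small_ball[OF I r key(1)[OF i] key(3)[OF i]])
      show "g \<in> borel_measurable ?M"
        unfolding g_def[abs_def] 
    by (intro borel_measurable_sum borel_measurable_times borel_measurable_const measurable_component_unif) auto
      show "R i \<in> borel_measurable ?M" by measurable
      show "R i a \<ge> 0" for a by (simp add: R_def sum_nonneg)
      show "g (a(\<kappa> i := y)) = g a" for a y unfolding g_def by (rule sum.cong) auto
      \<comment> \<open>The key coefficient belongs to class \<open>i\<close>, so the window formed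
        by the other classes does not depend on it.\<close>
      have "part i l (a(\<kappa> i := y)) = part i l a" if "l \<noteq> i" for l a y
        unfolding part_def by (rule sum.cong) (use that key(2)[OF i] in auto)
      then show "R i (a(\<kappa> i := y)) = R i a" for a y unfolding R_def by (intro sum.cong) auto
    qed
    also have "(\<integral>\<^sup>+a. ennreal (R i a) \<partial>?M) = (\<Sum>l\<in>L - {i}. (\<integral>\<^sup>+a. ennreal \<bar>part i l a\<bar> \<partial>?M))"
    proof -
      have "(\<integral>\<^sup>+a. ennreal (R i a) \<partial>?M) = (\<integral>\<^sup>+a. (\<Sum>l\<in>L - {i}. ennreal \<bar>part i l a\<bar>) \<partial>?M)"
        unfolding R_def by (intro nn_integral_cong) (simp add: sum_ennreal)
      also have "\<dots> = (\<Sum>l\<in>L - {i}. (\<integral>\<^sup>+a. ennreal \<bar>part i l a\<bar> \<partial>?M))" by (rule nn_integral_sum) measurable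
      finally show ?thesis .
    qed
    also have "\<dots> \<le> (\<Sum>l\<in>L - {i}. ennreal (r * \<sigma> i l))"
      unfolding part_def using \<sigma>[OF i] by (intro sum_mono nn_integral_linear_form_abs I r) auto
    also have "\<dots> = ennreal (r * (\<Sum>l\<in>L - {i}. \<sigma> i l))"
      using \<sigma>(1)[OF i] r by (subst sum_ennreal) (auto simp: sum_distrib_left less_imp_le)
    also have "ennreal (r * (\<Sum>l\<in>L - {i}. \<sigma> i l)) * ennreal (1 / (W i (\<kappa> i) * r)) = ennreal ((\<Sum>l\<in>L - {i}. \<sigma> i l) / W i (\<kappa> i))"
    proof -
      have "0 \<le> (\<Sum>l\<in>L - {i}. \<sigma> i l)" by (intro sum_nonneg less_imp_le \<sigma>(1)[OF i])
      then show ?thesis using r key(3)[OF i] by (subst ennreal_mult'[symmetric]) auto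
    qed
    finally show ?thesis unfolding part_g by (simp add: mult_right_mono)
  qed
  have "emeasure ?M (space ?M - G) \<le> emeasure ?M (\<Union>i\<in>{1..m}. {a \<in> space ?M. \<bar>part i i a\<bar> \<le> R i a})"
    by (rule emeasure_mono) (auto simp: G_def not_less)
  also have "\<dots> \<le> (\<Sum>i\<in>{1..m}. emeasure ?M {a \<in> space ?M. \<bar>part i i a\<bar> \<le> R i a})"
    by (rule emeasure_subadditive_finite) auto
  also have "\<dots> \<le> (\<Sum>i\<in>{1..m}. ennreal ((\<Sum>l\<in>L - {i}. \<sigma> i l) / W i (\<kappa> i)))"
    by (rule sum_mono[OF bad])
  also have "\<dots> = ennreal (\<Sum>i\<in>{1..m}. (\<Sum>l\<in>L - {i}. \<sigma> i l) / W i (\<kappa> i))"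
    using \<sigma>(1) key(3) by (intro sum_ennreal divide_nonneg_nonneg sum_nonneg) (auto intro: less_imp_le)
  finally have "emeasure ?M (space ?M - G) \<le> ennreal (\<Sum>i\<in>{1..m}. (\<Sum>l\<in>L - {i}. \<sigma> i l) / W i (\<kappa> i))" .
  then have "ennreal ((real m + 1) / 2 ^ m) + emeasure ?M (space ?M - G)
      \<le> ennreal ((real m + 1) / 2 ^ m) + ennreal (\<Sum>i\<in>{1..m}. (\<Sum>l\<in>L - {i}. \<sigma> i l) / W i (\<kappa> i))"
    by (rule add_left_mono)
  also have "\<dots> = ennreal ((real m + 1) / 2 ^ m + (\<Sum>i\<in>{1..m}. (\<Sum>l\<in>L - {i}. \<sigma> i l) / W i (\<kappa> i)))"
    using \<sigma>(1) key(3) by (intro ennreal_plus[symmetric] sum_nonneg divide_nonneg_nonneg) (auto intro: less_imp_le)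
  finally show ?thesis using main unfolding Y_def by (rule order_trans[rotated])
qed

section \<open>Choice of the scales\<close>

text \<open>Here \<open>ld\<close> stands for \<open>ln d\<close>. With \<open>m\<close> maximal
  such that \<open>(7/4)^m \<le> q\<close>, the value \<open>2 ^ m\<close> is at least
  \<open>(4/7 * q) powr (6/5)\<close>; the exponent beyond 1 absorbs the powers of
  \<open>ln ld\<close> that are lost in \<open>q\<close> and in \<open>m + 1\<close>.\<close>

lemma number_of_scales:
  "\<exists>\<Lambda>. \<forall>ld\<ge>\<Lambda>. \<exists>m::nat. 24 * ln ld * (7 / 4) ^ m \<le> ld / 2 \<and> (real m + 1) / 2 ^ m \<le> 1 / ld \<and> real m + 1 \<le> (ld::real)"
proof -
  have "\<forall>\<^sub>F ld in at_top. (1::real) \<le> ld / (48 * ln ld)" by real_asymp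
  moreover have "\<forall>\<^sub>F ld in at_top. (2 * ln ld + 1) / (4 / 7 * (ld / (48 * ln ld))) powr (6 / 5) \<le> 1 / (ld::real)" by real_asymp
  moreover have "\<forall>\<^sub>F ld in at_top. 2 * ln ld + 1 \<le> (ld::real)" by real_asymp
  moreover have "\<forall>\<^sub>F ld in at_top. 3 \<le> (ld::real)" by real_asymp
  ultimately have "\<forall>\<^sub>F ld in at_top. \<exists>m::nat. 24 * ln ld * (7 / 4) ^ m \<le> ld / 2 \<and> (real m + 1) / 2 ^ m \<le> 1 / ld \<and> real m + 1 \<le> (ld::real)"
  proof eventually_elim
    case (elim ld)
    \<comment> \<open>48 is twice 24, so that \<open>24 * ln ld * q = ld / 2\<close>; the scales
      then stay below the square root of \<open>d\<close>.\<close>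
    define q where "q = ld / (48 * ln ld)"
    have q: "q \<ge> 1" using elim(1) by (simp add: q_def)
    have ln: "ln ld \<ge> 1"
      using elim(4) e_less_272 by (subst ln_ge_iff) auto
    define m where "m = nat \<lfloor>log (7 / 4) q\<rfloor>"
    have log0: "log (7 / 4) q \<ge> 0" using q by simp
    have m: "real m \<le> log (7 / 4) q" "log (7 / 4) q < real m + 1"
      using log0 by (auto simp: m_def)
    have "(7 / 4) ^ m = (7 / 4 :: real) powr real m" by (simp add: powr_realpow)
    also have "\<dots> \<le> (7 / 4) powr log (7 / 4) q" using m(1) by (intro powr_mono) auto
    also have "\<dots> = q" using q by simp
    finally have up: "(7 / 4) ^ m \<le> q" .
    have "q = (7 / 4) powr log (7 / 4) q" using q by simp
    also have "\<dots> \<le> (7 / 4) powr (real m + 1)" using m(2) by (intro powr_mono) auto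
    also have "\<dots> = 7 / 4 * (7 / 4) ^ m" by (simp add: powr_add powr_realpow)
    finally have low: "4 / 7 * q \<le> (7 / 4) ^ m" by simp
    have "24 * ln ld * (7 / 4) ^ m \<le> 24 * ln ld * q" using up ln by (intro mult_left_mono) auto
    also have "\<dots> = ld / 2" using ln by (simp add: q_def)
    finally have 1: "24 * ln ld * (7 / 4) ^ m \<le> ld / 2" .
    \<comment> \<open>\<open>ln (7/4) \<ge> 1/2\<close>, which amounts to
      \<open>exp 1 \<le> (7/4)^2\<close>, turns \<open>(7/4)^m \<le> ld\<close> into a bound on
      \<open>m\<close>.\<close>
    have m_le: "real m \<le> 2 * ln ld"
    proof -
      have "q \<le> ld" using ln elim(4) by (simp add: q_def field_simps)
      then have "(7 / 4) ^ m \<le> ld" using up by linarith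
      then have "ln ((7 / 4) ^ m) \<le> ln ld" using elim(4) by (subst ln_le_cancel_iff) auto
      then have le: "real m * ln (7 / 4) \<le> ln ld" by (simp add: ln_realpow)
      have "exp (1 / 2 :: real) \<le> 7 / 4"
      proof (rule power2_le_imp_le)
        have "(exp (1 / 2 :: real))\<^sup>2 = exp 1" by (simp add: exp_of_nat_mult[symmetric] power2_eq_square exp_add[symmetric])
        then show "(exp (1 / 2 :: real))\<^sup>2 \<le> (7 / 4)\<^sup>2" using e_less_272 by (simp add: power2_eq_square)
      qed simp
      then have "1 / 2 \<le> ln (7 / 4 :: real)" by (subst ln_ge_iff) auto
      then have "real m * (1 / 2) \<le> real m * ln (7 / 4)" by (intro mult_left_mono) auto
      then show ?thesis using le by linarith
    qed
    have "(4 / 7 * q) powr (6 / 5) \<le> ((7 / 4) ^ m) powr (6 / 5)" using low q by (intro powr_mono2) auto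
    also have "\<dots> = (((7 / 4) powr (6 / 5)) :: real) ^ m" by (simp add: powr_realpow[symmetric] powr_powr mult.commute)
    also have "\<dots> \<le> 2 ^ m"
    proof (rule power_mono)
      \<comment> \<open>Numerically this is \<open>(7/4)^6 \<le> 2^5\<close>.\<close>
      have "((7 / 4) powr (6 / 5) :: real) = ((7 / 4) powr 6) powr (1 / 5)" by (subst powr_powr) simp
      also have "\<dots> \<le> (2 powr 5) powr (1 / 5)" by (rule powr_mono2) (simp_all add: power_divide)
      also have "\<dots> = 2" by (subst powr_powr) simp
      finally show "((7 / 4) powr (6 / 5) :: real) \<le> 2" .
    qed simp
    finally have pw: "(4 / 7 * q) powr (6 / 5) \<le> 2 ^ m" .
    have "(real m + 1) / 2 ^ m \<le> (2 * ln ld + 1) / (4 / 7 * q) powr (6 / 5)"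
      using pw m_le q ln by (intro frac_le) auto
    also have "\<dots> \<le> 1 / ld" using elim(2) by (simp add: q_def)
    finally have 2: "(real m + 1) / 2 ^ m \<le> 1 / ld" .
    show ?case using 1 2 m_le elim(3) by (intro exI[of _ m]) auto
  qed
  then show ?thesis by (simp add: eventually_at_top_linorder)
qed

lemma one_minus_power_le_exp:
  assumes "N \<ge> (1::real)"
  shows "(1 - 1 / N) ^ n \<le> exp (- real n / N)"
proof -
  have "(1 - 1 / N) ^ n \<le> (exp (- 1 / N)) ^ n"
    using assms exp_ge_add_one_self[of "- 1 / N"] by (intro power_mono) auto
  then show ?thesis by (simp add: exp_of_nat_mult[symmetric])
qed

text \<open>The coefficients are cut into blocks \<open>b\<^sub>i\<^sub>-\<^sub>1 < k \<le> b\<^sub>i\<close> such that block \<open>i\<close> dominates the value at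
  \<open>1 - 1/N\<^sub>i\<close>. Here \<open>N\<^sub>i = exp (u (7/4)\<^sup>i)\<close>, \<open>b\<^sub>i = N\<^sub>i powr (13/12)\<close> and \<open>u = 24 ln (ln d)\<close>; as
  \<open>7/4 > 3/2 * 13/12\<close>, the typical size \<open>b\<^sub>i\<^sub>-\<^sub>1 powr (3/2)\<close> of the lower blocks is small against \<open>N\<^sub>i\<close>,
  and as \<open>(7/4) powr (6/5) < 2\<close>, there are enough scales below \<open>d\<close> for \<open>(m + 1) / 2 ^ m \<le> 1 / ln d\<close>.\<close>

lemma random_derivative_no_sign_change:
  assumes r: "r > 0"
  shows "\<forall>\<^sub>F d in sequentially. \<exists>E\<in>sets (Pi\<^sub>M {1..d} (\<lambda>_. unif r)).
     emeasure (Pi\<^sub>M {1..d} (\<lambda>_. unif r)) E \<le> ennreal (5 / ln (real d)) \<and>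
     (\<forall>a\<in>space (Pi\<^sub>M {1..d} (\<lambda>_. unif r)).
        (\<forall>x y. x < y \<longrightarrow> \<not> ((\<Sum>k\<in>{1..d}. real k * x ^ (k - 1) * a k) > 0 \<and>
                             (\<Sum>k\<in>{1..d}. real k * y ^ (k - 1) * a k) < 0)) \<longrightarrow> a \<in> E)"
proof -
  obtain \<Lambda> where \<Lambda>: "\<And>ld. ld \<ge> \<Lambda> \<Longrightarrow> \<exists>m::nat. 24 * ln ld * (7 / 4) ^ m \<le> ld / 2 \<and> (real m + 1) / 2 ^ m \<le> 1 / ld \<and> real m + 1 \<le> (ld::real)"
    using number_of_scales by blast
  have "\<forall>\<^sub>F d in sequentially. ln (real d) \<ge> \<Lambda>" by real_asymp
  moreover have "\<forall>\<^sub>F d in sequentially. ln (real d) \<ge> 3" by real_asymp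
  moreover have "\<forall>\<^sub>F d in sequentially. d > 0" by (rule eventually_gt_at_top)
  ultimately show ?thesis
  proof eventually_elim
    case (elim d)
    define ld where "ld = ln (real d)"
    have ld3: "ld \<ge> 3" and d: "real d = exp ld" using elim by (simp_all add: ld_def)
    obtain m where m: "24 * ln ld * (7 / 4) ^ m \<le> ld / 2" "(real m + 1) / 2 ^ m \<le> 1 / ld" "real m + 1 \<le> ld"
      using \<Lambda>[of ld] elim(1) by (auto simp: ld_def)
    have ln: "ln ld \<ge> 1" using ld3 e_less_272 by (subst ln_ge_iff) auto
    \<comment> \<open>24 serves twice: \<open>t i / 12 \<ge> 2 * ln ld\<close> gives the factor
      \<open>ld^2\<close> between \<open>N i\<close> and \<open>b i\<close>, and
      \<open>t i / 8 \<ge> 3 * ln ld\<close> the factor \<open>ld^3\<close> between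
      \<open>b i powr (3/2)\<close> and \<open>N (Suc i)\<close>.\<close>
    define u where "u = 24 * ln ld"
    have u: "u \<ge> 24" using ln by (simp add: u_def)
    define t where "t i = u * (7 / 4) ^ i" for i :: nat
    have t_mono: "t i \<le> t j" if "i \<le> j" for i j
      using that u by (auto simp: t_def intro!: mult_left_mono power_increasing)
    have t_Suc: "t (Suc i) = 7 / 4 * t i" for i by (simp add: t_def)
    have t0: "t i \<ge> u" for i using t_mono[of 0 i] by (simp add: t_def)
    define N where "N i = exp (t i)" for i
    define b where "b i = exp (13 / 12 * t i)" for i
    have b_mono: "b i \<le> b j" if "i \<le> j" for i j using t_mono[OF that] by (simp add: b_def)
    have b1: "b i \<ge> 1" for i using t0[of i] u by (simp add: b_def)
    have N2: "N i \<ge> 8" for i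
    proof -
      have "N i \<ge> 1 + t i" unfolding N_def by (rule exp_ge_add_one_self)
      then show ?thesis using t0[of i] u by linarith
    qed
    have N_b: "N i \<le> b i" for i using t0[of i] u by (simp add: b_def N_def)
    have b_ratio: "b i \<ge> ld\<^sup>2 * N i" for i
    proof -
      have "ld\<^sup>2 = exp (2 * ln ld)" using ld3 by (simp add: exp_double)
      also have "\<dots> \<le> exp (t i / 12)" using t0[of i] by (simp add: u_def)
      finally have "ld\<^sup>2 * N i \<le> exp (t i / 12) * N i" by (simp add: N_def)
      also have "\<dots> = b i" by (simp add: N_def b_def exp_add[symmetric])
      finally show ?thesis .
    qed
    have b32: "b i powr (3 / 2) \<le> N (Suc i) / ld ^ 3" for i
    proof -
      \<comment> \<open>\<open>3/2 * 13/12 = 13/8\<close> falls short of \<open>7/4\<close> by 1/8,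
        which is the available gain.\<close>
      have "b i powr (3 / 2) = exp (13 / 8 * t i)" by (simp add: b_def powr_def)
      also have "\<dots> = N (Suc i) * exp (- (t i / 8))" by (simp add: N_def t_Suc exp_add[symmetric])
      also have "\<dots> \<le> N (Suc i) * exp (- (3 * ln ld))" using t0[of i] by (simp add: N_def u_def)
      also have "exp (- (3 * ln ld)) = 1 / ld ^ 3"
        using ld3 by (simp add: exp_minus exp_of_nat_mult[of 3, simplified] inverse_eq_divide)
      finally show ?thesis by simp
    qed
    have b_half: "b i < N (Suc i) / 2" for i
    proof -
      have "b i = b i powr 1" using b1[of i] by simp
      also have "\<dots> \<le> b i powr (3 / 2)" using b1[of i] by (intro powr_mono) auto
      also have "\<dots> \<le> N (Suc i) / ld ^ 3" by (rule b32)
      also have "\<dots> < N (Suc i) / 2"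
      proof -
        have "(3::real) ^ 3 \<le> ld ^ 3" using ld3 by (intro power_mono) auto
        then have "2 < ld ^ 3" by simp
        then show ?thesis using N2[of "Suc i"] ld3 by (intro divide_strict_left_mono) auto
      qed
      finally show ?thesis .
    qed
    define I where "I = {1..d}"
    define x where "x i = 1 - 1 / N i" for i
    have x01: "0 \<le> x i" "x i \<le> 1" for i using N2[of i] by (auto simp: x_def)
    define W where "W i k = real k * x i ^ (k - 1)" for i k
    \<comment> \<open>The number of breakpoints \<open>b 0\<close>, ..., \<open>b m\<close> below
      \<open>k\<close> is the index of its block. Block 0 is the initial segment up to
      \<open>b 0\<close> and block \<open>Suc m\<close> the tail beyond \<open>b m\<close>; neither
      belongs to a sample point.\<close>
    define \<beta> where "\<beta> k = card {j\<in>{0..m}. b j < real k}" for k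
    have \<beta>_le: "\<beta> k \<le> i" if "real k \<le> b i" "i \<le> m" for i k
    proof -
      have "{j\<in>{0..m}. b j < real k} \<subseteq> {0..<i}" using that b_mono by (force simp: not_le[symmetric])
      from card_mono[OF _ this] show ?thesis by (simp add: \<beta>_def)
    qed
    have \<beta>_ge: "Suc i \<le> \<beta> k" if "b i < real k" "i \<le> m" for i k
    proof -
      have "{0..i} \<subseteq> {j\<in>{0..m}. b j < real k}" using that b_mono by (force intro: le_less_trans)
      from card_mono[OF _ this] show ?thesis by (simp add: \<beta>_def)
    qed
    define L where "L = {0..Suc m}"
    have \<beta>_L: "\<beta> k \<in> L" for k
    proof -
      have "\<beta> k \<le> card {0..m}" unfolding \<beta>_def by (rule card_mono) auto
      then show ?thesis by (simp add: L_def)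
    qed
    \<comment> \<open>Near \<open>k = N i / 2\<close> the weight \<open>k * x i ^ (k - 1)\<close> is
      still of order \<open>N i\<close>, and this \<open>k\<close> lies between
      \<open>b (i - 1)\<close> and \<open>b i\<close>.\<close>
    define \<kappa> where "\<kappa> i = nat \<lceil>N i / 2\<rceil>" for i
    have \<kappa>: "N i / 2 \<le> real (\<kappa> i)" "real (\<kappa> i) \<le> N i / 2 + 1" for i
      using N2[of i] unfolding \<kappa>_def by linarith+
    have \<kappa>_N: "real (\<kappa> i) \<le> N i" for i using \<kappa>(2)[of i] N2[of i] by linarith
    have N_d: "N i \<le> real d" if "i \<le> m" for i
    proof -
      have "t i \<le> ld / 2" using t_mono[OF that] m(1) by (simp add: t_def u_def)
      then show ?thesis unfolding N_def d using ld3 by simp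
    qed
    have \<kappa>_I: "\<kappa> i \<in> I" if "i \<in> {1..m}" for i
    proof -
      have "real 1 \<le> real (\<kappa> i)" using \<kappa>(1)[of i] N2[of i] by simp
      moreover have "real (\<kappa> i) \<le> real d" using \<kappa>_N[of i] N_d[of i] that by simp
      ultimately show ?thesis unfolding I_def of_nat_le_iff by simp
    qed
    have \<beta>_\<kappa>: "\<beta> (\<kappa> i) = i" if i: "i \<in> {1..m}" for i
    proof (rule antisym)
      show "\<beta> (\<kappa> i) \<le> i" using \<kappa>_N[of i] N_b[of i] i by (intro \<beta>_le) auto
      have "Suc (i - 1) \<le> \<beta> (\<kappa> i)" using b_half[of "i - 1"] \<kappa>(1)[of i] i by (intro \<beta>_ge) auto
      then show "i \<le> \<beta> (\<kappa> i)" using i by simp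
    qed
    have W_\<kappa>: "W i (\<kappa> i) \<ge> N i / 4" if i: "i \<in> {1..m}" for i
    proof -
      have "1 + real (\<kappa> i - 1) * (- 1 / N i) \<le> (1 + (- 1 / N i)) ^ (\<kappa> i - 1)"
        using N2[of i] by (intro Bernoulli_inequality) (auto simp: field_simps)
      moreover have "real (\<kappa> i - 1) * (- 1 / N i) \<ge> - 1 / 2"
      proof -
        have "real (\<kappa> i - 1) \<le> N i / 2" using \<kappa>(2)[of i] \<kappa>_I[OF i] by (simp add: I_def of_nat_diff)
        then show ?thesis using N2[of i] by (simp add: field_simps)
      qed
      ultimately have "1 / 2 \<le> x i ^ (\<kappa> i - 1)" by (simp add: x_def)
      then have "N i / 2 * (1 / 2) \<le> real (\<kappa> i) * x i ^ (\<kappa> i - 1)"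
        using \<kappa>(1)[of i] N2[of i] by (intro mult_mono) auto
      then show ?thesis by (simp add: W_def)
    qed
    \<comment> \<open>A lower block has at most \<open>b (i - 1)\<close> coefficients, each of
      weight at most \<open>b (i - 1)\<close>: the square sum is at most the cube. In a higher block
      \<open>k > b i \<ge> ld^2 * N i\<close> makes the power of \<open>x i\<close> at most
      \<open>exp (1 - ld^2)\<close>, which outweighs all factors \<open>d = exp ld\<close>, so 1
      suffices.\<close>
    define \<sigma> where "\<sigma> i l = (if l < i then b (i - 1) powr (3 / 2) else 1)" for i l
    have \<sigma>_pos: "\<sigma> i l > 0" for i l using b1[of "i - 1"] by (simp add: \<sigma>_def)
    have \<sigma>: "(\<Sum>k\<in>{k\<in>I. \<beta> k = l}. (W i k)\<^sup>2) \<le> (\<sigma> i l)\<^sup>2" if i: "i \<in> {1..m}" and l: "l \<in> L - {i}" for i l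
    proof (cases "l < i")
      case True
      let ?b = "b (i - 1)"
      have k: "real k \<le> ?b" if "k \<in> I" "\<beta> k = l" for k
        using \<beta>_ge[of "i - 1" k] that i True by (force simp: not_less[symmetric])
      have "{k\<in>I. \<beta> k = l} \<subseteq> {1..nat \<lfloor>?b\<rfloor>}" using k by (auto simp: I_def le_nat_floor)
      from card_mono[OF _ this] have card: "real (card {k\<in>I. \<beta> k = l}) \<le> ?b"
        using b1[of "i - 1"] by (simp, linarith)
      have "(\<Sum>k\<in>{k\<in>I. \<beta> k = l}. (W i k)\<^sup>2) \<le> (\<Sum>k\<in>{k\<in>I. \<beta> k = l}. ?b\<^sup>2)"
      proof (rule sum_mono)
        fix k assume "k \<in> {k\<in>I. \<beta> k = l}"
        then have "W i k \<le> ?b * 1" unfolding W_def using k[of k] x01[of i] b1[of "i - 1"]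
          by (intro mult_mono power_le_one) auto
        moreover have "W i k \<ge> 0" using x01[of i] by (simp add: W_def)
        ultimately show "(W i k)\<^sup>2 \<le> ?b\<^sup>2" by (intro power_mono) auto
      qed
      also have "\<dots> \<le> ?b * ?b\<^sup>2" using card by (simp add: mult_right_mono)
      also have "\<dots> = (?b powr (3 / 2))\<^sup>2"
      proof -
        have "(?b powr (3 / 2))\<^sup>2 = ?b powr 3" by (simp add: power2_eq_square powr_add[symmetric])
        also have "\<dots> = ?b ^ 3" using b1[of "i - 1"] by simp
        finally show ?thesis by (simp add: power3_eq_cube power2_eq_square)
      qed
      finally show ?thesis using True by (simp add: \<sigma>_def)
    next
      case False
      then have il: "i < l" using l by auto
      have k: "b i < real k" if "k \<in> I" "\<beta> k = l" for k
        using \<beta>_le[of k i] that i il by (force simp: not_le[symmetric])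
      let ?B = "exp (2 * ld) * exp (2 - 2 * ld\<^sup>2)"
      have "(\<Sum>k\<in>{k\<in>I. \<beta> k = l}. (W i k)\<^sup>2) \<le> (\<Sum>k\<in>{k\<in>I. \<beta> k = l}. ?B)"
      proof (rule sum_mono)
        fix k assume "k \<in> {k\<in>I. \<beta> k = l}"
        then have kI: "k \<in> I" and kb: "b i < real k" using k by auto
        have "x i ^ (k - 1) \<le> exp (- real (k - 1) / N i)"
          unfolding x_def using N2[of i] by (intro one_minus_power_le_exp) simp
        also have "\<dots> \<le> exp (1 - ld\<^sup>2)"
        proof -
          have "ld\<^sup>2 * N i - N i \<le> real (k - 1)" using b_ratio[of i] kb N2[of i] kI by (simp add: I_def of_nat_diff)
          then show ?thesis using N2[of i] by (simp add: field_simps)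
        qed
        finally have "W i k \<le> exp ld * exp (1 - ld\<^sup>2)"
          unfolding W_def using kI d by (intro mult_mono) (auto simp: I_def x01)
        moreover have "W i k \<ge> 0" using x01[of i] by (simp add: W_def)
        ultimately have "(W i k)\<^sup>2 \<le> (exp ld * exp (1 - ld\<^sup>2))\<^sup>2" by (intro power_mono) auto
        also have "\<dots> = ?B" by (simp add: power_mult_distrib exp_double[symmetric] algebra_simps)
        finally show "(W i k)\<^sup>2 \<le> ?B" .
      qed
      also have "\<dots> = real (card {k\<in>I. \<beta> k = l}) * ?B" by simp
      also have "\<dots> \<le> exp ld * ?B"
      proof (rule mult_right_mono)
        have "card {k\<in>I. \<beta> k = l} \<le> card I" by (rule card_mono) (auto simp: I_def)
        then show "real (card {k\<in>I. \<beta> k = l}) \<le> exp ld" unfolding d[symmetric] by (simp add: I_def)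
      qed simp
      also have "\<dots> = exp (3 * ld + 2 - 2 * ld\<^sup>2)" by (simp add: exp_add[symmetric])
      also have "\<dots> \<le> 1"
      proof -
        have "3 * ld \<le> ld\<^sup>2" unfolding power2_eq_square using ld3 by (intro mult_right_mono) auto
        then have "3 * ld + 2 - 2 * ld\<^sup>2 \<le> 0" using ld3 by linarith
        then show ?thesis by simp
      qed
      finally show ?thesis using False by (simp add: \<sigma>_def)
    qed
    let ?M = "Pi\<^sub>M I (\<lambda>_. unif r)"
    define E where "E = {a \<in> space ?M. \<forall>i\<in>{1..m}. \<forall>l\<in>{1..m}. i < l \<longrightarrow>
        \<not> ((\<Sum>k\<in>I. W i k * a k) > 0 \<and> (\<Sum>k\<in>I. W l k * a k) < 0)}"
    have [measurable]: "(\<lambda>a. \<Sum>k\<in>I. W i k * a k) \<in> borel_measurable ?M" for i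
      
    by (intro borel_measurable_sum borel_measurable_times borel_measurable_const measurable_component_unif) auto
    have E: "E \<in> sets ?M" unfolding E_def by measurable
    have "emeasure ?M E \<le> ennreal ((real m + 1) / 2 ^ m + (\<Sum>i\<in>{1..m}. (\<Sum>l\<in>L - {i}. \<sigma> i l) / W i (\<kappa> i)))"
      unfolding E_def
    proof (rule linear_forms_no_sign_change_prob[where \<beta> = \<beta>])
      show "W i (\<kappa> i) > 0" if "i \<in> {1..m}" for i using W_\<kappa>[OF that] N2[of i] by linarith
    qed (use \<beta>_L \<kappa>_I \<beta>_\<kappa> \<sigma>_pos \<sigma> r in \<open>auto simp: I_def L_def\<close>)
    \<comment> \<open>The \<open>m + 1\<close> blocks other than \<open>i\<close> contribute at most
      \<open>4 / ld^2\<close>; at most \<open>ld\<close> such terms make \<open>4 / ld\<close>, and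
      the sign patterns add the fifth \<open>1 / ld\<close>.\<close>
    also have "\<dots> \<le> ennreal (5 / ld)"
    proof (rule ennreal_leI)
      have "(\<Sum>i\<in>{1..m}. (\<Sum>l\<in>L - {i}. \<sigma> i l) / W i (\<kappa> i)) \<le> (\<Sum>i\<in>{1..m}. 4 / ld\<^sup>2)"
      proof (rule sum_mono)
        fix i assume i: "i \<in> {1..m}"
        let ?c = "b (i - 1) powr (3 / 2)"
        have c1: "?c \<ge> 1" using b1[of "i - 1"] by (simp add: ge_one_powr_ge_zero)
        have "(\<Sum>l\<in>L - {i}. \<sigma> i l) \<le> (\<Sum>l\<in>L - {i}. ?c)"
          using c1 by (intro sum_mono) (auto simp: \<sigma>_def)
        also have "\<dots> = (real m + 1) * ?c" using i by (simp add: L_def card_Diff_singleton)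
        also have "\<dots> \<le> ld * (N i / ld ^ 3)"
          using m(3) b32[of "i - 1"] i c1 by (intro mult_mono) auto
        also have "\<dots> = N i / ld\<^sup>2" using ld3 by (simp add: power3_eq_cube power2_eq_square)
        finally have le: "(\<Sum>l\<in>L - {i}. \<sigma> i l) \<le> N i / ld\<^sup>2" .
        have "(\<Sum>l\<in>L - {i}. \<sigma> i l) / W i (\<kappa> i) \<le> (N i / ld\<^sup>2) / (N i / 4)"
          using le W_\<kappa>[OF i] N2[of i] \<sigma>_pos by (intro frac_le) (auto intro!: divide_nonneg_nonneg)
        also have "\<dots> = 4 / ld\<^sup>2" using N2[of i] by simp
        finally show "(\<Sum>l\<in>L - {i}. \<sigma> i l) / W i (\<kappa> i) \<le> 4 / ld\<^sup>2" .
      qed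
      also have "\<dots> = real m * (4 / ld\<^sup>2)" by simp
      also have "\<dots> \<le> ld * (4 / ld\<^sup>2)" using m(3) by (intro mult_right_mono) auto
      also have "\<dots> = 4 / ld" using ld3 by (simp add: power2_eq_square)
      finally show "(real m + 1) / 2 ^ m + (\<Sum>i\<in>{1..m}. (\<Sum>l\<in>L - {i}. \<sigma> i l) / W i (\<kappa> i)) \<le> 5 / ld"
        using m(2) by (simp add: add_divide_distrib[symmetric])
    qed
    finally have E_le: "emeasure ?M E \<le> ennreal (5 / ln (real d))" by (simp add: ld_def)
    have sub: "a \<in> E" if a: "a \<in> space ?M" and no: "\<forall>x y. x < y \<longrightarrow>
        \<not> ((\<Sum>k\<in>I. real k * x ^ (k - 1) * a k) > 0 \<and> (\<Sum>k\<in>I. real k * y ^ (k - 1) * a k) < 0)" for a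
      unfolding E_def
    proof (intro CollectI conjI a ballI impI)
      fix i l assume "i \<in> {1..m}" "l \<in> {1..m}" "i < l"
      have "t i < t (Suc i)" using t_Suc[of i] t0[of i] u by simp
      also have "\<dots> \<le> t l" using \<open>i < l\<close> by (intro t_mono) simp
      finally have "N i < N l" by (simp add: N_def)
      then have "x i < x l" using N2[of i] N2[of l] by (auto simp: x_def intro!: divide_strict_left_mono mult_pos_pos)
      then show "\<not> ((\<Sum>k\<in>I. W i k * a k) > 0 \<and> (\<Sum>k\<in>I. W l k * a k) < 0)"
        using no unfolding W_def by blast
    qed
    show ?case using E E_le sub unfolding I_def by blast
  qed
qed

section \<open>Separable polynomials\<close>

text \<open>\<open>S\<close> may be unbounded: a nonconstant polynomial is large outside a compact
  interval, and on the rest of \<open>S\<close> a minimum is attained.\<close>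

lemma poly_bounded_away_from_zero:
  fixes p :: "real poly"
  assumes "closed S" "\<And>x. x \<in> S \<Longrightarrow> poly p x \<noteq> 0"
  shows "\<exists>\<epsilon>>0. \<forall>x\<in>S. \<epsilon> \<le> \<bar>poly p x\<bar>"
proof (cases "S = {}")
  case False
  have "\<exists>\<epsilon>>0. \<exists>R. \<forall>x\<in>S. R \<le> \<bar>x\<bar> \<longrightarrow> \<epsilon> \<le> \<bar>poly p x\<bar>"
  proof -
    obtain a q where p: "p = pCons a q" by (cases p)
    show ?thesis
    proof (cases "q = 0")
      case True
      then have "a \<noteq> 0" using False assms(2) p by auto
      then show ?thesis using True p by (intro exI[of _ "\<bar>a\<bar>"]) auto
    next
      case False
      show ?thesis using poly_infinity[OF False, of 1 a] p by (intro exI[of _ 1]) (auto simp: real_norm_def)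
    qed
  qed
  then obtain \<epsilon> R where R: "\<epsilon> > 0" "\<And>x. x \<in> S \<Longrightarrow> R \<le> \<bar>x\<bar> \<Longrightarrow> \<epsilon> \<le> \<bar>poly p x\<bar>" by blast
  let ?K = "S \<inter> {- R..R}"
  have "\<exists>\<delta>>0. \<forall>x\<in>?K. \<delta> \<le> \<bar>poly p x\<bar>"
  proof (cases "?K = {}")
    case True
    then show ?thesis by (intro exI[of _ 1]) auto
  next
    case False
    have "compact ?K" using assms(1) by (intro closed_Int_compact) auto
    moreover have "continuous_on ?K (\<lambda>x. \<bar>poly p x\<bar>)" by (intro continuous_intros)
    ultimately obtain z where "z \<in> ?K" "\<And>x. x \<in> ?K \<Longrightarrow> \<bar>poly p z\<bar> \<le> \<bar>poly p x\<bar>"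
      using continuous_attains_inf[of ?K "\<lambda>x. \<bar>poly p x\<bar>"] False by blast
    then show ?thesis using assms(2)[of z] by (intro exI[of _ "\<bar>poly p z\<bar>"]) auto
  qed
  then obtain \<delta> where \<delta>: "\<delta> > 0" "\<And>x. x \<in> ?K \<Longrightarrow> \<delta> \<le> \<bar>poly p x\<bar>" by blast
  have "min \<epsilon> \<delta> \<le> \<bar>poly p x\<bar>" if "x \<in> S" for x
  proof (cases "R \<le> \<bar>x\<bar>")
    case True
    then show ?thesis using R(2)[OF that] by simp
  next
    case False
    then have "x \<in> ?K" using that by auto
    then show ?thesis using \<delta>(2) by fastforce
  qed
  then show ?thesis using R(1) \<delta>(1) by (intro exI[of _ "min \<epsilon> \<delta>"]) auto
qed (auto intro: exI[of _ 1])

text \<open>By \<open>\<bar>x\<bar> \<le> 1 + x^2\<close> the weight dominates all powers up to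
  \<open>d\<close>, and being a polynomial it is admissible in a smooth connection.\<close>

lemma poly_growth_bound:
  fixes p :: "real poly"
  assumes "degree p \<le> d"
  shows "\<exists>C\<ge>0. \<forall>x. \<bar>poly p x\<bar> \<le> C * (1 + x\<^sup>2) ^ d"
proof (intro exI[of _ "\<Sum>i\<le>degree p. \<bar>coeff p i\<bar>"] conjI allI)
  fix x :: real
  have x: "\<bar>x\<bar> \<le> 1 + x\<^sup>2"
    using sum_squares_ge_zero[of "\<bar>x\<bar> - 1 / 2" 0] by (simp add: power2_eq_square algebra_simps)
  have "\<bar>poly p x\<bar> \<le> (\<Sum>i\<le>degree p. \<bar>coeff p i * x ^ i\<bar>)" unfolding poly_altdef by (rule sum_abs)
  also have "\<dots> \<le> (\<Sum>i\<le>degree p. \<bar>coeff p i\<bar> * (1 + x\<^sup>2) ^ d)"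
  proof (rule sum_mono)
    fix i assume i: "i \<in> {..degree p}"
    have "\<bar>x\<bar> ^ i \<le> (1 + x\<^sup>2) ^ i" using x by (intro power_mono) auto
    also have "\<dots> \<le> (1 + x\<^sup>2) ^ d" using i assms by (intro power_increasing) auto
    finally show "\<bar>coeff p i * x ^ i\<bar> \<le> \<bar>coeff p i\<bar> * (1 + x\<^sup>2) ^ d"
      by (simp add: abs_mult power_abs mult_left_mono)
  qed
  finally show "\<bar>poly p x\<bar> \<le> (\<Sum>i\<le>degree p. \<bar>coeff p i\<bar>) * (1 + x\<^sup>2) ^ d" by (simp add: sum_distrib_right)
qed (simp add: sum_nonneg)

lemma poly_nonneg_of_rational:
  fixes q :: "real poly"
  assumes "\<And>x. x \<in> \<rat> \<Longrightarrow> poly q x \<ge> 0"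
  shows "poly q x \<ge> 0"
proof (rule ccontr)
  assume "\<not> ?thesis"
  then have "x \<in> {x. poly q x < 0}" by simp
  moreover have "open {x. poly q x < 0}" by (intro open_Collect_less continuous_intros)
  ultimately obtain e where e: "e > 0" "ball x e \<subseteq> {x. poly q x < 0}" by (meson open_contains_ball)
  obtain y where "y \<in> \<rat>" "x < y" "y < x + e" using Rats_dense_in_real[of x "x + e"] e(1) by auto
  then have "poly q y < 0" using e(2) by (auto simp: dist_real_def subset_eq)
  then show False using assms[OF \<open>y \<in> \<rat>\<close>] by simp
qed

text \<open>Quantifying over rational points only makes the sets of coefficients below Borel.\<close>

lemma poly_no_root_iff_rational:
  fixes p :: "real poly"
  shows "(\<forall>x. poly p x \<noteq> 0) \<longleftrightarrow> (\<exists>n::nat. \<forall>x\<in>\<rat>. (poly p x)\<^sup>2 \<ge> 1 / real (Suc n))"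
proof
  assume "\<forall>x. poly p x \<noteq> 0"
  then obtain \<epsilon> where \<epsilon>: "\<epsilon> > 0" "\<And>x. \<epsilon> \<le> \<bar>poly p x\<bar>"
    using poly_bounded_away_from_zero[of UNIV p] by auto
  obtain n :: nat where n: "1 / real (Suc n) < \<epsilon>\<^sup>2" using \<epsilon>(1) nat_approx_posE[of "\<epsilon>\<^sup>2"] by auto
  have "(poly p x)\<^sup>2 \<ge> 1 / real (Suc n)" for x
  proof -
    have "\<epsilon>\<^sup>2 \<le> \<bar>poly p x\<bar>\<^sup>2" using \<epsilon> by (intro power_mono) auto
    then show ?thesis using n by simp
  qed
  then show "\<exists>n::nat. \<forall>x\<in>\<rat>. (poly p x)\<^sup>2 \<ge> 1 / real (Suc n)" by blast
next
  assume "\<exists>n::nat. \<forall>x\<in>\<rat>. (poly p x)\<^sup>2 \<ge> 1 / real (Suc n)"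
  then obtain n :: nat where n: "\<And>x. x \<in> \<rat> \<Longrightarrow> (poly p x)\<^sup>2 \<ge> 1 / real (Suc n)" by blast
  have "poly (p\<^sup>2 - [:1 / real (Suc n):]) x \<ge> 0" for x
  proof (rule poly_nonneg_of_rational)
    fix y :: real assume "y \<in> \<rat>"
    from n[OF this] show "0 \<le> poly (p\<^sup>2 - [:1 / real (Suc n):]) y" by (simp add: poly_power)
  qed
  then have "(poly p x)\<^sup>2 \<ge> 1 / real (Suc n)" for x by (simp add: poly_power)
  moreover have "1 / real (Suc n) > 0" by simp
  ultimately show "\<forall>x. poly p x \<noteq> 0" by (metis not_le zero_power2)
qed

text \<open>The one-variable case of the inequality behind the connection: it says quantitatively
  that \<open>f''\<close> is nonnegative at the zeros of \<open>f'\<close>. Integer \<open>K\<close>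
  and rational \<open>x\<close> make it a countable combination of conditions on the
  coefficients.\<close>

definition unimodal_at_rationals :: "nat \<Rightarrow> real poly \<Rightarrow> bool" where
  "unimodal_at_rationals d f \<longleftrightarrow>
     (\<exists>K::nat. \<forall>x\<in>\<rat>. poly (pderiv (pderiv f)) x + real K * (1 + x\<^sup>2) ^ d * (poly (pderiv f) x)\<^sup>2 \<ge> 0)"

text \<open>On the closed set where \<open>f'' \<le> 0\<close>, \<open>f'\<close> is bounded away
  from 0, and the growth bound on \<open>f''\<close> then determines \<open>K\<close>. Elsewhere the
  inequality is clear.\<close>

lemma unimodal_at_rationalsI:
  assumes d: "degree f \<le> d" and pos: "\<And>x. poly (pderiv f) x = 0 \<Longrightarrow> poly (pderiv (pderiv f)) x > 0"
  shows "unimodal_at_rationals d f"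
proof -
  let ?q = "pderiv (pderiv f)"
  let ?S = "{x. poly ?q x \<le> 0}"
  have "closed ?S" by (intro closed_Collect_le continuous_intros)
  moreover have "poly (pderiv f) x \<noteq> 0" if "x \<in> ?S" for x using pos[of x] that by auto
  ultimately obtain \<epsilon> where \<epsilon>: "\<epsilon> > 0" "\<And>x. x \<in> ?S \<Longrightarrow> \<epsilon> \<le> \<bar>poly (pderiv f) x\<bar>"
    using poly_bounded_away_from_zero[of ?S "pderiv f"] by auto
  have "degree ?q \<le> d" using d by (simp add: degree_pderiv)
  then obtain C where C: "C \<ge> 0" "\<And>x. \<bar>poly ?q x\<bar> \<le> C * (1 + x\<^sup>2) ^ d" using poly_growth_bound by blast
  obtain K :: nat where K: "C / \<epsilon>\<^sup>2 \<le> real K" using real_arch_simple by blast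
  have "poly ?q x + real K * (1 + x\<^sup>2) ^ d * (poly (pderiv f) x)\<^sup>2 \<ge> 0" for x
  proof (cases "poly ?q x \<le> 0")
    case True
    have "\<epsilon>\<^sup>2 \<le> \<bar>poly (pderiv f) x\<bar>\<^sup>2" using \<epsilon> True by (intro power_mono) auto
    then have "C \<le> real K * (poly (pderiv f) x)\<^sup>2"
      using K \<epsilon>(1) by (simp add: field_simps) (metis mult_left_mono of_nat_0_le_iff order_trans mult.commute)
    then have "C * (1 + x\<^sup>2) ^ d \<le> real K * (poly (pderiv f) x)\<^sup>2 * (1 + x\<^sup>2) ^ d" by (intro mult_right_mono) auto
    then show ?thesis using C(2)[of x] by (simp add: mult_ac)
  qed simp
  then show ?thesis unfolding unimodal_at_rationals_def by blast
qed

lemma unimodal_at_rationalsD: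
  assumes "unimodal_at_rationals d f"
  obtains K :: nat where "\<And>x. poly (pderiv (pderiv f)) x + real K * (1 + x\<^sup>2) ^ d * (poly (pderiv f) x)\<^sup>2 \<ge> 0"
proof -
  obtain K :: nat where K: "\<And>x. x \<in> \<rat> \<Longrightarrow> poly (pderiv (pderiv f)) x + real K * (1 + x\<^sup>2) ^ d * (poly (pderiv f) x)\<^sup>2 \<ge> 0"
    using assms unfolding unimodal_at_rationals_def by blast
  have "poly (pderiv (pderiv f) + smult (real K) ([:1, 0, 1:] ^ d * (pderiv f)\<^sup>2)) x \<ge> 0" for x
  proof (rule poly_nonneg_of_rational)
    fix y :: real assume "y \<in> \<rat>"
    from K[OF this]
    show "0 \<le> poly (pderiv (pderiv f) + smult (real K) ([:1, 0, 1:] ^ d * (pderiv f)\<^sup>2)) y"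
      by (simp add: poly_power power2_eq_square mult.assoc)
  qed
  then show thesis by (intro that[of K]) (simp add: poly_power power2_eq_square mult.assoc)
qed

text \<open>One \<open>f_j'\<close> without zeros bounds the whole gradient below, and a single
  \<open>K\<close> pays for all \<open>f_i''\<close>. In the other case each index pays with its own
  \<open>f_i'\<close>, and the constants are added up.\<close>

lemma separable_g_convexI_1d:
  fixes F :: "'n::finite \<Rightarrow> real poly"
  assumes d: "\<And>j. degree (F j) \<le> d"
    and F: "(\<exists>j. \<forall>x. poly (pderiv (F j)) x \<noteq> 0) \<or> (\<forall>j. unimodal_at_rationals d (F j))"
  shows "\<exists>D. connection D \<and> g_convex D (separable c F)"
proof -
  let ?n = "\<lambda>x::real^'n. \<Sum>j\<in>UNIV. (poly (pderiv (F j)) (x $ j))\<^sup>2"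
  have n_ge: "(poly (pderiv (F j)) (x $ j))\<^sup>2 \<le> ?n x" for x j by (rule member_le_sum) auto
  show ?thesis
  proof (cases "\<exists>j. \<forall>x. poly (pderiv (F j)) x \<noteq> 0")
    case True
    then obtain j where "\<forall>x. poly (pderiv (F j)) x \<noteq> 0" by blast
    then obtain \<epsilon> where \<epsilon>: "\<epsilon> > 0" "\<And>x. \<epsilon> \<le> \<bar>poly (pderiv (F j)) x\<bar>"
      using poly_bounded_away_from_zero[of UNIV "pderiv (F j)"] by auto
    have n_pos: "\<epsilon>\<^sup>2 \<le> ?n x" for x
    proof -
      have "\<epsilon>\<^sup>2 \<le> \<bar>poly (pderiv (F j)) (x $ j)\<bar>\<^sup>2" using \<epsilon> by (intro power_mono) auto
      then show ?thesis using n_ge[of j x] by simp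
    qed
    have "\<forall>i. \<exists>C\<ge>0. \<forall>x. \<bar>poly (pderiv (pderiv (F i))) x\<bar> \<le> C * (1 + x\<^sup>2) ^ d"
      using d by (intro allI poly_growth_bound) (simp add: degree_pderiv, meson diff_le_self order_trans)
    then obtain C where C: "\<And>i. C i \<ge> 0" "\<And>i x. \<bar>poly (pderiv (pderiv (F i))) x\<bar> \<le> C i * (1 + x\<^sup>2) ^ d" by metis
    define K where "K = (\<Sum>i\<in>UNIV. C i) / \<epsilon>\<^sup>2"
    show ?thesis
    proof (rule separable_g_convexI[of F K d])
      fix x :: "real ^ 'n" and i
      have "C i \<le> (\<Sum>i\<in>UNIV. C i)" by (rule member_le_sum) (auto simp: C)
      also have "\<dots> = K * \<epsilon>\<^sup>2" using \<epsilon>(1) by (simp add: K_def)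
      also have "\<dots> \<le> K * ?n x" using n_pos[of x] by (intro mult_left_mono) (auto simp: K_def C sum_nonneg)
      finally have "C i * (1 + (x $ i)\<^sup>2) ^ d \<le> K * ?n x * (1 + (x $ i)\<^sup>2) ^ d" by (intro mult_right_mono) auto
      then show "0 \<le> poly (pderiv (pderiv (F i))) (x $ i) + K * (1 + (x $ i)\<^sup>2) ^ d * ?n x"
        using C(2)[of i "x $ i"] by (simp add: mult_ac)
    qed
  next
    case False
    then have "\<forall>j. unimodal_at_rationals d (F j)" using F by blast
    then have "\<forall>j. \<exists>K::nat. \<forall>x. poly (pderiv (pderiv (F j))) x + real K * (1 + x\<^sup>2) ^ d * (poly (pderiv (F j)) x)\<^sup>2 \<ge> 0"
      by (metis unimodal_at_rationalsD)
    then obtain K :: "'n \<Rightarrow> nat" where K: "\<And>j x. poly (pderiv (pderiv (F j))) x + real (K j) * (1 + x\<^sup>2) ^ d * (poly (pderiv (F j)) x)\<^sup>2 \<ge> 0"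
      by metis
    define L where "L = (\<Sum>j\<in>UNIV. real (K j))"
    show ?thesis
    proof (rule separable_g_convexI[of F L d])
      fix x :: "real ^ 'n" and i
      have "real (K i) \<le> L" unfolding L_def by (rule member_le_sum) auto
      then have "real (K i) * (1 + (x $ i)\<^sup>2) ^ d * (poly (pderiv (F i)) (x $ i))\<^sup>2 \<le> L * (1 + (x $ i)\<^sup>2) ^ d * ?n x"
        using n_ge[of i x] by (intro mult_mono) auto
      then show "0 \<le> poly (pderiv (pderiv (F i))) (x $ i) + L * (1 + (x $ i)\<^sup>2) ^ d * ?n x"
        using K[of i "x $ i"] by linarith
    qed
  qed
qed

text \<open>At the first point with \<open>p \<le> 0\<close> the polynomial comes down from positive
  values, so its derivative cannot be positive there.\<close>

lemma poly_down_crossing: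
  fixes p :: "real poly"
  assumes "x < y" "poly p x > 0" "poly p y < 0"
  obtains z where "poly p z = 0" "poly (pderiv p) z \<le> 0"
proof -
  let ?S = "{t \<in> {x..y}. poly p t \<le> 0}"
  have "?S = {x..y} \<inter> {t. poly p t \<le> 0}" by auto
  moreover have "closed {t. poly p t \<le> 0}" by (intro closed_Collect_le continuous_intros)
  ultimately have "compact ?S" by (metis compact_Icc compact_Int_closed)
  moreover have "?S \<noteq> {}" using assms by (auto intro: exI[of _ y])
  ultimately obtain z where z: "z \<in> ?S" "\<And>t. t \<in> ?S \<Longrightarrow> z \<le> t"
    using compact_attains_inf[of ?S] by blast
  have zx: "x < z" using z(1) assms(2) by (cases "x = z") auto
  have pos: "poly p t > 0" if "x \<le> t" "t < z" for t using z that by force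
  have z0: "poly p z = 0"
  proof (rule ccontr)
    assume "poly p z \<noteq> 0"
    then have "poly p z < 0" using z(1) by auto
    then obtain t where "x < t" "t < z" "poly p t = 0" using poly_IVT_neg[OF zx assms(2)] by blast
    then show False using pos[of t] by simp
  qed
  moreover have "poly (pderiv p) z \<le> 0"
  proof (rule ccontr)
    assume "\<not> ?thesis"
    then obtain e where e: "e > 0" "\<And>h. h > 0 \<Longrightarrow> h < e \<Longrightarrow> poly p (z - h) < poly p z"
      using DERIV_pos_inc_left[OF poly_DERIV[of p z]] by auto
    define h where "h = min (e / 2) ((z - x) / 2)"
    have "h > 0" "h < e" "x \<le> z - h" "z - h < z" using e(1) zx by (auto simp: h_def min_def field_simps)
    then show False using e(2)[of h] pos[of "z - h"] z0 by simp
  qed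
  ultimately show thesis by (rule that)
qed

text \<open>If every \<open>f_j'\<close> has a zero, any zero of one \<open>f_i'\<close> can be
  completed by zeros of the others to a critical point of the sum. The Hessian is semidefinite there
  and \<open>gen\<close> makes the inequality strict, so \<open>f_i'\<close> crosses zero only
  upwards.\<close>

lemma separable_g_convex_generic:
  fixes F :: "'n::finite \<Rightarrow> real poly"
  assumes D: "connection D" "g_convex D (separable c F)" and d: "\<And>j. degree (F j) \<le> d"
    and gen: "\<And>j x. poly (pderiv (F j)) x = 0 \<Longrightarrow> poly (pderiv (pderiv (F j))) x \<noteq> 0"
  shows "(\<exists>j. \<forall>x. poly (pderiv (F j)) x \<noteq> 0) \<or> (\<forall>j. unimodal_at_rationals d (F j))" (is ?A)
    and "\<exists>j. \<forall>x y. x < y \<longrightarrow> \<not> (poly (pderiv (F j)) x > 0 \<and> poly (pderiv (F j)) y < 0)" (is ?B)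
proof -
  have "?A \<and> ?B"
  proof (cases "\<exists>j. \<forall>x. poly (pderiv (F j)) x \<noteq> 0")
    case True
    then obtain j where j: "\<forall>x. poly (pderiv (F j)) x \<noteq> 0" by blast
    then have "\<not> (poly (pderiv (F j)) x > 0 \<and> poly (pderiv (F j)) y < 0)" if "x < y" for x y
      using poly_IVT_neg[OF that] by blast
    then show ?thesis using True by blast
  next
    case False
    then obtain z where z: "\<And>j. poly (pderiv (F j)) (z j) = 0" by metis
    have pos: "poly (pderiv (pderiv (F i))) x > 0" if x: "poly (pderiv (F i)) x = 0" for i x
    proof -
      define p :: "real ^ 'n" where "p = (\<chi> j. if j = i then x else z j)"
      have "poly (pderiv (F j)) (p $ j) = 0" for j using x z by (simp add: p_def)
      from g_convex_separable_critical[OF D this, of i]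
      have "poly (pderiv (pderiv (F i))) x \<ge> 0" by (simp add: p_def)
      then show ?thesis using gen[OF x] by linarith
    qed
    have "unimodal_at_rationals d (F j)" for j by (rule unimodal_at_rationalsI[OF d pos])
    moreover have "\<not> (poly (pderiv (F j)) x > 0 \<and> poly (pderiv (F j)) y < 0)" if xy: "x < y" for x y j
    proof
      assume "poly (pderiv (F j)) x > 0 \<and> poly (pderiv (F j)) y < 0"
      then obtain w where "poly (pderiv (F j)) w = 0" "poly (pderiv (pderiv (F j))) w \<le> 0"
        using poly_down_crossing[OF xy] by blast
      then show False using pos[of j w] by simp
    qed
    ultimately show ?thesis by blast
  qed
  then show ?A ?B by blast+
qed

section \<open>Coefficients of separable polynomials\<close>

text \<open>The sum starts at \<open>k = 1\<close>: the constant monomial is shared by all axes and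
  drops out of the derivatives.\<close>

definition axis_poly :: "nat \<Rightarrow> (('n \<Rightarrow>\<^sub>0 nat) \<Rightarrow> real) \<Rightarrow> 'n \<Rightarrow> real poly" where
  "axis_poly d c j = (\<Sum>k\<in>{1..d}. monom (c (Poly_Mapping.single j k)) k)"

lemma degree_axis_poly: "degree (axis_poly d c j) \<le> d"
  unfolding axis_poly_def by (intro degree_sum_le) (auto intro: order_trans[OF degree_monom_le])

lemma poly_pderiv_axis_poly:
  "poly (pderiv (axis_poly d c j)) x = (\<Sum>k\<in>{1..d}. real k * x ^ (k - 1) * c (Poly_Mapping.single j k))"
proof -
  have "pderiv (axis_poly d c j) = (\<Sum>k\<in>{1..d}. monom (real k * c (Poly_Mapping.single j k)) (k - 1))"
    unfolding axis_poly_def by (simp add: higher_pderiv_sum[of 1, simplified] pderiv_monom)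
  then show ?thesis by (simp add: poly_sum poly_monom mult_ac)
qed

lemma poly_pderiv2_axis_poly:
  "poly (pderiv (pderiv (axis_poly d c j))) x =
     (\<Sum>k\<in>{1..d}. real k * real (k - 1) * x ^ (k - 2) * c (Poly_Mapping.single j k))"
proof -
  have "pderiv (pderiv (axis_poly d c j)) =
      (\<Sum>k\<in>{1..d}. monom (real (k - 1) * (real k * c (Poly_Mapping.single j k))) (k - 1 - 1))"
    unfolding axis_poly_def by (simp add: higher_pderiv_sum[of 1, simplified] pderiv_monom)
  then show ?thesis by (simp add: poly_sum poly_monom mult_ac numeral_2_eq_2)
qed

lemma sep_monoms_eq_insert:
  "(sep_monoms d :: ('n::finite \<Rightarrow>\<^sub>0 nat) set) = insert 0 ((\<lambda>(j, k). Poly_Mapping.single j k) ` (UNIV \<times> {1..d}))"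
    (is "_ = insert 0 (?s ` _)")
proof (intro equalityI subsetI)
  fix m :: "'n \<Rightarrow>\<^sub>0 nat" assume "m \<in> sep_monoms d"
  then obtain j k where "m = Poly_Mapping.single j k" "k \<le> d" by (auto simp: sep_monoms_def)
  then show "m \<in> insert 0 (?s ` (UNIV \<times> {1..d}))"
    by (cases "k = 0") (auto intro!: image_eqI[where x = "(j, k)"])
next
  fix m :: "'n \<Rightarrow>\<^sub>0 nat" assume "m \<in> insert 0 (?s ` (UNIV \<times> {1..d}))"
  then have "m = Poly_Mapping.single undefined 0 \<or> (\<exists>j k. m = Poly_Mapping.single j k \<and> k \<le> d)" by auto
  then show "m \<in> sep_monoms d" unfolding sep_monoms_def by blast
qed

lemma zero_notin_singles: "0 \<notin> (\<lambda>(j, k::nat). Poly_Mapping.single j k) ` (UNIV \<times> {1..d})"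
proof
  assume "0 \<in> (\<lambda>(j, k::nat). Poly_Mapping.single j k) ` (UNIV \<times> {1..d})"
  then show False by (auto simp: single_eq_0_iff)
qed

lemma eval_poly_of_coeffs:
  fixes c :: "('n::finite \<Rightarrow>\<^sub>0 nat) \<Rightarrow> real"
  shows "eval_poly (poly_of_coeffs d c) = separable (c 0) (axis_poly d c)"
proof
  fix x :: "real ^ 'n"
  let ?P = "\<lambda>m. \<Prod>i\<in>UNIV. (x $ i) ^ Poly_Mapping.lookup m i"
  let ?s = "\<lambda>(j::'n, k::nat). Poly_Mapping.single j k"
  have keys: "Poly_Mapping.keys (poly_of_coeffs d c) \<subseteq> sep_monoms d"
    by (auto simp: in_keys_iff lookup_poly_of_coeffs split: if_splits)
  have "eval_poly (poly_of_coeffs d c) x = (\<Sum>m\<in>sep_monoms d. Poly_Mapping.lookup (poly_of_coeffs d c) m * ?P m)"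
    unfolding eval_poly_def using keys by (intro sum.mono_neutral_left finite_sep_monoms) (auto simp: in_keys_iff)
  also have "\<dots> = (\<Sum>m\<in>sep_monoms d. c m * ?P m)" by (intro sum.cong) (auto simp: lookup_poly_of_coeffs)
  also have "\<dots> = c 0 * ?P 0 + (\<Sum>m\<in>?s ` (UNIV \<times> {1..d}). c m * ?P m)"
    unfolding sep_monoms_eq_insert by (rule sum.insert[OF _ zero_notin_singles]) simp
  also have "(\<Sum>m\<in>?s ` (UNIV \<times> {1..d}). c m * ?P m) = (\<Sum>(j, k)\<in>UNIV \<times> {1..d}. c (Poly_Mapping.single j k) * (x $ j) ^ k)"
  proof (subst sum.reindex)
    show "inj_on ?s (UNIV \<times> {1..d})" by (auto simp: inj_on_def single_eq_iff)
    have P: "?P (Poly_Mapping.single j k) = (x $ j) ^ k" for j k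
    proof -
      have "?P (Poly_Mapping.single j k) = (\<Prod>i\<in>UNIV. if i = j then (x $ j) ^ k else 1)"
        by (rule prod.cong) (auto simp: lookup_single when_def)
      then show ?thesis by simp
    qed
    show "sum ((\<lambda>m. c m * ?P m) \<circ> ?s) (UNIV \<times> {1..d}) = (\<Sum>(j, k)\<in>UNIV \<times> {1..d}. c (Poly_Mapping.single j k) * (x $ j) ^ k)"
      by (rule sum.cong) (auto simp: P)
  qed
  also have "\<dots> = (\<Sum>j\<in>UNIV. poly (axis_poly d c j) (x $ j))"
    by (simp add: axis_poly_def poly_sum poly_monom sum.cartesian_product)
  finally show "eval_poly (poly_of_coeffs d c) x = separable (c 0) (axis_poly d c) x" by (simp add: separable_def)
qed

lemma poly_of_coeffs_polys_le: "poly_of_coeffs d c \<in> (polys_le d :: 'n::finite rpoly set)"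
proof -
  have "(\<Sum>i\<in>UNIV. Poly_Mapping.lookup m i) \<le> d" if "m \<in> Poly_Mapping.keys (poly_of_coeffs d c)" for m :: "'n \<Rightarrow>\<^sub>0 nat"
  proof -
    have "m \<in> sep_monoms d" using that by (auto simp: in_keys_iff lookup_poly_of_coeffs split: if_splits)
    then obtain j k where "m = Poly_Mapping.single j k" "k \<le> d" by (auto simp: sep_monoms_def)
    then show ?thesis by (simp add: lookup_single when_def)
  qed
  then show ?thesis by (simp add: polys_le_def)
qed

text \<open>A measurable substitute for g-convexity: it always implies it, and it follows from it
  when no axis is degenerate.\<close>

definition good_coeffs :: "nat \<Rightarrow> (('n::finite \<Rightarrow>\<^sub>0 nat) \<Rightarrow> real) \<Rightarrow> bool" where
  "good_coeffs d c \<longleftrightarrow> (\<exists>j. \<forall>x. poly (pderiv (axis_poly d c j)) x \<noteq> 0) \<or>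
     (\<forall>j. unimodal_at_rationals d (axis_poly d c j))"

definition degenerate :: "nat \<Rightarrow> (('n::finite \<Rightarrow>\<^sub>0 nat) \<Rightarrow> real) \<Rightarrow> 'n \<Rightarrow> bool" where
  "degenerate d c j \<longleftrightarrow> (\<exists>x. poly (pderiv (axis_poly d c j)) x = 0 \<and> poly (pderiv (pderiv (axis_poly d c j))) x = 0)"

lemma good_coeffs_g_convex:
  assumes "good_coeffs d c"
  shows "poly_of_coeffs d c \<in> g_convex_polys d"
proof -
  have "\<exists>D. connection D \<and> g_convex D (separable (c 0) (axis_poly d c))"
    using assms unfolding good_coeffs_def by (rule separable_g_convexI_1d[OF degree_axis_poly])
  then show ?thesis by (simp add: g_convex_polys_def eval_poly_of_coeffs poly_of_coeffs_polys_le)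
qed

lemma g_convex_coeffs_generic:
  assumes "poly_of_coeffs d c \<in> g_convex_polys d" "\<And>j. \<not> degenerate d c j"
  shows "good_coeffs d c"
    and "\<exists>j. \<forall>x y. x < y \<longrightarrow> \<not> (poly (pderiv (axis_poly d c j)) x > 0 \<and> poly (pderiv (axis_poly d c j)) y < 0)"
proof -
  obtain D where D: "connection D" "g_convex D (separable (c 0) (axis_poly d c))"
    using assms(1) by (auto simp: g_convex_polys_def eval_poly_of_coeffs)
  have gen: "poly (pderiv (pderiv (axis_poly d c j))) x \<noteq> 0" if "poly (pderiv (axis_poly d c j)) x = 0" for j x
    using assms(2)[of j] that by (auto simp: degenerate_def)
  note * = separable_g_convex_generic[OF D degree_axis_poly gen]
  show "good_coeffs d c" unfolding good_coeffs_def by (rule *(1))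
  show "\<exists>j. \<forall>x y. x < y \<longrightarrow> \<not> (poly (pderiv (axis_poly d c j)) x > 0 \<and> poly (pderiv (axis_poly d c j)) y < 0)" by (rule *(2))
qed

text \<open>Perturbations of \<open>x + x^d\<close> (\<open>d\<close> odd) have positive derivative, and perturbations of
  \<open>x^2 + x^d\<close> (\<open>d\<close> even) have positive second derivative.\<close>

lemma good_coeffs_cube:
  fixes c :: "('n::finite \<Rightarrow>\<^sub>0 nat) \<Rightarrow> real"
  assumes d: "d \<ge> 1" and \<epsilon>: "\<epsilon> * (4 * real d ^ 3) \<le> 1" "\<epsilon> \<ge> 0"
    and c: "\<And>j k. k \<in> {1..d} \<Longrightarrow> \<bar>c (Poly_Mapping.single j k) - (if k = d \<or> k = (if odd d then 1 else 2) then 1 else 0)\<bar> \<le> \<epsilon>"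
  shows "good_coeffs d c"
proof -
  define a where "a k = (if k = d \<or> k = (if odd d then 1 else 2) then 1 else 0 :: real)" for k
  have pw: "\<bar>x\<bar> ^ k \<le> 1 + x ^ e" if "k \<le> e" "even e" for x :: real and k e :: nat
  proof (cases "\<bar>x\<bar> \<le> 1")
    case True
    then have "\<bar>x\<bar> ^ k \<le> 1" by (simp add: power_le_one)
    then show ?thesis using zero_le_even_power[OF that(2), of x] by linarith
  next
    case False
    then have "\<bar>x\<bar> ^ k \<le> \<bar>x\<bar> ^ e" using that(1) by (intro power_increasing) auto
    then show ?thesis using that(2) by (simp add: power_even_abs)
  qed
  \<comment> \<open>\<open>s\<close> is the order of the derivative, 1 or 2. The \<open>d\<close>
    summands, with factors at most \<open>d^2\<close> and coefficient errors at most
    \<open>\<epsilon>\<close>, add up to \<open>\<epsilon> * d^3 \<le> 1/4\<close>, while the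
    unperturbed sum will be at least \<open>(1 + x ^ (d - s)) / 2\<close>.\<close>
  have pert: "\<bar>(\<Sum>k\<in>{1..d}. w k * x ^ (k - s) * c (Poly_Mapping.single j k)) - (\<Sum>k\<in>{1..d}. w k * x ^ (k - s) * a k)\<bar>
      \<le> (1 + x ^ (d - s)) / 4"
    if w: "\<And>k. k \<in> {1..d} \<Longrightarrow> 0 \<le> w k \<and> w k \<le> (real d)\<^sup>2" and e: "even (d - s)" for w :: "nat \<Rightarrow> real" and x s j
  proof -
    have "\<bar>(\<Sum>k\<in>{1..d}. w k * x ^ (k - s) * c (Poly_Mapping.single j k)) - (\<Sum>k\<in>{1..d}. w k * x ^ (k - s) * a k)\<bar>
      = \<bar>\<Sum>k\<in>{1..d}. w k * x ^ (k - s) * (c (Poly_Mapping.single j k) - a k)\<bar>"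
      by (simp add: sum_subtractf[symmetric] right_diff_distrib)
    also have "\<dots> \<le> (\<Sum>k\<in>{1..d}. \<bar>w k * x ^ (k - s) * (c (Poly_Mapping.single j k) - a k)\<bar>)" by (rule sum_abs)
    also have "\<dots> \<le> (\<Sum>k\<in>{1..d}. (real d)\<^sup>2 * (1 + x ^ (d - s)) * \<epsilon>)"
    proof (rule sum_mono)
      fix k assume k: "k \<in> {1..d}"
      have "\<bar>x\<bar> ^ (k - s) \<le> 1 + x ^ (d - s)" using k e by (intro pw) auto
      then show "\<bar>w k * x ^ (k - s) * (c (Poly_Mapping.single j k) - a k)\<bar> \<le> (real d)\<^sup>2 * (1 + x ^ (d - s)) * \<epsilon>"
        unfolding abs_mult power_abs using w[OF k] c[OF k, of j] zero_le_even_power[OF e, of x]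
        by (intro mult_mono) (auto simp: a_def)
    qed
    also have "\<dots> = (\<epsilon> * real d ^ 3) * (1 + x ^ (d - s))" by (simp add: power2_eq_square power3_eq_cube mult_ac)
    also have "\<dots> \<le> (1 / 4) * (1 + x ^ (d - s))"
      using \<epsilon> zero_le_even_power[OF e, of x] by (intro mult_right_mono) auto
    finally show ?thesis by simp
  qed
  show ?thesis
  proof (cases "odd d")
    case True
    have "poly (pderiv (axis_poly d c j)) x > 0" for j x
    proof -
      have e: "even (d - 1)" using True by simp
      have x: "x ^ (d - 1) \<ge> 0" using e by (rule zero_le_even_power)
      have "(1 + x ^ (d - 1)) / 2 \<le> (\<Sum>k\<in>{1, d}. real k * x ^ (k - 1) * a k)"
      proof (cases "d = 1")
        case False
        have "1 * x ^ (d - 1) \<le> real d * x ^ (d - 1)" using x d by (intro mult_right_mono) auto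
        then show ?thesis using False True x by (simp add: a_def)
      qed (simp add: a_def)
      also have "\<dots> \<le> (\<Sum>k\<in>{1..d}. real k * x ^ (k - 1) * a k)"
        using d True by (subst sum.mono_neutral_left[of "{1..d}" "{1, d}"]) (auto simp: a_def)
      finally have lo: "(1 + x ^ (d - 1)) / 2 \<le> (\<Sum>k\<in>{1..d}. real k * x ^ (k - 1) * a k)" .
      have "real k \<le> (real d)\<^sup>2" if "k \<in> {1..d}" for k
      proof -
        have "real k * 1 \<le> real d * real d" using that by (intro mult_mono) auto
        then show ?thesis by (simp add: power2_eq_square)
      qed
      then have "\<bar>poly (pderiv (axis_poly d c j)) x - (\<Sum>k\<in>{1..d}. real k * x ^ (k - 1) * a k)\<bar> \<le> (1 + x ^ (d - 1)) / 4"
        unfolding poly_pderiv_axis_poly by (intro pert e) auto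
      then show ?thesis using lo x unfolding abs_le_iff by (simp add: field_simps)
    qed
    then show ?thesis unfolding good_coeffs_def by (metis less_irrefl)
  next
    case False
    then have d2: "d \<ge> 2" using d by (cases "d = 1") auto
    have "poly (pderiv (pderiv (axis_poly d c j))) x > 0" for j x
    proof -
      have e: "even (d - 2)" using False by simp
      have x: "x ^ (d - 2) \<ge> 0" using e by (rule zero_le_even_power)
      have "(1 + x ^ (d - 2)) / 2 \<le> (\<Sum>k\<in>{2, d}. real k * real (k - 1) * x ^ (k - 2) * a k)"
      proof (cases "d = 2")
        case ne: False
        have "1 * 1 * x ^ (d - 2) \<le> real d * real (d - 1) * x ^ (d - 2)" using x d2 by (intro mult_right_mono mult_mono) auto
        then show ?thesis using ne False x by (simp add: a_def)
      qed (simp add: a_def)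
      also have "\<dots> \<le> (\<Sum>k\<in>{1..d}. real k * real (k - 1) * x ^ (k - 2) * a k)"
        using d2 False by (subst sum.mono_neutral_left[of "{1..d}" "{2, d}"]) (auto simp: a_def)
      finally have lo: "(1 + x ^ (d - 2)) / 2 \<le> (\<Sum>k\<in>{1..d}. real k * real (k - 1) * x ^ (k - 2) * a k)" .
      have "real k * real (k - 1) \<le> (real d)\<^sup>2" if "k \<in> {1..d}" for k
        unfolding power2_eq_square using that by (intro mult_mono) auto
      then have "\<bar>poly (pderiv (pderiv (axis_poly d c j))) x - (\<Sum>k\<in>{1..d}. real k * real (k - 1) * x ^ (k - 2) * a k)\<bar> \<le> (1 + x ^ (d - 2)) / 4"
        unfolding poly_pderiv2_axis_poly by (intro pert e) auto
      then show ?thesis using lo x unfolding abs_le_iff by (simp add: field_simps)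
    qed
    then have "unimodal_at_rationals d (axis_poly d c j)" for j
      by (intro unimodal_at_rationalsI degree_axis_poly)
    then show ?thesis by (simp add: good_coeffs_def)
  qed
qed

section \<open>Measure of sets of coefficients\<close>

lemma uniform_measure_PiM_box:
  fixes B :: "'i \<Rightarrow> real set"
  assumes I: "finite I" and B: "\<And>i. B i \<in> sets lborel" "\<And>i. emeasure lborel (B i) = ennreal (v i)" "\<And>i. v i > 0"
  shows "uniform_measure (Pi\<^sub>M I (\<lambda>_. lborel)) (Pi\<^sub>E I B) = Pi\<^sub>M I (\<lambda>i. uniform_measure lborel (B i))"
proof -
  interpret L: product_sigma_finite "\<lambda>_::'i. lborel :: real measure" by standard
  interpret U: product_sigma_finite "\<lambda>i. uniform_measure lborel (B i)"
  proof
    fix i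
    interpret prob_space "uniform_measure lborel (B i)"
      by (intro prob_space_uniform_measure) (simp_all add: B(2) ennreal_eq_0_iff not_le B(3))
    show "\<exists>A. countable A \<and> A \<subseteq> sets (uniform_measure lborel (B i)) \<and> \<Union> A = space (uniform_measure lborel (B i))
        \<and> (\<forall>a\<in>A. emeasure (uniform_measure lborel (B i)) a \<noteq> \<infinity>)" by (rule sigma_finite_countable)
  qed
  have box: "Pi\<^sub>E I B \<in> sets (Pi\<^sub>M I (\<lambda>_. lborel))" using B(1) I by (intro sets_PiM_I_finite) auto
  show ?thesis
  proof (rule U.PiM_eqI[OF I])
    show "sets (uniform_measure (Pi\<^sub>M I (\<lambda>_. lborel)) (Pi\<^sub>E I B)) = sets (Pi\<^sub>M I (\<lambda>i. uniform_measure lborel (B i)))"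
      by (simp, rule sets_PiM_cong) auto
    fix A assume A: "\<And>i. i \<in> I \<Longrightarrow> A i \<in> sets (uniform_measure lborel (B i))"
    then have A': "Pi\<^sub>E I A \<in> sets (Pi\<^sub>M I (\<lambda>_. lborel))" using I by (intro sets_PiM_I_finite) auto
    have "emeasure (uniform_measure (Pi\<^sub>M I (\<lambda>_. lborel)) (Pi\<^sub>E I B)) (Pi\<^sub>E I A)
        = emeasure (Pi\<^sub>M I (\<lambda>_. lborel)) (Pi\<^sub>E I B \<inter> Pi\<^sub>E I A) / emeasure (Pi\<^sub>M I (\<lambda>_. lborel)) (Pi\<^sub>E I B)"
      by (rule emeasure_uniform_measure[OF box A'])
    also have "Pi\<^sub>E I B \<inter> Pi\<^sub>E I A = Pi\<^sub>E I (\<lambda>i. B i \<inter> A i)" by (rule PiE_Int)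
    also have "emeasure (Pi\<^sub>M I (\<lambda>_. lborel)) \<dots> = (\<Prod>i\<in>I. emeasure lborel (B i \<inter> A i))"
      using A B(1) by (intro L.emeasure_PiM I) auto
    also have "emeasure (Pi\<^sub>M I (\<lambda>_. lborel)) (Pi\<^sub>E I B) = ennreal (\<Prod>i\<in>I. v i)"
      using B by (subst L.emeasure_PiM[OF I]) (auto simp: prod_ennreal less_imp_le)
    also have "(\<Prod>i\<in>I. emeasure lborel (B i \<inter> A i)) / ennreal (\<Prod>i\<in>I. v i)
        = (\<Prod>i\<in>I. emeasure lborel (B i \<inter> A i)) * (\<Prod>i\<in>I. inverse (ennreal (v i)))"
      using B(3) by (simp add: divide_ennreal_def inverse_ennreal prod_pos prod_ennreal less_imp_le prod_inversef[symmetric])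
    also have "\<dots> = (\<Prod>i\<in>I. emeasure lborel (B i \<inter> A i) / emeasure lborel (B i))"
      by (simp add: prod.distrib divide_ennreal_def B(2))
    also have "\<dots> = (\<Prod>i\<in>I. emeasure (uniform_measure lborel (B i)) (A i))"
      using A B(1) by (intro prod.cong) auto
    finally show "emeasure (uniform_measure (Pi\<^sub>M I (\<lambda>_. lborel)) (Pi\<^sub>E I B)) (Pi\<^sub>E I A)
        = (\<Prod>i\<in>I. emeasure (uniform_measure lborel (B i)) (A i))" .
  qed
qed

definition coeff_box :: "real \<Rightarrow> ('n::finite \<Rightarrow>\<^sub>0 nat) \<Rightarrow> real set" where
  "coeff_box r m = (if m = 0 then {- (real CARD('n) * r)..real CARD('n) * r} else {- r..r})"

lemma sep_polys_coeff_box: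
  "(sep_polys d r :: 'n::finite rpoly set) = poly_of_coeffs d ` Pi\<^sub>E (sep_monoms d) (coeff_box r)"
  unfolding sep_polys_eq_box coeff_box_def[abs_def] ..

abbreviation coeff_measure :: "nat \<Rightarrow> (('n::finite \<Rightarrow>\<^sub>0 nat) \<Rightarrow> real) measure" where
  "coeff_measure d \<equiv> Pi\<^sub>M (sep_monoms d) (\<lambda>_. lborel)"

lemma single_in_sep_monoms: "k \<le> d \<Longrightarrow> Poly_Mapping.single j k \<in> sep_monoms d"
  by (auto simp: sep_monoms_def)

lemma coeff_box_lborel:
  fixes m :: "'n::finite \<Rightarrow>\<^sub>0 nat"
  assumes "r > 0"
  shows "coeff_box r m \<in> sets lborel"
    "emeasure lborel (coeff_box r m) = ennreal (if m = 0 then 2 * (real CARD('n) * r) else 2 * r)"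
    "(if m = 0 then 2 * (real CARD('n) * r) else 2 * r) > 0"
  using assms by (auto simp: coeff_box_def)

text \<open>The exponents start at 1, so the constant coordinate with its wider interval is left
  out, and the coefficients of one axis are independent and uniform on
  \<open>{-r..r}\<close>.\<close>

lemma emeasure_uniform_marginal:
  fixes j :: "'n::finite"
  assumes r: "r > 0" and E: "E \<in> sets (Pi\<^sub>M {1..d} (\<lambda>_. unif r))"
  defines "X \<equiv> {c \<in> space (coeff_measure d). (\<lambda>k\<in>{1..d}. c (Poly_Mapping.single j k)) \<in> E}"
  shows "X \<in> sets (coeff_measure d)"
    "emeasure (uniform_measure (coeff_measure d) (Pi\<^sub>E (sep_monoms d) (coeff_box r))) X
      = emeasure (Pi\<^sub>M {1..d} (\<lambda>_. unif r)) E"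
proof -
  let ?S = "Poly_Mapping.single j"
  let ?U = "\<lambda>m::'n \<Rightarrow>\<^sub>0 nat. uniform_measure lborel (coeff_box r m)"
  let ?K = "sep_monoms d :: ('n \<Rightarrow>\<^sub>0 nat) set"
  let ?\<pi> = "\<lambda>c. \<lambda>k\<in>{1..d}. c (?S k)"
  have S: "?S k \<in> ?K" if "k \<in> {1..d}" for k using that by (intro single_in_sep_monoms) auto
  have sets_eq: "sets (Pi\<^sub>M {1..d} (\<lambda>_. unif r)) = sets (Pi\<^sub>M {1..d} (\<lambda>_. lborel))"
    by (rule sets_PiM_cong) auto
  have "?\<pi> \<in> measurable (coeff_measure d) (Pi\<^sub>M {1..d} (\<lambda>_. lborel))"
    using S by (intro measurable_restrict measurable_component_singleton) auto
  from measurable_sets[OF this, of E] show X: "X \<in> sets (coeff_measure d)"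
    using E unfolding sets_eq X_def by (simp add: vimage_def Int_def conj_commute)
  have prob: "prob_space (?U m)" for m
    using coeff_box_lborel[OF r, of m] by (intro prob_space_uniform_measure) (auto split: if_splits)
  have U_S: "?U (?S k) = unif r" if "k \<in> {1..d}" for k
    using that by (simp add: unif_def coeff_box_def single_eq_0_iff)
  have eq: "Pi\<^sub>M {1..d} (\<lambda>k. ?U (?S k)) = Pi\<^sub>M {1..d} (\<lambda>_. unif r)"
    by (rule PiM_cong[OF refl U_S])
  have distr: "distr (Pi\<^sub>M ?K ?U) (Pi\<^sub>M {1..d} (\<lambda>_. unif r)) ?\<pi> = Pi\<^sub>M {1..d} (\<lambda>_. unif r)"
    using distr_PiM_reindex[of ?K ?U ?S "{1..d}"] prob S unfolding eq
    by (auto simp: inj_on_def single_eq_iff)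
  have meas: "?\<pi> \<in> measurable (Pi\<^sub>M ?K ?U) (Pi\<^sub>M {1..d} (\<lambda>k. ?U (?S k)))"
    by (intro measurable_restrict measurable_component_singleton S)
  have "emeasure (uniform_measure (coeff_measure d) (Pi\<^sub>E ?K (coeff_box r))) X = emeasure (Pi\<^sub>M ?K ?U) X"
    by (subst uniform_measure_PiM_box[OF finite_sep_monoms coeff_box_lborel[OF r]]) simp
  also have "\<dots> = emeasure (Pi\<^sub>M ?K ?U) (?\<pi> -` E \<inter> space (Pi\<^sub>M ?K ?U))"
    by (rule arg_cong[where f = "emeasure _"]) (auto simp: X_def space_PiM)
  also have "\<dots> = emeasure (distr (Pi\<^sub>M ?K ?U) (Pi\<^sub>M {1..d} (\<lambda>_. unif r)) ?\<pi>) E"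
    by (rule emeasure_distr[OF meas[unfolded eq] E, symmetric])
  also have "\<dots> = emeasure (Pi\<^sub>M {1..d} (\<lambda>_. unif r)) E" unfolding distr ..
  finally show "emeasure (uniform_measure (coeff_measure d) (Pi\<^sub>E ?K (coeff_box r))) X = emeasure (Pi\<^sub>M {1..d} (\<lambda>_. unif r)) E" .
qed

lemma measurable_coeff:
  "m \<in> sep_monoms d \<Longrightarrow> (\<lambda>c. c m) \<in> borel_measurable (coeff_measure d)"
  using measurable_component_singleton[of m "sep_monoms d" "\<lambda>_. lborel"] by simp

lemma measurable_poly_pderiv_axis_poly:
  fixes j :: "'n::finite"
  shows "(\<lambda>c. poly (pderiv (axis_poly d c j)) x) \<in> borel_measurable (coeff_measure d)"
    "(\<lambda>c. poly (pderiv (pderiv (axis_poly d c j))) x) \<in> borel_measurable (coeff_measure d)"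
  unfolding poly_pderiv_axis_poly poly_pderiv2_axis_poly
  by (intro borel_measurable_sum borel_measurable_times borel_measurable_const measurable_coeff single_in_sep_monoms; simp)+

lemma sets_good_coeffs: "{c \<in> space (coeff_measure d). good_coeffs d c} \<in> sets (coeff_measure d :: (('n::finite \<Rightarrow>\<^sub>0 nat) \<Rightarrow> real) measure)"
proof -
  note [measurable] = measurable_poly_pderiv_axis_poly
  let ?M = "coeff_measure d :: (('n \<Rightarrow>\<^sub>0 nat) \<Rightarrow> real) measure"
  have 1: "{c \<in> space ?M. \<forall>x. poly (pderiv (axis_poly d c j)) x \<noteq> 0} \<in> sets ?M" for j
    unfolding poly_no_root_iff_rational
    by (intro sets.sets_Collect_countable_Ex sets.sets_Collect_countable_All' countable_rat) measurable
  have 2: "{c \<in> space ?M. unimodal_at_rationals d (axis_poly d c j)} \<in> sets ?M" for j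
    unfolding unimodal_at_rationals_def
    by (intro sets.sets_Collect_countable_Ex sets.sets_Collect_countable_All' countable_rat) measurable
  have "{c \<in> space ?M. \<exists>j\<in>UNIV. \<forall>x. poly (pderiv (axis_poly d c j)) x \<noteq> 0} \<in> sets ?M"
    "{c \<in> space ?M. \<forall>j\<in>UNIV. unimodal_at_rationals d (axis_poly d c j)} \<in> sets ?M"
    by (intro sets.sets_Collect_finite_Ex sets.sets_Collect_finite_All 1 2 finite)+
  from sets.Un[OF this] show ?thesis by (rule back_subst[of "\<lambda>X. X \<in> sets ?M"]) (auto simp: good_coeffs_def)
qed

text \<open>The linear coefficient \<open>y\<close> shifts \<open>f'\<close> and leaves
  \<open>f''\<close> unchanged. A common zero forces \<open>y = - h'(x)\<close> at one of the
  finitely many zeros of \<open>h''\<close>; if \<open>h''\<close> is the zero polynomial,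
  \<open>h'\<close> is constant and at most one \<open>y\<close> is bad.\<close>

lemma finite_degenerate_section:
  fixes c :: "('n::finite \<Rightarrow>\<^sub>0 nat) \<Rightarrow> real"
  assumes d: "d \<ge> 1"
  shows "finite {y. degenerate d (c(Poly_Mapping.single j 1 := y)) j}"
proof -
  let ?s = "Poly_Mapping.single j (1::nat)"
  define h where "h = axis_poly d (c(?s := 0)) j"
  have ax: "axis_poly d (c(?s := y)) j = h + monom y 1" for y
  proof -
    have "axis_poly d (c(?s := y)) j = (\<Sum>k\<in>{1..d}. monom ((c(?s := 0)) (Poly_Mapping.single j k)) k + (if k = 1 then monom y 1 else 0))"
      unfolding axis_poly_def by (rule sum.cong) (auto simp: single_eq_iff)
    then show ?thesis using d by (simp add: sum.distrib h_def axis_poly_def)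
  qed
  have "pderiv (h + monom y 1) = pderiv h + [:y:]" for y
    by (simp add: pderiv_add pderiv_monom monom_0)
  then have deg: "degenerate d (c(?s := y)) j \<longleftrightarrow> (\<exists>x. poly (pderiv h) x + y = 0 \<and> poly (pderiv (pderiv h)) x = 0)" for y
    unfolding degenerate_def ax by (simp add: pderiv_add pderiv_pCons)
  show ?thesis
  proof (cases "pderiv (pderiv h) = 0")
    case True
    then have "degree (pderiv h) = 0" by (simp add: pderiv_eq_0_iff)
    then obtain b where "pderiv h = [:b:]" by (rule degree_eq_zeroE)
    then have "{y. degenerate d (c(?s := y)) j} \<subseteq> {- b}" unfolding deg by auto
    then show ?thesis by (rule finite_subset) simp
  next
    case False
    have "{y. degenerate d (c(?s := y)) j} \<subseteq> (\<lambda>x. - poly (pderiv h) x) ` {x. poly (pderiv (pderiv h)) x = 0}"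
      unfolding deg by (force simp: add_eq_0_iff)
    then show ?thesis by (rule finite_subset) (intro finite_imageI poly_roots_finite False)
  qed
qed

lemma null_sets_degenerate:
  fixes j :: "'n::finite"
  assumes d: "d \<ge> 1"
  shows "{c \<in> space (coeff_measure d). degenerate d c j} \<in> null_sets (coeff_measure d)"
proof -
  note [measurable] = measurable_poly_pderiv_axis_poly
  let ?M = "coeff_measure d :: (('n \<Rightarrow>\<^sub>0 nat) \<Rightarrow> real) measure"
  let ?s = "Poly_Mapping.single j (1::nat)"
  interpret product_sigma_finite "\<lambda>_::'n \<Rightarrow>\<^sub>0 nat. lborel :: real measure" by standard
  define B where "B = {c \<in> space ?M. degenerate d c j}"
  \<comment> \<open>A common zero is a zero of the sum of squares; this brings in the rational
    criterion and shows that \<open>B\<close> is Borel, as Fubini requires.\<close>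
  have deg: "degenerate d c j \<longleftrightarrow> \<not> (\<forall>x. poly ((pderiv (axis_poly d c j))\<^sup>2 + (pderiv (pderiv (axis_poly d c j)))\<^sup>2) x \<noteq> 0)" for c
    unfolding degenerate_def by (simp add: poly_power sum_power2_eq_zero_iff)
  have B: "B \<in> sets ?M"
    unfolding B_def deg poly_no_root_iff_rational
    unfolding poly_add poly_power
    by (intro sets.sets_Collect_neg sets.sets_Collect_countable_Ex sets.sets_Collect_countable_All' countable_rat) measurable
  define J where "J = sep_monoms d - {?s}"
  have K: "sep_monoms d = insert ?s J" "finite J" "?s \<notin> J"
    using single_in_sep_monoms[OF d, of j] finite_sep_monoms by (auto simp: J_def)
  have "emeasure ?M B = (\<integral>\<^sup>+c. indicator B c \<partial>?M)" using B by simp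
  also have "\<dots> = (\<integral>\<^sup>+x. (\<integral>\<^sup>+y. indicator B (x(?s := y)) \<partial>lborel) \<partial>Pi\<^sub>M J (\<lambda>_. lborel))"
    unfolding K(1) by (rule product_nn_integral_insert[OF K(2,3)]) (use B K(1) in simp)
  also have "\<dots> = (\<integral>\<^sup>+x. 0 \<partial>Pi\<^sub>M J (\<lambda>_. lborel :: real measure))"
  proof (rule nn_integral_cong)
    fix x :: "('n \<Rightarrow>\<^sub>0 nat) \<Rightarrow> real"
    let ?D = "{y. degenerate d (x(?s := y)) j}"
    have D: "?D \<in> null_sets lborel"
      using finite_degenerate_section[OF d] by (intro finite_imp_null_set_lborel)
    have "(\<integral>\<^sup>+y. indicator B (x(?s := y)) \<partial>lborel) \<le> (\<integral>\<^sup>+y. indicator ?D y \<partial>lborel)"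
      by (rule nn_integral_mono) (auto simp: B_def split: split_indicator)
    also have "\<dots> = emeasure lborel ?D" using D by (intro nn_integral_indicator) auto
    also have "\<dots> = 0" using D by auto
    finally show "(\<integral>\<^sup>+y. indicator B (x(?s := y)) \<partial>lborel) = 0" by simp
  qed
  finally show ?thesis using B unfolding B_def[symmetric] by (simp add: null_sets_def)
qed

definition g_convex_coeffs :: "nat \<Rightarrow> real \<Rightarrow> (('n::finite \<Rightarrow>\<^sub>0 nat) \<Rightarrow> real) set" where
  "g_convex_coeffs d r = {c \<in> Pi\<^sub>E (sep_monoms d) (coeff_box r). poly_of_coeffs d c \<in> g_convex_polys d}"

lemma sep_g_convex_eq: "sep_polys d r \<inter> g_convex_polys d = poly_of_coeffs d ` g_convex_coeffs d r"
  unfolding sep_polys_coeff_box g_convex_coeffs_def by blast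

lemma coeff_box_sets:
  assumes "r > 0"
  shows "Pi\<^sub>E (sep_monoms d) (coeff_box r) \<in> sets (coeff_measure d)"
  using coeff_box_lborel(1)[OF assms] by (intro sets_PiM_I_finite finite_sep_monoms) auto

text \<open>The existence of a connection is not visibly a Borel condition. The set is instead a
  Borel part, certified by \<open>good_coeffs\<close>, together with a subset of the null set of
  degenerate coefficients.\<close>

lemma g_convex_coeffs_sets:
  fixes r :: real
  assumes d: "d \<ge> 1" and r: "r > 0"
  shows "g_convex_coeffs d r \<in> sets (completion (coeff_measure d :: (('n::finite \<Rightarrow>\<^sub>0 nat) \<Rightarrow> real) measure))"
proof -
  let ?M = "coeff_measure d :: (('n \<Rightarrow>\<^sub>0 nat) \<Rightarrow> real) measure"
  let ?B = "Pi\<^sub>E (sep_monoms d) (coeff_box r) :: (('n \<Rightarrow>\<^sub>0 nat) \<Rightarrow> real) set"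
  let ?G = "{c \<in> space ?M. good_coeffs d c}"
  let ?N = "\<Union>j. {c \<in> space ?M. degenerate d c j}"
  have sp: "?B \<subseteq> space ?M" by (auto simp: space_PiM PiE_iff)
  show ?thesis
  proof (rule sets_completionI)
    show "g_convex_coeffs d r = (?B \<inter> ?G) \<union> (g_convex_coeffs d r - ?G)"
      using good_coeffs_g_convex sp unfolding g_convex_coeffs_def by blast
    show "g_convex_coeffs d r - ?G \<subseteq> ?N"
    proof
      fix c :: "('n \<Rightarrow>\<^sub>0 nat) \<Rightarrow> real" assume c: "c \<in> g_convex_coeffs d r - ?G"
      then have cs: "c \<in> space ?M" using sp unfolding g_convex_coeffs_def by blast
      show "c \<in> ?N"
      proof (rule ccontr)
        assume "c \<notin> ?N"
        then have "\<And>j. \<not> degenerate d c j" using cs by blast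
        from g_convex_coeffs_generic(1)[OF _ this] c cs show False unfolding g_convex_coeffs_def by blast
      qed
    qed
    show "?N \<in> null_sets ?M" by (rule null_sets_UN) (rule null_sets_degenerate[OF d])
    show "?B \<inter> ?G \<in> sets ?M" by (intro sets.Int coeff_box_sets[OF r] sets_good_coeffs)
  qed
qed

lemma inj_on_space_coeff: "inj_on (poly_of_coeffs d) (space (completion (coeff_measure d :: (('n::finite \<Rightarrow>\<^sub>0 nat) \<Rightarrow> real) measure)))"
  using inj_on_poly_of_coeffs[of d] by (simp add: space_PiM)

lemma sep_g_convex_sets:
  assumes d: "d \<ge> 1" and r: "r > 0"
  shows "sep_polys d r \<inter> g_convex_polys d \<in> sets (sep_uniform d r :: 'n::finite rpoly measure)"
  unfolding sep_g_convex_eq sep_uniform_def sep_lebesgue_def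
  by (simp add: in_sets_embed_measure[OF g_convex_coeffs_sets[OF d r]])

text \<open>Off a null set some axis has a derivative that never changes from plus to minus, so its
  coefficients lie in \<open>E\<close>. The union bound over the axes costs the factor
  \<open>CARD('n)\<close>.\<close>

lemma emeasure_sep_g_convex_le:
  fixes r :: real
  assumes d: "d \<ge> 1" and r: "r > 0" and E: "E \<in> sets (Pi\<^sub>M {1..d} (\<lambda>_. unif r))"
    and noE: "\<And>a. a \<in> space (Pi\<^sub>M {1..d} (\<lambda>_. unif r)) \<Longrightarrow>
        (\<And>x y. x < y \<Longrightarrow> \<not> ((\<Sum>k\<in>{1..d}. real k * x ^ (k - 1) * a k) > 0 \<and>
                             (\<Sum>k\<in>{1..d}. real k * y ^ (k - 1) * a k) < 0)) \<Longrightarrow> a \<in> E"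
  shows "emeasure (sep_uniform d r) (sep_polys d r \<inter> g_convex_polys d :: 'n::finite rpoly set)
     \<le> of_nat CARD('n) * emeasure (Pi\<^sub>M {1..d} (\<lambda>_. unif r)) E"
proof -
  let ?M = "coeff_measure d :: (('n \<Rightarrow>\<^sub>0 nat) \<Rightarrow> real) measure"
  let ?B = "Pi\<^sub>E (sep_monoms d) (coeff_box r) :: (('n \<Rightarrow>\<^sub>0 nat) \<Rightarrow> real) set"
  let ?C = "g_convex_coeffs d r :: (('n \<Rightarrow>\<^sub>0 nat) \<Rightarrow> real) set"
  let ?N = "\<Union>j. {c \<in> space ?M. degenerate d c j}"
  define X where "X j = {c \<in> space ?M. (\<lambda>k\<in>{1..d}. c (Poly_Mapping.single j k)) \<in> E}" for j :: 'n
  have X: "X j \<in> sets ?M" for j unfolding X_def by (rule emeasure_uniform_marginal(1)[OF r E])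
  have B: "?B \<in> sets ?M" by (rule coeff_box_sets[OF r])
  have C: "?C \<in> sets (completion ?M)" by (rule g_convex_coeffs_sets[OF d r])
  have N: "?N \<in> null_sets ?M" by (rule null_sets_UN) (rule null_sets_degenerate[OF d])
  have sp: "?B \<subseteq> space ?M" by (auto simp: space_PiM PiE_iff)
  have sub: "?C \<subseteq> (\<Union>j. ?B \<inter> X j) \<union> ?N"
  proof
    fix c assume c: "c \<in> ?C"
    then have cB: "c \<in> ?B" and cs: "c \<in> space ?M" using sp unfolding g_convex_coeffs_def by blast+
    show "c \<in> (\<Union>j. ?B \<inter> X j) \<union> ?N"
    proof (cases "c \<in> ?N")
      case False
      then have "\<And>j. \<not> degenerate d c j" using cs by blast
      then obtain j where j: "\<And>x y. x < y \<Longrightarrow> \<not> (poly (pderiv (axis_poly d c j)) x > 0 \<and> poly (pderiv (axis_poly d c j)) y < 0)"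
        using g_convex_coeffs_generic(2)[of d c] c unfolding g_convex_coeffs_def by blast
      define a where "a = (\<lambda>k\<in>{1..d}. c (Poly_Mapping.single j k))"
      have "a \<in> E"
      proof (rule noE)
        show "a \<in> space (Pi\<^sub>M {1..d} (\<lambda>_. unif r))" by (simp add: a_def space_PiM)
        fix x y :: real assume "x < y"
        have "poly (pderiv (axis_poly d c j)) z = (\<Sum>k\<in>{1..d}. real k * z ^ (k - 1) * a k)" for z
          unfolding poly_pderiv_axis_poly a_def by (rule sum.cong) auto
        then show "\<not> ((\<Sum>k\<in>{1..d}. real k * x ^ (k - 1) * a k) > 0 \<and> (\<Sum>k\<in>{1..d}. real k * y ^ (k - 1) * a k) < 0)"
          using j[OF \<open>x < y\<close>] by simp
      qed
      then have "c \<in> X j" using cs by (simp add: X_def a_def)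
      then show ?thesis using cB by blast
    qed blast
  qed
  have em_embed: "emeasure (sep_lebesgue d) (poly_of_coeffs d ` A) = emeasure (completion ?M) A"
    if "A \<in> sets (completion ?M)" for A
    unfolding sep_lebesgue_def by (rule emeasure_embed_measure_image'[OF inj_on_space_coeff that])
  have "emeasure (sep_uniform d r) (sep_polys d r \<inter> g_convex_polys d :: 'n rpoly set)
      = emeasure (sep_lebesgue d) (sep_polys d r \<inter> (sep_polys d r \<inter> g_convex_polys d) :: 'n rpoly set) / emeasure (sep_lebesgue d) (sep_polys d r :: 'n rpoly set)"
    unfolding sep_uniform_def
  proof (rule emeasure_uniform_measure)
    show "(sep_polys d r :: 'n rpoly set) \<in> sets (sep_lebesgue d)"
      unfolding sep_polys_coeff_box sep_lebesgue_def using B by (intro in_sets_embed_measure) auto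
    show "(sep_polys d r \<inter> g_convex_polys d :: 'n rpoly set) \<in> sets (sep_lebesgue d)"
      unfolding sep_g_convex_eq sep_lebesgue_def by (rule in_sets_embed_measure[OF C])
  qed
  also have "sep_polys d r \<inter> (sep_polys d r \<inter> g_convex_polys d) = poly_of_coeffs d ` ?C"
    using sep_g_convex_eq[of d r] by auto
  also have "emeasure (sep_lebesgue d) \<dots> = emeasure (completion ?M) ?C" by (rule em_embed[OF C])
  also have "emeasure (sep_lebesgue d) (sep_polys d r :: 'n rpoly set) = emeasure ?M ?B"
    unfolding sep_polys_coeff_box using B by (subst em_embed) auto
  also have "emeasure (completion ?M) ?C / emeasure ?M ?B \<le> (\<Sum>j\<in>UNIV. emeasure ?M (?B \<inter> X j)) / emeasure ?M ?B"
  proof (rule divide_right_mono_ennreal)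
    have sets: "(\<Union>j. ?B \<inter> X j) \<in> sets ?M" using B X by (intro sets.finite_UN) auto
    have "emeasure (completion ?M) ?C \<le> emeasure (completion ?M) ((\<Union>j. ?B \<inter> X j) \<union> ?N)"
      using sub sets N by (intro emeasure_mono) auto
    also have "\<dots> = emeasure ?M ((\<Union>j. ?B \<inter> X j) \<union> ?N)"
    proof -
      have "(\<Union>j. ?B \<inter> X j) \<union> ?N \<in> sets ?M" using sets N by (intro sets.Un) auto
      then show ?thesis by simp
    qed
    also have "\<dots> = emeasure ?M (\<Union>j. ?B \<inter> X j)" by (rule emeasure_Un_null_set[OF sets N])
    also have "\<dots> \<le> (\<Sum>j\<in>UNIV. emeasure ?M (?B \<inter> X j))"
      using B X by (intro emeasure_subadditive_finite) auto
    finally show "emeasure (completion ?M) ?C \<le> (\<Sum>j\<in>UNIV. emeasure ?M (?B \<inter> X j))" .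
  qed
  also have "\<dots> = (\<Sum>j\<in>UNIV. emeasure ?M (?B \<inter> X j) / emeasure ?M ?B)"
    by (simp add: divide_ennreal_def sum_distrib_right)
  also have "\<dots> = (\<Sum>j\<in>(UNIV :: 'n set). emeasure (Pi\<^sub>M {1..d} (\<lambda>_. unif r)) E)"
  proof (rule sum.cong[OF refl])
    fix j :: 'n
    show "emeasure ?M (?B \<inter> X j) / emeasure ?M ?B = emeasure (Pi\<^sub>M {1..d} (\<lambda>_. unif r)) E"
      using emeasure_uniform_marginal(2)[OF r E, of j] B X[of j] unfolding X_def[symmetric] by simp
  qed
  finally show ?thesis by simp
qed

lemma sep_g_convex_bigo:
  assumes r: "r > 0"
  shows "(\<lambda>d. measure (sep_uniform d r) (sep_polys d r \<inter> g_convex_polys d :: 'n::finite rpoly set)) \<in> O(\<lambda>d. 1 / ln (real d))"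
proof (rule bigoI[of _ "5 * real CARD('n)"])
  have "\<forall>\<^sub>F d in sequentially. d \<ge> (2::nat)" by (rule eventually_ge_at_top)
  with random_derivative_no_sign_change[OF r]
  show "\<forall>\<^sub>F d in sequentially. norm (measure (sep_uniform d r) (sep_polys d r \<inter> g_convex_polys d :: 'n rpoly set))
      \<le> 5 * real CARD('n) * norm (1 / ln (real d))"
  proof eventually_elim
    case (elim d)
    let ?P = "Pi\<^sub>M {1..d} (\<lambda>_. unif r)"
    have ln: "ln (real d) > 0" using elim(2) by simp
    obtain E where E: "E \<in> sets ?P" "emeasure ?P E \<le> ennreal (5 / ln (real d))"
      "\<forall>a\<in>space ?P. (\<forall>x y. x < y \<longrightarrow> \<not> ((\<Sum>k\<in>{1..d}. real k * x ^ (k - 1) * a k) > 0 \<and>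
                             (\<Sum>k\<in>{1..d}. real k * y ^ (k - 1) * a k) < 0)) \<longrightarrow> a \<in> E"
      using elim(1) by blast
    have "emeasure (sep_uniform d r) (sep_polys d r \<inter> g_convex_polys d :: 'n rpoly set) \<le> of_nat CARD('n) * emeasure ?P E"
      using elim(2) E by (intro emeasure_sep_g_convex_le r) auto
    also have "\<dots> \<le> of_nat CARD('n) * ennreal (5 / ln (real d))" by (intro mult_left_mono E) simp
    also have "\<dots> = ennreal (real CARD('n) * (5 / ln (real d)))"
      by (simp only: ennreal_of_nat_eq_real_of_nat ennreal_mult'[OF of_nat_0_le_iff])
    finally have "measure (sep_uniform d r) (sep_polys d r \<inter> g_convex_polys d :: 'n rpoly set) \<le> real CARD('n) * (5 / ln (real d))"
      unfolding measure_def using ln by (intro enn2real_leI) auto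
    then show ?case using ln by (simp add: mult_ac)
  qed
qed

section \<open>Dimension of the set of g-convex separable polynomials\<close>

lemma continuous_on_if_coordinate:
  "continuous_on UNIV (\<lambda>x. \<lambda>i. if P i then x (f i) else (0::real))"
proof (rule continuous_on_coordinatewise_then_product)
  show "continuous_on UNIV (\<lambda>x. if P i then x (f i) else (0::real))" for i
    by (cases "P i") simp_all
qed

lemma topspace_coeff_topology: "topspace (coeff_topology :: 'n::finite rpoly topology) = UNIV"
  by (simp add: coeff_topology_def topspace_pullback_topology)

lemma continuous_map_lookup: "continuous_map coeff_topology euclidean (Poly_Mapping.lookup :: 'n::finite rpoly \<Rightarrow> _)"
  unfolding coeff_topology_def continuous_map_def
  by (auto simp: topspace_pullback_topology openin_pullback_topology)

lemma card_sep_monoms: "card (sep_monoms d :: ('n::finite \<Rightarrow>\<^sub>0 nat) set) = CARD('n) * d + 1"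
proof -
  let ?s = "\<lambda>(j::'n, k::nat). Poly_Mapping.single j k"
  have "card (?s ` (UNIV \<times> {1..d})) = card ((UNIV :: 'n set) \<times> {1..d})"
    by (rule card_image) (auto simp: inj_on_def single_eq_iff)
  then show ?thesis unfolding sep_monoms_eq_insert
    by (subst card_insert_disjoint[OF _ zero_notin_singles]) (auto simp: card_cartesian_product)
qed

lemma sep_polys_infI:
  assumes "\<And>m. m \<in> sep_monoms d \<Longrightarrow> \<bar>c m\<bar> \<le> r" "r > 0"
  shows "poly_of_coeffs d c \<in> (sep_polys_inf d :: 'n::finite rpoly set)"
proof -
  let ?c = "restrict c (sep_monoms d)"
  have "r * 1 \<le> r * real CARD('n)" using assms(2) by (intro mult_left_mono) auto
  then have "?c \<in> Pi\<^sub>E (sep_monoms d) (coeff_box r :: ('n \<Rightarrow>\<^sub>0 nat) \<Rightarrow> _)"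
    using assms(1) by (fastforce simp: coeff_box_def abs_le_iff mult.commute)
  then have "poly_of_coeffs d ?c \<in> sep_polys d r" unfolding sep_polys_coeff_box by blast
  moreover have "poly_of_coeffs d ?c = poly_of_coeffs d c"
    by (rule poly_mapping_eqI) (simp add: lookup_poly_of_coeffs)
  ultimately show ?thesis unfolding sep_polys_inf_def using assms(2) by auto
qed

lemma lookup_sep_polys_inf: "p \<in> sep_polys_inf d \<Longrightarrow> m \<notin> sep_monoms d \<Longrightarrow> Poly_Mapping.lookup p m = 0"
  by (auto simp: sep_polys_inf_def sep_polys_coeff_box lookup_poly_of_coeffs)

text \<open>Enumerating the monomials embeds the set into N-space, which bounds the dimension above.
  For the lower bound, the cube of side \<open>\<epsilon>\<close> with corner \<open>c0\<close>
  consists of good coefficients, and clamping retracts the set onto it.\<close>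

lemma covering_dim_sep_g_convex:
  assumes d: "d \<ge> 1"
  shows "covering_dim (subtopology coeff_topology (sep_polys_inf d \<inter> g_convex_polys d :: 'n::finite rpoly set))
    = ereal (real (CARD('n) * d + 1))"
proof -
  define A where "A = (sep_polys_inf d \<inter> g_convex_polys d :: 'n rpoly set)"
  define N where "N = CARD('n) * d + 1"
  let ?K = "sep_monoms d :: ('n \<Rightarrow>\<^sub>0 nat) set"
  obtain e where e: "bij_betw e {..<N} ?K"
    using ex_bij_betw_nat_finite[OF finite_sep_monoms[of d]] unfolding card_sep_monoms N_def atLeast0LessThan by blast
  define e' where "e' = inv_into {..<N} e"
  have e': "e' m < N" "e (e' m) = m" if "m \<in> ?K" for m
    using that e unfolding e'_def by (auto simp: bij_betw_def inv_into_into f_inv_into_f intro: inv_into_into[of _ e "{..<N}", simplified])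
  have ee: "e i \<in> ?K" "e' (e i) = i" if "i < N" for i
    using that e unfolding e'_def by (auto simp: bij_betw_def)
  define coord where "coord w = (\<lambda>i. if i < N then w (e i) else 0)" for w :: "('n \<Rightarrow>\<^sub>0 nat) \<Rightarrow> real"
  define \<psi> where "\<psi> y = (\<lambda>m. if m \<in> ?K then y (e' m) else 0)" for y :: "nat \<Rightarrow> real"
  have coord_cont: "continuous_on UNIV coord" unfolding coord_def[abs_def] by (rule continuous_on_if_coordinate)
  have \<psi>_cont: "continuous_on UNIV \<psi>" unfolding \<psi>_def[abs_def] by (rule continuous_on_if_coordinate)
  have \<psi>coord: "\<psi> (coord (Poly_Mapping.lookup p)) = Poly_Mapping.lookup p" if "p \<in> A" for p
    using that e' lookup_sep_polys_inf unfolding A_def by (fastforce simp: \<psi>_def coord_def)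
  let ?X = "subtopology coeff_topology A"
  have X_top: "topspace ?X = A" by (simp add: topspace_coeff_topology)
  have upper: "covering_dim_le ?X (int N)"
  proof (rule covering_dim_le_embedding[of _ "\<lambda>p. coord (Poly_Mapping.lookup p)"])
    fix U assume "openin ?X U"
    then obtain V where V: "open V" "U = Poly_Mapping.lookup -` V \<inter> A"
      by (auto simp: openin_subtopology coeff_topology_def openin_pullback_topology)
    have "U = {p \<in> topspace ?X. coord (Poly_Mapping.lookup p) \<in> \<psi> -` V}"
      unfolding X_top V(2) using \<psi>coord by auto
    then show "\<exists>G. open G \<and> U = {p \<in> topspace ?X. coord (Poly_Mapping.lookup p) \<in> G}"
      using open_vimage[OF V(1) \<psi>_cont] by blast
  next
    fix G :: "(nat \<Rightarrow> real) set" assume "open G"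
    then have "open (coord -` G)" by (rule open_vimage[OF _ coord_cont])
    then show "openin ?X {p \<in> topspace ?X. coord (Poly_Mapping.lookup p) \<in> G}"
      unfolding X_top openin_subtopology coeff_topology_def openin_pullback_topology
      by (intro exI[of _ "Poly_Mapping.lookup -` (coord -` G)"]) (auto simp: topspace_pullback_topology)
  qed (simp add: coord_def)
  define \<epsilon> where "\<epsilon> = 1 / (4 * real d ^ 3)"
  have \<epsilon>: "\<epsilon> > 0" "\<epsilon> * (4 * real d ^ 3) \<le> 1" "\<epsilon> \<le> 1"
  proof -
    have "1 \<le> real d ^ 3" using d by (intro one_le_power) simp
    then have "1 \<le> 4 * real d ^ 3" by linarith
    then show "\<epsilon> > 0" "\<epsilon> * (4 * real d ^ 3) \<le> 1" "\<epsilon> \<le> 1"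
      using d by (simp_all add: \<epsilon>_def)
  qed
  \<comment> \<open>The coefficients of the sum over all axes of \<open>x + x^d\<close> for odd
    \<open>d\<close> and \<open>x^2 + x^d\<close> for even \<open>d\<close>, coinciding monomials
    counted once.\<close>
  define c0 :: "('n \<Rightarrow>\<^sub>0 nat) \<Rightarrow> real" where
    "c0 m = (if \<exists>j k. m = Poly_Mapping.single j k \<and> k \<noteq> 0 \<and> (k = d \<or> k = (if odd d then 1 else 2)) then 1 else 0)" for m
  have c0: "c0 (Poly_Mapping.single j k) = (if k = d \<or> k = (if odd d then 1 else 2) then 1 else 0)" if "k \<in> {1..d}" for j k
  proof -
    have "(\<exists>j' k'. Poly_Mapping.single j k = Poly_Mapping.single j' k' \<and> k' \<noteq> 0 \<and> P k') \<longleftrightarrow> P k" for P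
    proof
      assume "\<exists>j' k'. Poly_Mapping.single j k = Poly_Mapping.single j' k' \<and> k' \<noteq> 0 \<and> P k'"
      then obtain j' k' where eq: "Poly_Mapping.single j k = Poly_Mapping.single j' k'" "k' \<noteq> 0" "P k'" by blast
      then show "P k" using single_eq_iff[OF eq(2), of j k j'] by simp
    next
      assume "P k"
      then show "\<exists>j' k'. Poly_Mapping.single j k = Poly_Mapping.single j' k' \<and> k' \<noteq> 0 \<and> P k'"
        using that by (intro exI[of _ j] exI[of _ k]) auto
    qed
    then show ?thesis unfolding c0_def by presburger
  qed
  define cc where "cc x m = c0 m + \<epsilon> * \<psi> x m" for x m
  have lower: "int N \<le> k" if "covering_dim_le ?X k" for k
  proof (rule covering_dim_le_cube_retract[OF _ _ _ that])
    \<comment> \<open>Clamping the rescaled coordinates is continuous on all coefficient vectors, so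
      it restricts to \<open>A\<close> whatever its shape.\<close>
    define cl where "cl t = max 0 (min 1 t)" for t :: real
    define retr where "retr w = (\<lambda>i. if i < N then cl ((w (e i) - c0 (e i)) / \<epsilon>) else 0)" for w :: "('n \<Rightarrow>\<^sub>0 nat) \<Rightarrow> real"
    have "continuous_on UNIV retr"
      unfolding retr_def[abs_def]
    proof (rule continuous_on_coordinatewise_then_product)
      show "continuous_on UNIV (\<lambda>w. if i < N then cl ((w (e i) - c0 (e i)) / \<epsilon>) else 0)" for i
        unfolding cl_def by (cases "i < N") (use \<epsilon>(1) in \<open>auto intro!: continuous_intros\<close>)
    qed
    then have "continuous_map coeff_topology euclidean (retr \<circ> Poly_Mapping.lookup)"
      using continuous_map_lookup by (intro continuous_map_compose[where X' = euclidean]) auto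
    then have "continuous_map ?X euclidean (retr \<circ> Poly_Mapping.lookup)" by (rule continuous_map_from_subtopology)
    moreover have "retr w \<in> unit_cube N" for w by (auto simp: retr_def unit_cube_def cl_def)
    ultimately show "continuous_map ?X (top_of_set (unit_cube N)) (retr \<circ> Poly_Mapping.lookup)"
      by (auto simp: continuous_map_in_subtopology)
    have in_A: "poly_of_coeffs d (cc x) \<in> A" if x: "x \<in> unit_cube N" for x
    proof -
      have \<psi>x: "0 \<le> \<psi> x m \<and> \<psi> x m \<le> 1" for m
        using x e'(1) by (auto simp: \<psi>_def unit_cube_def)
      have pert: "\<bar>cc x m - c0 m\<bar> \<le> \<epsilon>" for m
        using \<psi>x[of m] \<epsilon>(1) by (simp add: cc_def abs_mult mult_left_le)
      have "good_coeffs d (cc x)"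
      proof (rule good_coeffs_cube[OF d \<epsilon>(2)])
        show "0 \<le> \<epsilon>" using \<epsilon>(1) by simp
        fix j :: 'n and k assume "k \<in> {1..d}"
        then show "\<bar>cc x (Poly_Mapping.single j k) - (if k = d \<or> k = (if odd d then 1 else 2) then 1 else 0)\<bar> \<le> \<epsilon>"
          using pert[of "Poly_Mapping.single j k"] c0[of k j] by simp
      qed
      then have "poly_of_coeffs d (cc x) \<in> g_convex_polys d" by (rule good_coeffs_g_convex)
      moreover have "\<bar>cc x m\<bar> \<le> 2" for m using pert[of m] \<epsilon>(3) by (auto simp: c0_def split: if_splits)
      ultimately show ?thesis unfolding A_def by (auto intro!: sep_polys_infI[where r = 2])
    qed
    show "continuous_map (top_of_set (unit_cube N)) ?X (\<lambda>x. poly_of_coeffs d (cc x))"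
      unfolding continuous_map_in_subtopology
    proof
      have lk: "Poly_Mapping.lookup (poly_of_coeffs d (cc x)) = (\<lambda>m. if m \<in> ?K then c0 m + \<epsilon> * x (e' m) else 0)" for x
        by (auto simp: lookup_poly_of_coeffs cc_def \<psi>_def)
      have "continuous_on UNIV (\<lambda>x. Poly_Mapping.lookup (poly_of_coeffs d (cc x)))"
        unfolding lk
      proof (rule continuous_on_coordinatewise_then_product)
        show "continuous_on UNIV (\<lambda>x. if m \<in> ?K then c0 m + \<epsilon> * x (e' m) else 0)" for m
          by (cases "m \<in> ?K") (auto intro!: continuous_intros)
      qed
      then have op: "open ((\<lambda>x. Poly_Mapping.lookup (poly_of_coeffs d (cc x))) -` V)" if "open V" for V
        using that by (simp add: open_vimage)
      show "continuous_map (top_of_set (unit_cube N)) coeff_topology (\<lambda>x. poly_of_coeffs d (cc x))"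
        unfolding continuous_map_def
      proof (intro conjI allI impI)
        fix U :: "'n rpoly set" assume "openin coeff_topology U"
        then obtain V where V: "open V" "U = Poly_Mapping.lookup -` V"
          by (auto simp: coeff_topology_def openin_pullback_topology)
        have "{x \<in> topspace (top_of_set (unit_cube N)). poly_of_coeffs d (cc x) \<in> U}
            = unit_cube N \<inter> (\<lambda>x. Poly_Mapping.lookup (poly_of_coeffs d (cc x))) -` V"
          by (auto simp: V(2))
        then show "openin (top_of_set (unit_cube N)) {x \<in> topspace (top_of_set (unit_cube N)). poly_of_coeffs d (cc x) \<in> U}"
          using op[OF V(1)] by (simp add: openin_open_Int)
      qed (simp add: topspace_coeff_topology)
      show "(\<lambda>x. poly_of_coeffs d (cc x)) \<in> topspace (top_of_set (unit_cube N)) \<rightarrow> A" using in_A by auto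
    qed
    show "(retr \<circ> Poly_Mapping.lookup) (poly_of_coeffs d (cc x)) = x" if x: "x \<in> unit_cube N" for x
    proof
      fix i
      show "(retr \<circ> Poly_Mapping.lookup) (poly_of_coeffs d (cc x)) i = x i"
        using x ee[of i] \<epsilon>(1)
        by (cases "i < N") (auto simp: retr_def lookup_poly_of_coeffs cc_def \<psi>_def cl_def unit_cube_def)
    qed
  qed
  show ?thesis using covering_dim_eqI[OF upper lower] unfolding A_def N_def by simp
qed

theorem theorem8p5:
  shows "(\<forall>d\<ge>1.
            covering_dim (subtopology coeff_topology
               (sep_polys_inf d \<inter> g_convex_polys d :: 'n::finite rpoly set))
            = ereal (real (CARD('n) * d + 1))) \<and>
         (\<forall>r>0.
            (\<forall>d\<ge>1. sep_polys d r \<inter> g_convex_polys d \<in> sets (sep_uniform d r :: 'n rpoly measure)) \<and>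
            (\<lambda>d. measure (sep_uniform d r) (sep_polys d r \<inter> g_convex_polys d :: 'n rpoly set))
              \<in> O(\<lambda>d. 1 / ln (real d)))"
  using covering_dim_sep_g_convex sep_g_convex_sets sep_g_convex_bigo by blast

end
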